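(* Let $n\geq 1$ be an integer and let $P\subset\mathbb{R}^n$ be an $n$-dimensional convex polytope with $0\in\operatorname{int}P$. Suppose that for every $k\in\{1,\ldots,n\}$ and every nonempty proper face $F$ of $P$ of codimension $k$ (that is, $\dim F=n-k$) one has $$\operatorname{dist}(0,\operatorname{aff}F)\geq\sqrt{k}.$$ Then $$\mathcal{H}^{n-1}(\partial P)\geq n2^n.$$ The constant $n2^n$ is sharp, as is seen by taking $P=[-1,1]^n$ (which satisfies the hypotheses and gives equality).
   Context: A polytope means a compact convex polyhedron. $\operatorname{aff}F$ denotes the affine hull of $F$, $\operatorname{dist}$ is Euclidean distance, and $\mathcal{H}^{n-1}$ is $(n-1)$-dimensional Hausdorff measure (normalized to agree with Euclidean $(n-1)$-volume on $(n-1)$-dimensional affine subspaces; $\mathcal{H}^0$ is counting measure). *)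

theory Defs
  imports "HOL-Analysis.Analysis"
begin

text \<open>
  The standard \<open>m\<close>-dimensional Hausdorff measure, as an outer measure on all subsets of a metric
  space.  The factor \<open>unit_ball_vol m / 2 ^ m\<close> is the usual normalization, for which it agrees with
  Euclidean \<open>m\<close>-volume on \<open>m\<close>-dimensional affine subspaces.  Nonempty sets must have cost \<open>1\<close> and
  the empty set cost \<open>0\<close> when \<open>m = 0\<close> (counting measure), hence the case distinction.  The covering
  sets are required to be bounded because \<^const>\<open>diameter\<close> is meaningless for unbounded sets.
\<close>

definition hausdorff_cost :: "nat \<Rightarrow> 'a::metric_space set \<Rightarrow> ennreal" where
  "hausdorff_cost m U =
     (if U = {} then 0 else ennreal (unit_ball_vol (real m) * (diameter U / 2) ^ m))"

definition hausdorff_premeasure :: "nat \<Rightarrow> real \<Rightarrow> 'a::metric_space set \<Rightarrow> ennreal" where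
  "hausdorff_premeasure m \<delta> A =
     Inf {(\<Sum>i. hausdorff_cost m (U i)) | U :: nat \<Rightarrow> 'a set.
            A \<subseteq> (\<Union>i. U i) \<and> (\<forall>i. bounded (U i) \<and> diameter (U i) \<le> \<delta>)}"

definition hausdorff_measure :: "nat \<Rightarrow> 'a::metric_space set \<Rightarrow> ennreal" where
  "hausdorff_measure m A = (SUP \<delta>\<in>{0<..}. hausdorff_premeasure m \<delta> A)"

definition sqrt_codim_polytope :: "(real ^ 'n) set \<Rightarrow> bool" where
  "sqrt_codim_polytope P \<longleftrightarrow>
     polytope P \<and> aff_dim P = int CARD('n) \<and> 0 \<in> interior P \<and>
     (\<forall>k\<in>{1..CARD('n)}. \<forall>F. F face_of P \<and> F \<noteq> {} \<and> F \<noteq> P \<and>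
        aff_dim F = int CARD('n) - int k \<longrightarrow> infdist 0 (affine hull F) \<ge> sqrt (real k))"

end

theory Submission
  imports Defs
begin

text \<open>
The lower bound compares the polytope \<open>P\<close> with the cube one simplex at a time.  A flag
\<open>P = F\<^sub>0 \<supset> F\<^sub>1 \<supset> \<dots> \<supset> F\<^sub>n\<close>, each \<open>F\<^sub>k\<^sub>+\<^sub>1\<close> a facet of \<open>F\<^sub>k\<close>, has the points \<open>p\<^sub>k\<close> of \<open>F\<^sub>k\<close> nearest
to the origin, so \<open>p\<^sub>0 = 0\<close>.  The simplices \<open>conv {p\<^sub>0, \<dots>, p\<^sub>n}\<close>, over all flags with
\<open>p\<^sub>k \<notin> F\<^sub>k\<^sub>+\<^sub>1\<close>, triangulate \<open>P\<close>: they are the result of coning each face over its nearest point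
(\<open>flag_simplices_cover\<close>, \<open>flag_simplices_overlap\<close>).  Nearest points satisfy
\<open>p\<^sub>i \<bullet> p\<^sub>j \<ge> p\<^sub>i \<bullet> p\<^sub>i\<close> for \<open>i \<le> j\<close>, and the distance hypothesis makes this at least \<open>i\<close>.  For the
cube these are equalities, with \<open>q\<^sub>k = e\<^sub>1 + \<dots> + e\<^sub>k\<close> for \<open>p\<^sub>k\<close>.  Hence the linear map sending
\<open>p\<^sub>k\<close> to \<open>q\<^sub>k\<close> does not increase norms on the cone spanned by the \<open>p\<^sub>k\<close>, and it sends the part of a
ball \<open>B\<close> in this cone into the same ball intersected with one of the \<open>2\<^sup>n n!\<close> congruent chambers of
the cube.  Comparing volumes, a simplex \<open>T\<close> of the triangulation has
\<open>2\<^sup>n vol (B \<inter> T) \<le> vol T \<cdot> vol B\<close>.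

This idea, due to Rogers, would give \<open>vol P \<ge> 2\<^sup>n\<close>.  For the surface area the estimate has to be
better by the height \<open>h\<close> of the hyperplane of \<open>F\<^sub>1\<close>, since the face of \<open>T\<close> opposite to the origin
has area \<open>n vol T / h\<close>.  The gain comes from replacing \<open>p\<^sub>1\<close> by \<open>p\<^sub>1 / |p\<^sub>1|\<close>: the inner products
still dominate those of the \<open>q\<^sub>k\<close> because \<open>|p\<^sub>1| \<ge> 1\<close>, while the determinant is divided by
\<open>|p\<^sub>1| \<ge> h\<close>.  So \<open>|p\<^sub>1| 2\<^sup>n vol (B \<inter> T) \<le> vol T \<cdot> vol B\<close> (\<open>simplex_ball_comparison\<close>), and
summing over the flags, with \<open>B \<subseteq> P\<close>, the facets have total area at least \<open>n 2\<^sup>n\<close>.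

The link between Hausdorff measure and area is the isodiametric inequality, obtained here from the
Prekopa-Leindler inequality.  By slicing, it bounds the volume of the cone from the origin over a
subset \<open>U\<close> of a hyperplane at distance \<open>h\<close> by \<open>h / n\<close> times the cost of \<open>U\<close>
(\<open>emeasure_cone_over_hyperplane\<close>).  A cover of the boundary by small sets therefore costs at least
\<open>n / h\<close> times the volume of the cone over each facet, summed over the facets.

For the cube, the lower bound applies because on a face of codimension \<open>k\<close> at least \<open>k\<close>
coordinates are constantly \<open>1\<close> or \<open>- 1\<close>.  For the upper bound, the Vitali covering theorem covers
the solid cube by small balls of total volume close to \<open>2\<^sup>n\<close>.  On average over \<open>t\<close>, the slices of
these balls by \<open>x\<^sub>i = t\<close> have total cost close to \<open>2\<^sup>n\<^sup>-\<^sup>1\<close>, so some slice of the cube, which is a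
translate of a facet, has a cover of that cost (\<open>exists_cheap_slice\<close>).
\<close>

abbreviation vol :: "'a::euclidean_space set \<Rightarrow> ennreal" where
  "vol \<equiv> emeasure lborel"

abbreviation lmeas :: "'a::euclidean_space set \<Rightarrow> real" where
  "lmeas \<equiv> measure lebesgue"

section \<open>The isodiametric inequality\<close>

text \<open>
Inside a large ball Lebesgue measure is finite, hence inner regular.
\<close>

lemma lborel_inner_compact:
  fixes S :: "'a::euclidean_space set"
  assumes S: "S \<in> sets borel" and c: "c < vol S"
  shows "\<exists>K. compact K \<and> K \<subseteq> S \<and> c < vol K"
proof -
  define T where "T n = cball 0 (real n) \<inter> S" for n
  have "incseq T" by (force simp: T_def incseq_def)
  moreover have "(\<Union>n. T n) = S" by (auto simp: T_def real_arch_simple)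
  moreover have "range T \<subseteq> sets lborel" using S by (auto simp: T_def)
  ultimately have "vol S = (SUP n. vol (T n))" by (metis SUP_emeasure_incseq)
  then obtain n where n: "c < vol (T n)" using c by (auto simp: less_SUP_iff)
  define M where "M = density lborel (indicator (cball 0 (real n)) :: 'a \<Rightarrow> ennreal)"
  have M: "emeasure M B = vol (cball 0 (real n) \<inter> B)" if "B \<in> sets borel" for B
    unfolding M_def using that by (subst emeasure_restricted) auto
  have "vol (cball 0 (real n) :: 'a set) < \<infinity>"
    by (rule emeasure_bounded_finite) simp
  then have "emeasure M (space M) \<noteq> \<infinity>"
    using M[of UNIV] by (simp add: M_def)
  then have "emeasure M S = (SUP K\<in>{K. K \<subseteq> S \<and> compact K}. emeasure M K)"
    by (intro inner_regular) (auto simp: M_def S)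
  with n S have "c < (SUP K\<in>{K. K \<subseteq> S \<and> compact K}. emeasure M K)" by (simp add: M T_def)
  then obtain K where K: "K \<subseteq> S" "compact K" "c < emeasure M K" by (auto simp: less_SUP_iff)
  have "emeasure M K \<le> vol K"
    using K(2) by (simp add: M borel_compact emeasure_mono)
  with K show ?thesis by (meson order.strict_trans2)
qed

text \<open>
By inner regularity it suffices to treat compact \<open>K \<subseteq> A\<close> and \<open>L \<subseteq> B\<close>.  With \<open>k = max K\<close> and
\<open>l = min L\<close>, the translates \<open>l + K\<close> and \<open>k + L\<close> both lie in \<open>K + L\<close>, hence in \<open>2 C\<close>, and they
meet only in \<open>k + l\<close>.  Asking for a measurable superset \<open>C\<close> of the midpoints avoids the question
whether the sum of two Borel sets is measurable.
\<close>

lemma one_dim_brunn_minkowski: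
  fixes A B C :: "real set"
  assumes [measurable]: "A \<in> sets borel" "B \<in> sets borel" "C \<in> sets borel"
    and "A \<noteq> {}" "B \<noteq> {}"
    and sub: "\<And>x y. x \<in> A \<Longrightarrow> y \<in> B \<Longrightarrow> (x + y) / 2 \<in> C"
  shows "vol A + vol B \<le> 2 * vol C"
proof -
  have cpt: "vol K + vol L \<le> 2 * vol C"
    if K: "compact K" "K \<subseteq> A" and L: "compact L" "L \<subseteq> B" and ne: "K \<noteq> {}" "L \<noteq> {}" for K L
  proof -
    obtain k where k: "k \<in> K" "\<And>x. x \<in> K \<Longrightarrow> x \<le> k" using compact_attains_sup[OF K(1) ne(1)] by auto
    obtain l where l: "l \<in> L" "\<And>x. x \<in> L \<Longrightarrow> l \<le> x" using compact_attains_inf[OF L(1) ne(2)] by auto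
    define K' L' where "K' = (+) l ` K" and "L' = (+) k ` L"
    have cK: "compact K'" "compact L'" unfolding K'_def L'_def using K L by (auto intro!: compact_translation)
    then have [measurable]: "K' \<in> sets borel" "L' \<in> sets borel" by (auto intro: borel_compact)
    have mK: "vol K' = vol K" "vol L' = vol L"
    proof -
      have tr: "vol ((+) c ` S) = vol S" if "S \<in> sets borel" for c and S :: "real set"
      proof -
        have "vol ((+) c ` S) = emeasure (distr lborel borel ((+) (-c))) S"
          using that by (subst emeasure_distr) (auto intro!: arg_cong[where f = "vol"] image_eqI[where x = "_ - c"])
        then show ?thesis by (simp add: lborel_distr_plus)
      qed
      show "vol K' = vol K" "vol L' = vol L"
        unfolding K'_def L'_def using K L by (auto intro!: tr borel_compact)
    qed
    have int: "K' \<inter> L' \<subseteq> {k + l}"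
      using k l by (force simp: K'_def L'_def)
    have [measurable]: "(*) (1/2) -` C \<in> sets (borel :: real measure)"
      by (rule measurable_sets_borel[OF _ assms(3)]) auto
    have "vol K + vol L = vol K' + vol L'" by (simp add: mK)
    also have "\<dots> = vol (K' \<union> L') + vol (K' \<inter> L')"
      using emeasure_Un_Int[of K' lborel L'] by simp
    also have "vol (K' \<inter> L') = 0"
      using emeasure_mono[OF int, of lborel] by simp
    also have "vol (K' \<union> L') + 0 \<le> vol ((*) (1/2) -` C)"
      using sub K L k l by (auto simp: K'_def L'_def add.commute intro!: emeasure_mono) (metis add.commute subsetD)+
    also have "\<dots> = emeasure (distr lborel borel ((*) (1/2))) C"
      by (subst emeasure_distr) auto
    also have "\<dots> = 2 * vol C"
      by (subst lborel_distr_mult) (auto simp: emeasure_density nn_integral_cmult)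
    finally show ?thesis .
  qed
  have approx: "\<exists>K. (\<forall>n::nat. compact (K n) \<and> K n \<noteq> {} \<and> K n \<subseteq> S) \<and> (\<lambda>n. vol (K n)) \<longlonglongrightarrow> vol S"
    if S: "S \<in> sets borel" "S \<noteq> {}" for S :: "real set"
  proof -
    let ?\<K> = "{K. compact K \<and> K \<noteq> {} \<and> K \<subseteq> S}"
    obtain x where "x \<in> S" using S(2) by blast
    then have ne: "vol ` ?\<K> \<noteq> {}" by (auto intro!: exI[of _ "{x}"])
    from ennreal_Sup_countable_SUP[OF ne] obtain f :: "nat \<Rightarrow> ennreal"
      where f: "incseq f" "range f \<subseteq> vol ` ?\<K>" "Sup (vol ` ?\<K>) = (SUP n. f n)" by auto
    have "Sup (vol ` ?\<K>) = vol S"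
    proof (rule antisym)
      show "Sup (vol ` ?\<K>) \<le> vol S" using S(1) by (auto intro!: SUP_least emeasure_mono)
      show "vol S \<le> Sup (vol ` ?\<K>)"
      proof (rule dense_le)
        fix c assume "c < vol S"
        from lborel_inner_compact[OF S(1) this] obtain K where K: "compact K" "K \<subseteq> S" "c < vol K" by blast
        then have "K \<in> ?\<K>" by auto
        then show "c \<le> Sup (vol ` ?\<K>)" using K(3) by (auto intro: order_trans[OF less_imp_le SUP_upper])
      qed
    qed
    then have lim: "f \<longlonglongrightarrow> vol S" using LIMSEQ_SUP[OF f(1)] f(3) by simp
    have "\<forall>n. \<exists>K. K \<in> ?\<K> \<and> f n = vol K" using f(2) by blast
    from choice[OF this] obtain K where K: "\<forall>n. K n \<in> ?\<K> \<and> f n = vol (K n)" ..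
    then have "f = (\<lambda>n. vol (K n))" by auto
    with K lim show ?thesis by (intro exI[of _ K]) auto
  qed
  from approx[OF assms(1,4)] obtain K
    where K: "\<And>n. compact (K n)" "\<And>n. K n \<noteq> {}" "\<And>n. K n \<subseteq> A" "(\<lambda>n. vol (K n)) \<longlonglongrightarrow> vol A" by blast
  from approx[OF assms(2,5)] obtain L
    where L: "\<And>n. compact (L n)" "\<And>n. L n \<noteq> {}" "\<And>n. L n \<subseteq> B" "(\<lambda>n. vol (L n)) \<longlonglongrightarrow> vol B" by blast
  have "vol (K n) + vol (L n) \<le> 2 * vol C" for n
    by (intro cpt K(1-3) L(1-3))
  then show ?thesis by (intro LIMSEQ_le_const2[OF tendsto_add[OF K(4) L(4)]]) blast
qed

text \<open>
Fubini for the region below the graph.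
\<close>

lemma layer_cake_below_1:
  fixes f :: "real \<Rightarrow> ennreal"
  assumes [measurable]: "f \<in> borel_measurable borel" and "\<And>x. f x \<le> 1"
  shows "(\<integral>\<^sup>+x. f x \<partial>lborel) =
    (\<integral>\<^sup>+t. indicator {0..<1} t * vol {x. ennreal t < f x} \<partial>lborel)"
proof -
  have fx: "f x = (\<integral>\<^sup>+t. indicator {0..<1} t * indicator {x. ennreal t < f x} x \<partial>lborel)" for x
  proof -
    obtain r where r: "0 \<le> r" "f x = ennreal r" using assms(2)[of x]
      by (cases "f x") (auto simp: top_unique)
    have r1: "r \<le> 1" using r assms(2)[of x] by simp
    have "(\<integral>\<^sup>+t. indicator {0..<1} t * indicator {x. ennreal t < f x} x \<partial>lborel)
        = (\<integral>\<^sup>+t. indicator {0..<r} t \<partial>(lborel::real measure))"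
      using r r1 by (intro nn_integral_cong) (auto simp: indicator_def ennreal_less_iff)
    also have "\<dots> = ennreal r" using r by simp
    finally show ?thesis using r by simp
  qed
  have "(\<integral>\<^sup>+x. f x \<partial>lborel) = (\<integral>\<^sup>+x. \<integral>\<^sup>+t. indicator {0..<1} t * indicator {x. ennreal t < f x} x \<partial>lborel \<partial>lborel)"
    by (intro nn_integral_cong fx)
  also have "\<dots> = (\<integral>\<^sup>+t. \<integral>\<^sup>+x. indicator {0..<1} t * indicator {x. ennreal t < f x} x \<partial>lborel \<partial>lborel)"
    by (rule lborel_pair.Fubini') measurable
  also have "\<dots> = (\<integral>\<^sup>+t. indicator {0..<1} t * vol {x. ennreal t < f x} \<partial>lborel)"
    by (intro nn_integral_cong) (simp add: nn_integral_cmult)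
  finally show ?thesis .
qed

text \<open>
The inequality between the arithmetic and the geometric mean.
\<close>

lemma ennreal_prod_le_square:
  fixes a b c :: ennreal
  assumes "a + b \<le> 2 * c"
  shows "a * b \<le> c * c"
proof (cases "c = \<infinity>")
  case True
  then show ?thesis by (simp add: ennreal_top_mult)
next
  case False
  then have fin: "a \<noteq> \<infinity>" "b \<noteq> \<infinity>" using assms
    by (auto simp: ennreal_mult_eq_top_iff top_unique)
  obtain x y z where xyz: "a = ennreal x" "b = ennreal y" "c = ennreal z" "0 \<le> x" "0 \<le> y" "0 \<le> z"
    using fin False by (metis ennreal_cases infinity_ennreal_def)
  have "ennreal (x + y) \<le> ennreal (2 * z)" using assms xyz
    by (simp add: ennreal_mult)
  then have le: "x + y \<le> 2 * z" using xyz by (simp del: ennreal_plus)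
  have "4 * (x * y) \<le> (x + y) * (x + y)" using zero_le_square[of "x - y"] by (simp add: algebra_simps)
  also have "\<dots> \<le> (2 * z) * (2 * z)" using le xyz by (intro mult_mono) auto
  finally have "x * y \<le> z * z" by simp
  then show ?thesis using xyz by (simp flip: ennreal_mult)
qed

lemma ennreal_le_of_square_le:
  fixes a b :: ennreal
  assumes "a * a \<le> b * b"
  shows "a \<le> b"
proof (cases "b = \<infinity>")
  case False
  then have "a \<noteq> \<infinity>" using assms by (auto simp: ennreal_mult_eq_top_iff top_unique)
  then obtain x y where xy: "a = ennreal x" "b = ennreal y" "0 \<le> x" "0 \<le> y"
    using False by (metis ennreal_cases infinity_ennreal_def)
  then have "x * x \<le> y * y" using assms by (simp flip: ennreal_mult)
  then have "x \<le> y" using xy power2_le_imp_le by (metis power2_eq_square)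
  then show ?thesis using xy by (simp add: ennreal_leI)
qed simp

text \<open>
When both suprema are \<open>1\<close>, the superlevel sets of \<open>f\<close> and \<open>g\<close> at a level \<open>t < 1\<close> are nonempty and
their midpoints lie in the superlevel set of \<open>h\<close>.  Integrating the one-dimensional Brunn-Minkowski
inequality over \<open>t\<close> gives the claim.
\<close>

lemma prekopa_leindler_sup_1:
  fixes f g h :: "real \<Rightarrow> ennreal"
  assumes [measurable]: "f \<in> borel_measurable borel" "g \<in> borel_measurable borel" "h \<in> borel_measurable borel"
    and le: "\<And>x. f x \<le> 1" "\<And>x. g x \<le> 1"
    and sup: "\<And>t. t < 1 \<Longrightarrow> \<exists>x. t < f x" "\<And>t. t < 1 \<Longrightarrow> \<exists>x. t < g x"
    and fgh: "\<And>x y. f x * g y \<le> h ((x + y) / 2) * h ((x + y) / 2)"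
  shows "(\<integral>\<^sup>+x. f x \<partial>lborel) + (\<integral>\<^sup>+x. g x \<partial>lborel) \<le> 2 * (\<integral>\<^sup>+x. h x \<partial>lborel)"
proof -
  define k where "k x = min (h x) 1" for x
  have [measurable]: "k \<in> borel_measurable borel" unfolding k_def by measurable
  have k1: "k x \<le> 1" for x by (simp add: k_def)
  have level: "vol {x. ennreal t < f x} + vol {x. ennreal t < g x}
       \<le> 2 * vol {x. ennreal t < k x}" if t: "0 \<le> t" "t < 1" for t
  proof (rule one_dim_brunn_minkowski)
    have t1: "ennreal t < 1" using t by (simp add: ennreal_less_one_iff)
    then show "{x. ennreal t < f x} \<noteq> {}" "{x. ennreal t < g x} \<noteq> {}" using sup by auto
    fix x y assume "x \<in> {x. ennreal t < f x}" "y \<in> {x. ennreal t < g x}"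
    \<comment> \<open>An intermediate \<open>s\<close> is needed because \<open>s\<^sup>2 \<le> h\<^sup>2\<close> yields only the weak inequality \<open>s \<le> h\<close>.\<close>
    then obtain s where s: "ennreal t < s" "s < min (f x) (g y)" using dense[of "ennreal t" "min (f x) (g y)"] by auto
    then have "s * s \<le> f x * g y" by (intro mult_mono) auto
    also note fgh[of x y]
    finally have "s \<le> h ((x + y) / 2)" by (rule ennreal_le_of_square_le)
    then have "ennreal t < h ((x + y) / 2)" using s(1) by (rule order.strict_trans2[rotated])
    then show "(x + y) / 2 \<in> {x. ennreal t < k x}" using t1 by (simp add: k_def)
  qed measurable
  have meas: "(\<lambda>t. vol {x. ennreal t < f x}) \<in> borel_measurable borel" if [measurable]: "f \<in> borel_measurable borel"
    for f :: "real \<Rightarrow> ennreal" by measurable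
  note [measurable] = meas[of f, simplified] meas[of g, simplified] meas[of k, simplified]
  have "(\<integral>\<^sup>+x. f x \<partial>lborel) + (\<integral>\<^sup>+x. g x \<partial>lborel)
    = (\<integral>\<^sup>+t. indicator {0..<1} t * vol {x. ennreal t < f x} +
            indicator {0..<1} t * vol {x. ennreal t < g x} \<partial>lborel)"
    by (simp add: layer_cake_below_1 le nn_integral_add)
  also have "\<dots> \<le> (\<integral>\<^sup>+t. 2 * (indicator {0..<1} t * vol {x. ennreal t < k x}) \<partial>lborel)"
    using level by (intro nn_integral_mono) (auto simp: indicator_def)
  also have "\<dots> = 2 * (\<integral>\<^sup>+x. k x \<partial>lborel)"
    by (simp add: nn_integral_cmult layer_cake_below_1[of k] k1)
  also have "\<dots> \<le> 2 * (\<integral>\<^sup>+x. h x \<partial>lborel)"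
    by (intro mult_left_mono nn_integral_mono) (auto simp: k_def)
  finally show ?thesis .
qed

text \<open>
Dividing \<open>f\<close> and \<open>g\<close> by their suprema and \<open>h\<close> by the geometric mean of the suprema reduces this
to the normalized case.
\<close>

lemma prekopa_leindler_bounded:
  fixes f g h :: "real \<Rightarrow> ennreal"
  assumes [measurable]: "f \<in> borel_measurable borel" "g \<in> borel_measurable borel" "h \<in> borel_measurable borel"
    and bd: "\<And>x. f x \<le> ennreal K" "\<And>x. g x \<le> ennreal L"
    and fgh: "\<And>x y. f x * g y \<le> h ((x + y) / 2) * h ((x + y) / 2)"
  shows "(\<integral>\<^sup>+x. f x \<partial>lborel) * (\<integral>\<^sup>+x. g x \<partial>lborel) \<le> (\<integral>\<^sup>+x. h x \<partial>lborel) * (\<integral>\<^sup>+x. h x \<partial>lborel)"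
proof (cases "(\<forall>x. f x = 0) \<or> (\<forall>x. g x = 0)")
  case True
  then show ?thesis by auto
next
  case False
  have ex: "\<exists>a. 0 < a \<and> (SUP x. f x) = ennreal a" if "\<And>x. f x \<le> ennreal K" "\<exists>x. f x \<noteq> 0" for f :: "real \<Rightarrow> ennreal" and K
  proof -
    have "(SUP x. f x) \<le> ennreal K" using that by (simp add: SUP_least)
    then obtain a where a: "(SUP x. f x) = ennreal a" "0 \<le> a" by (cases "SUP x. f x") (auto simp: top_unique)
    have "(SUP x. f x) \<noteq> 0" using that(2) by (metis SUP_upper UNIV_I le_zero_eq)
    then show ?thesis using a by (intro exI[of _ a]) (auto simp: less_le)
  qed
  obtain a where a: "0 < a" "(SUP x. f x) = ennreal a" using ex[of f, OF bd(1)] False by metis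
  obtain b where b: "0 < b" "(SUP x. g x) = ennreal b" using ex[of g, OF bd(2)] False by metis
  define s where "s = sqrt (a * b)"
  have s: "0 < s" "s * s = a * b" using a b by (auto simp: s_def)
  define ca cb cs where "ca = ennreal (1/a)" "cb = ennreal (1/b)" "cs = ennreal (1/s)"
  have cab: "ca * cb = cs * cs" using a b s by (simp add: ca_cb_cs_def flip: ennreal_mult)
  have norm: "c * ennreal (1/a) \<le> 1" if "0 < a" "c \<le> ennreal a" for a c
  proof -
    have "c * ennreal (1/a) \<le> ennreal a * ennreal (1/a)" using that(2) by (rule mult_right_mono) simp
    also have "\<dots> = 1" using that(1) by (simp flip: ennreal_mult)
    finally show ?thesis .
  qed
  have sup1: "\<exists>x. t < f x * ennreal (1/a)" if "t < 1" "0 < a" "(SUP x. f x) = ennreal a" for f :: "real \<Rightarrow> ennreal" and a t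
  proof (rule ccontr)
    assume "\<not> ?thesis"
    then have "f x * ennreal (1/a) \<le> t" for x by (simp add: not_less)
    then have "(SUP x. f x) * ennreal (1/a) \<le> t" by (simp add: SUP_mult_right_ennreal SUP_least)
    then have "1 \<le> t" using that by (simp flip: ennreal_mult)
    then show False using that by simp
  qed
  let ?F = "\<integral>\<^sup>+x. f x \<partial>lborel" let ?G = "\<integral>\<^sup>+x. g x \<partial>lborel" let ?H = "\<integral>\<^sup>+x. h x \<partial>lborel"
  have "(\<integral>\<^sup>+x. f x * ca \<partial>lborel) + (\<integral>\<^sup>+x. g x * cb \<partial>lborel) \<le> 2 * (\<integral>\<^sup>+x. h x * cs \<partial>lborel)"
  proof (rule prekopa_leindler_sup_1)
    show "f x * ca \<le> 1" "g x * cb \<le> 1" for x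
      unfolding ca_cb_cs_def
      using norm[OF a(1), of "f x"] norm[OF b(1), of "g x"] a(2) b(2) by (metis SUP_upper UNIV_I)+
    show "t < 1 \<Longrightarrow> \<exists>x. t < f x * ca" "t < 1 \<Longrightarrow> \<exists>x. t < g x * cb" for t
      unfolding ca_cb_cs_def using sup1 a b by auto
    show "f x * ca * (g y * cb) \<le> h ((x + y) / 2) * cs * (h ((x + y) / 2) * cs)" for x y
    proof -
      have "f x * ca * (g y * cb) = (f x * g y) * (ca * cb)" by (simp add: mult_ac)
      also have "\<dots> \<le> (h ((x + y) / 2) * h ((x + y) / 2)) * (ca * cb)" using fgh by (rule mult_right_mono) simp
      finally show ?thesis unfolding cab by (simp add: mult_ac)
    qed
  qed measurable
  then have "?F * ca + ?G * cb \<le> 2 * (?H * cs)" by (simp add: nn_integral_multc)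
  from ennreal_prod_le_square[OF this]
  have "(?F * ?G) * (ca * cb) \<le> (?H * ?H) * (cs * cs)" by (simp only: mult_ac)
  then have le: "(?F * ?G) * (cs * cs) \<le> (?H * ?H) * (cs * cs)" unfolding cab .
  have one: "cs * cs * (ennreal s * ennreal s) = 1" using s(1) by (simp add: ca_cb_cs_def flip: ennreal_mult)
  have "(?F * ?G) * (cs * cs) * (ennreal s * ennreal s) \<le> (?H * ?H) * (cs * cs) * (ennreal s * ennreal s)"
    using le by (rule mult_right_mono) simp
  then show ?thesis unfolding mult.assoc[of _ "cs * cs"] one by simp
qed

text \<open>
Truncation at \<open>i\<close> and \<open>j\<close> and monotone convergence remove the boundedness.
\<close>

lemma prekopa_leindler_real:
  fixes f g h :: "real \<Rightarrow> ennreal"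
  assumes [measurable]: "f \<in> borel_measurable borel" "g \<in> borel_measurable borel" "h \<in> borel_measurable borel"
    and fgh: "\<And>x y. f x * g y \<le> h ((x + y) / 2) * h ((x + y) / 2)"
  shows "(\<integral>\<^sup>+x. f x \<partial>lborel) * (\<integral>\<^sup>+x. g x \<partial>lborel) \<le> (\<integral>\<^sup>+x. h x \<partial>lborel) * (\<integral>\<^sup>+x. h x \<partial>lborel)"
proof -
  define trunc where "trunc f j x = min (f x) (ennreal (real j))" for f :: "real \<Rightarrow> ennreal" and j x
  have [measurable]: "trunc u j \<in> borel_measurable borel" if [measurable]: "u \<in> borel_measurable borel" for u j
    unfolding trunc_def by measurable
  have sup: "(\<integral>\<^sup>+x. u x \<partial>lborel) = (SUP j. \<integral>\<^sup>+x. trunc u j x \<partial>lborel)" if [measurable]: "u \<in> borel_measurable borel" for u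
  proof -
    have "(SUP j. trunc u j x) = u x" for x
    proof -
      have "(SUP j. trunc u j x) = inf (u x) (SUP j. ennreal (real j))"
        unfolding trunc_def inf_min[symmetric] by (rule inf_SUP[symmetric])
      then show ?thesis by (simp add: ennreal_SUP_of_nat_eq_top ennreal_of_nat_eq_real_of_nat[symmetric])
    qed
    then have "(\<integral>\<^sup>+x. u x \<partial>lborel) = (\<integral>\<^sup>+x. (SUP j. trunc u j x) \<partial>lborel)" by simp
    also have "\<dots> = (SUP j. \<integral>\<^sup>+x. trunc u j x \<partial>lborel)"
    proof (rule nn_integral_monotone_convergence_SUP)
      show "incseq (trunc u)"
        unfolding trunc_def by (auto intro!: incseq_SucI le_funI min.mono)
    qed measurable
    finally show ?thesis .
  qed
  have le: "(\<integral>\<^sup>+x. trunc f i x \<partial>lborel) * (\<integral>\<^sup>+x. trunc g j x \<partial>lborel) \<le> (\<integral>\<^sup>+x. h x \<partial>lborel) * (\<integral>\<^sup>+x. h x \<partial>lborel)" for i j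
  proof (rule prekopa_leindler_bounded)
    show "trunc f i x \<le> ennreal (real i)" "trunc g j x \<le> ennreal (real j)" for x by (auto simp: trunc_def)
    show "trunc f i x * trunc g j y \<le> h ((x + y) / 2) * h ((x + y) / 2)" for x y
      by (rule order_trans[OF mult_mono fgh]) (auto simp: trunc_def)
  qed measurable
  show ?thesis
    unfolding sup[OF assms(1)] sup[OF assms(2)] SUP_mult_right_ennreal SUP_mult_left_ennreal
    using le by (intro SUP_least) auto
qed

text \<open>
Induction on the number of coordinates: for fixed values \<open>t\<close>, \<open>s\<close>, \<open>(t + s) / 2\<close> of one coordinate
the sections satisfy the hypothesis, so by induction their integrals satisfy the hypothesis of the
one-dimensional inequality.  The index set is a finite set and not a type, so that its size can vary.
\<close>

lemma prekopa_leindler_PiM: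
  fixes f g h :: "('i \<Rightarrow> real) \<Rightarrow> ennreal"
  assumes "finite I"
    and "f \<in> borel_measurable (PiM I (\<lambda>_. lborel))" "g \<in> borel_measurable (PiM I (\<lambda>_. lborel))"
      "h \<in> borel_measurable (PiM I (\<lambda>_. lborel))"
    and "\<And>x y. x \<in> space (PiM I (\<lambda>_. lborel)) \<Longrightarrow> y \<in> space (PiM I (\<lambda>_. lborel)) \<Longrightarrow>
      f x * g y \<le> h (\<lambda>i\<in>I. (x i + y i) / 2) * h (\<lambda>i\<in>I. (x i + y i) / 2)"
  shows "(\<integral>\<^sup>+x. f x \<partial>PiM I (\<lambda>_. lborel)) * (\<integral>\<^sup>+x. g x \<partial>PiM I (\<lambda>_. lborel))
    \<le> (\<integral>\<^sup>+x. h x \<partial>PiM I (\<lambda>_. lborel)) * (\<integral>\<^sup>+x. h x \<partial>PiM I (\<lambda>_. lborel))"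
  using assms
proof (induction I arbitrary: f g h rule: finite_induct)
  case empty
  interpret product_sigma_finite "\<lambda>_::'i. lborel :: real measure" by standard
  have u: "(\<lambda>k. undefined) \<in> space (PiM {} (\<lambda>_::'i. lborel :: real measure))" by (simp add: space_PiM)
  show ?case using empty(4)[OF u u] by (simp add: nn_integral_empty restrict_def)
next
  case (insert i I)
  interpret product_sigma_finite "\<lambda>_::'i. lborel :: real measure" by standard
  interpret I: finite_product_sigma_finite "\<lambda>_::'i. lborel :: real measure" I by standard fact
  note [measurable] = insert.prems(1-3)
  let ?M = "PiM I (\<lambda>_. lborel :: real measure)"
  define S where "S f t = (\<integral>\<^sup>+x. f (x(i := t)) \<partial>?M)" for f :: "('i \<Rightarrow> real) \<Rightarrow> ennreal" and t
  have Sm: "S u \<in> borel_measurable borel" if [measurable]: "u \<in> borel_measurable (PiM (insert i I) (\<lambda>_. lborel))" for u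
    unfolding S_def by measurable
  have Si: "(\<integral>\<^sup>+x. u x \<partial>PiM (insert i I) (\<lambda>_. lborel)) = (\<integral>\<^sup>+t. S u t \<partial>lborel)"
    if [measurable]: "u \<in> borel_measurable (PiM (insert i I) (\<lambda>_. lborel))" for u
    unfolding S_def using insert.hyps by (intro product_nn_integral_insert_rev) auto
  have sec: "(\<lambda>x. u (x(i := t))) \<in> borel_measurable ?M"
    if [measurable]: "u \<in> borel_measurable (PiM (insert i I) (\<lambda>_. lborel))" for u t
    by measurable
  have "S f t * S g s \<le> S h ((t + s) / 2) * S h ((t + s) / 2)" for t s
    unfolding S_def
  proof (rule insert.IH)
    fix x y assume xy: "x \<in> space ?M" "y \<in> space ?M"
    have eq: "(\<lambda>j\<in>insert i I. ((x(i := t)) j + (y(i := s)) j) / 2) = (\<lambda>j\<in>I. (x j + y j) / 2)(i := (t + s) / 2)"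
      using insert.hyps by (auto simp: fun_eq_iff)
    have "x(i := t) \<in> space (PiM (insert i I) (\<lambda>_. lborel))" "y(i := s) \<in> space (PiM (insert i I) (\<lambda>_. lborel))"
      using xy by (auto simp: space_PiM PiE_def extensional_def)
    from insert.prems(4)[OF this] show
      "f (x(i := t)) * g (y(i := s)) \<le> h ((\<lambda>j\<in>I. (x j + y j) / 2)(i := (t + s) / 2)) * h ((\<lambda>j\<in>I. (x j + y j) / 2)(i := (t + s) / 2))"
      unfolding eq .
  qed (rule sec, rule insert.prems)+
  then show ?case
    unfolding Si[OF insert.prems(1)] Si[OF insert.prems(2)] Si[OF insert.prems(3)]
    by (intro prekopa_leindler_real) (auto intro: Sm insert.prems)
qed

lemma emeasure_PiM_reflect:
  fixes A :: "('i \<Rightarrow> real) set"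
  assumes "finite I" "A \<in> sets (PiM I (\<lambda>_. lborel))"
  shows "(\<lambda>x. \<lambda>i\<in>I. - x i) -` A \<inter> space (PiM I (\<lambda>_. lborel)) \<in> sets (PiM I (\<lambda>_. lborel :: real measure))"
    and "emeasure (PiM I (\<lambda>_. lborel)) ((\<lambda>x. \<lambda>i\<in>I. - x i) -` A \<inter> space (PiM I (\<lambda>_. lborel))) = emeasure (PiM I (\<lambda>_. lborel)) A"
proof -
  interpret product_sigma_finite "\<lambda>_::'i. lborel :: real measure" by standard
  let ?M = "PiM I (\<lambda>_. lborel :: real measure)"
  have m[measurable]: "(\<lambda>x. \<lambda>i\<in>I. - x i) \<in> ?M \<rightarrow>\<^sub>M ?M" by measurable
  show "(\<lambda>x. \<lambda>i\<in>I. - x i) -` A \<inter> space ?M \<in> sets ?M" using assms by measurable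
  have "distr ?M ?M (\<lambda>x. \<lambda>i\<in>I. - x i) = ?M"
  proof (rule PiM_eqI)
    fix B :: "'i \<Rightarrow> real set" assume B: "\<And>i. i \<in> I \<Longrightarrow> B i \<in> sets lborel"
    have um: "uminus -` C \<in> sets lborel" "vol (uminus -` C) = vol C" if "C \<in> sets lborel" for C :: "real set"
    proof -
      have "emeasure (distr lborel borel uminus) C = vol (uminus -` C)"
        using that by (subst emeasure_distr) auto
      then show "vol (uminus -` C) = vol C" by (simp add: lborel_distr_uminus)
      show "uminus -` C \<in> sets lborel" using that measurable_sets_borel[of uminus borel C] by simp
    qed
    have "emeasure (distr ?M ?M (\<lambda>x. \<lambda>i\<in>I. - x i)) (Pi\<^sub>E I B) = emeasure ?M ((\<lambda>x. \<lambda>i\<in>I. - x i) -` Pi\<^sub>E I B \<inter> space ?M)"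
      using B assms by (intro emeasure_distr sets_PiM_I_finite) auto
    also have "(\<lambda>x. \<lambda>i\<in>I. - x i) -` Pi\<^sub>E I B \<inter> space ?M = Pi\<^sub>E I (\<lambda>i. uminus -` B i)"
      by (auto simp: space_PiM PiE_iff)
    also have "emeasure ?M \<dots> = (\<Prod>i\<in>I. vol (uminus -` B i))"
      using B um assms by (intro emeasure_PiM) auto
    also have "\<dots> = (\<Prod>i\<in>I. vol (B i))" using B um by (intro prod.cong) auto
    finally show "emeasure (distr ?M ?M (\<lambda>x. \<lambda>i\<in>I. - x i)) (Pi\<^sub>E I B) = (\<Prod>i\<in>I. vol (B i))" .
  qed (use assms in auto)
  then have "emeasure ?M A = emeasure (distr ?M ?M (\<lambda>x. \<lambda>i\<in>I. - x i)) A" by simp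
  also have "\<dots> = emeasure ?M ((\<lambda>x. \<lambda>i\<in>I. - x i) -` A \<inter> space ?M)"
    using assms by (intro emeasure_distr) auto
  finally show "emeasure ?M ((\<lambda>x. \<lambda>i\<in>I. - x i) -` A \<inter> space ?M) = emeasure ?M A" by simp
qed

text \<open>
For \<open>x, y \<in> A\<close> the midpoint of \<open>x\<close> and \<open>- y\<close> has norm at most \<open>d / 2\<close>.  So the Prekopa-Leindler
inequality for the indicators of \<open>A\<close>, \<open>- A\<close> and a ball \<open>C\<close> gives
\<open>vol A \<cdot> vol (- A) \<le> (vol C)\<^sup>2\<close>, and \<open>vol (- A) = vol A\<close>.
\<close>

theorem isodiametric_PiM:
  fixes A :: "('i \<Rightarrow> real) set"
  assumes I: "finite I" and A: "A \<in> sets (PiM I (\<lambda>_. lborel))" and d: "0 \<le> d"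
    and diam: "\<And>x y. x \<in> A \<Longrightarrow> y \<in> A \<Longrightarrow> sqrt (\<Sum>i\<in>I. (x i - y i)\<^sup>2) \<le> d"
  shows "emeasure (PiM I (\<lambda>_. lborel)) A \<le> ennreal (unit_ball_vol (real (card I)) * (d / 2) ^ card I)"
proof -
  let ?M = "PiM I (\<lambda>_. lborel :: real measure)"
  define \<omega> where "\<omega> = unit_ball_vol (real (card I))"
  have le: "emeasure ?M A \<le> ennreal (\<omega> * r ^ card I)" if r: "d / 2 < r" for r
  proof -
    have r0: "0 < r" using r d by linarith
    define C where "C = {x. sqrt (\<Sum>i\<in>I. (x i)\<^sup>2) \<le> r} \<inter> space ?M"
    define A' where "A' = (\<lambda>x. \<lambda>i\<in>I. - x i) -` A \<inter> space ?M"
    have A': "A' \<in> sets ?M" "emeasure ?M A' = emeasure ?M A"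
      unfolding A'_def using emeasure_PiM_reflect[OF I A] by auto
    have C: "C \<in> sets ?M" unfolding C_def by measurable
    have "(\<integral>\<^sup>+x. indicator A x \<partial>?M) * (\<integral>\<^sup>+x. indicator A' x \<partial>?M)
      \<le> (\<integral>\<^sup>+x. indicator C x \<partial>?M) * (\<integral>\<^sup>+x. indicator C x \<partial>?M)"
    proof (rule prekopa_leindler_PiM)
      fix x y assume xy: "x \<in> space ?M" "y \<in> space ?M"
      have "(\<lambda>i\<in>I. (x i + y i) / 2) \<in> C" if "x \<in> A" "y \<in> A'"
      proof -
        have "(\<lambda>i\<in>I. - y i) \<in> A" using that by (simp add: A'_def)
        from diam[OF that(1) this] have "sqrt (\<Sum>i\<in>I. (x i + y i)\<^sup>2) \<le> d" by simp
        moreover have "sqrt (\<Sum>i\<in>I. ((x i + y i) / 2)\<^sup>2) = sqrt (\<Sum>i\<in>I. (x i + y i)\<^sup>2) / 2"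
        proof -
          have "(\<Sum>i\<in>I. ((x i + y i) / 2)\<^sup>2) = (\<Sum>i\<in>I. (x i + y i)\<^sup>2) / 2\<^sup>2"
            by (simp add: power_divide sum_divide_distrib)
          then have "sqrt (\<Sum>i\<in>I. ((x i + y i) / 2)\<^sup>2) = sqrt (\<Sum>i\<in>I. (x i + y i)\<^sup>2) / sqrt (2\<^sup>2)"
            by (metis real_sqrt_divide)
          then show ?thesis by simp
        qed
        ultimately show ?thesis using r by (simp add: C_def space_PiM)
      qed
      then show "indicator A x * indicator A' y \<le> (indicator C (\<lambda>i\<in>I. (x i + y i) / 2) * indicator C (\<lambda>i\<in>I. (x i + y i) / 2) :: ennreal)"
        by (auto simp: indicator_def)
    qed (use I A A' C in auto)
    then have "emeasure ?M A * emeasure ?M A \<le> emeasure ?M C * emeasure ?M C"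
      using A A' C by simp
    then have "emeasure ?M A \<le> emeasure ?M C"
      by (rule ennreal_le_of_square_le)
    also have "\<dots> = ennreal (\<omega> * r ^ card I)"
      unfolding C_def \<omega>_def using I r0 by (rule emeasure_cball_aux)
    finally show ?thesis .
  qed
  \<comment> \<open>The volume formula is for balls of positive radius; letting \<open>r\<close> decrease to \<open>d / 2\<close> also covers \<open>d = 0\<close>.\<close>
  have "((\<lambda>r. ennreal (\<omega> * r ^ card I)) \<longlongrightarrow> ennreal (\<omega> * (d / 2) ^ card I)) (at_right (d / 2))"
    by (intro tendsto_intros)
  then show ?thesis unfolding \<omega>_def[symmetric]
    by (rule tendsto_lowerbound) (auto simp: eventually_at_right_less le intro: eventually_mono[OF eventually_at_right_less])
qed

section \<open>Linear images of Lebesgue measure\<close>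

text \<open>
Uniqueness of Haar measure.  Let \<open>C\<close> be the unit cube.  The double integral of \<open>1\<^sub>A(x) 1\<^sub>C(y)\<close> is
\<open>N A\<close>; shifting \<open>y\<close> by \<open>x\<close>, then \<open>x\<close> by \<open>- y\<close>, and exchanging the integrals in between, turns it
into that of \<open>1\<^sub>A(x - y) 1\<^sub>C(x)\<close>, which is \<open>N C \<cdot> vol A\<close>.
\<close>

lemma translation_invariant_measure_eq:
  fixes N :: "'a::euclidean_space measure"
  assumes "sigma_finite_measure N" and sets: "sets N = sets borel"
    and inv: "\<And>a. distr N borel ((+) a) = N"
    and A: "A \<in> sets borel"
  shows "emeasure N A = emeasure N (cbox 0 One) * vol A"
proof -
  interpret N: sigma_finite_measure N by fact
  interpret pair_sigma_finite N lborel ..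
  note [measurable_cong] = sets
  let ?C = "cbox 0 One :: 'a set"
  have [measurable]: "A \<in> sets borel" by fact
  have C1: "vol ?C = 1" by simp
  have shiftN: "(\<integral>\<^sup>+x. u x \<partial>N) = (\<integral>\<^sup>+x. u (a + x) \<partial>N)" if [measurable]: "u \<in> borel_measurable borel" for u :: "'a \<Rightarrow> ennreal" and a
    by (subst inv[of a, symmetric], subst nn_integral_distr) (auto simp: measurable_cong_sets[OF sets refl])
  have shiftL: "(\<integral>\<^sup>+x. u x \<partial>lborel) = (\<integral>\<^sup>+x. u (a + x) \<partial>lborel)" if [measurable]: "u \<in> borel_measurable borel" for u :: "'a \<Rightarrow> ennreal" and a
    by (subst lborel_distr_plus[of a, symmetric], subst nn_integral_distr) auto
  have reflL: "(\<integral>\<^sup>+y. indicator A (x - y) \<partial>lborel) = vol A" for x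
  proof -
    have "vol A = (\<integral>\<^sup>+y. indicator A y \<partial>(lborel::'a measure))" by simp
    also have "\<dots> = (\<integral>\<^sup>+y. indicator A y \<partial>(density (distr lborel borel (\<lambda>y. x + (-1) *\<^sub>R y)) (\<lambda>_. ennreal (\<bar>-1\<bar> ^ DIM('a)))))"
      using lborel_affine[of "-1" x] by simp
    also have "\<dots> = (\<integral>\<^sup>+y. indicator A (x - y) \<partial>lborel)"
      by (subst nn_integral_density) (auto simp: nn_integral_distr simp del: nn_integral_indicator)
    finally show ?thesis by simp
  qed
  have "emeasure N A = (\<integral>\<^sup>+x. \<integral>\<^sup>+y. indicator A x * indicator ?C y \<partial>lborel \<partial>N)"
    by (simp add: nn_integral_cmult C1 sets nn_integral_multc)
  also have "\<dots> = (\<integral>\<^sup>+x. \<integral>\<^sup>+y. indicator A x * indicator ?C (x + y) \<partial>lborel \<partial>N)"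
  proof (rule nn_integral_cong)
    fix x
    show "(\<integral>\<^sup>+y. indicator A x * indicator ?C y \<partial>lborel) = (\<integral>\<^sup>+y. (indicator A x * indicator ?C (x + y) :: ennreal) \<partial>lborel)"
      using shiftL[of "\<lambda>y. indicator A x * indicator ?C y" x] by simp
  qed
  also have "\<dots> = (\<integral>\<^sup>+y. \<integral>\<^sup>+x. indicator A x * indicator ?C (x + y) \<partial>N \<partial>lborel)"
    by (rule Fubini'[symmetric]) measurable
  also have "\<dots> = (\<integral>\<^sup>+y. \<integral>\<^sup>+x. indicator A (x - y) * indicator ?C x \<partial>N \<partial>lborel)"
  proof (rule nn_integral_cong)
    fix y
    show "(\<integral>\<^sup>+x. indicator A x * indicator ?C (x + y) \<partial>N) = (\<integral>\<^sup>+x. (indicator A (x - y) * indicator ?C x :: ennreal) \<partial>N)"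
      using shiftN[of "\<lambda>x. indicator A (x - y) * indicator ?C x" y] by (simp add: add.commute)
  qed
  also have "\<dots> = (\<integral>\<^sup>+x. \<integral>\<^sup>+y. indicator A (x - y) * indicator ?C x \<partial>lborel \<partial>N)"
    by (rule Fubini') measurable
  also have "\<dots> = (\<integral>\<^sup>+x. vol A * indicator ?C x \<partial>N)"
    by (intro nn_integral_cong) (simp add: nn_integral_multc reflL)
  also have "\<dots> = emeasure N ?C * vol A"
    by (simp add: nn_integral_cmult sets mult.commute)
  finally show ?thesis .
qed

text \<open>
The set function \<open>A \<mapsto> vol (f A)\<close> is a translation invariant measure.  The constant is
left unspecified: each application determines it by evaluating a single set.
\<close>

lemma emeasure_linear_image_inj:
  fixes f :: "'a::euclidean_space \<Rightarrow> 'a"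
  assumes f: "linear f" "inj f"
  shows "\<exists>c\<ge>0. \<forall>A\<in>sets borel. f ` A \<in> sets borel \<and> vol (f ` A) = ennreal c * vol A"
proof -
  obtain g where g: "linear g" "\<And>x. g (f x) = x" "\<And>x. f (g x) = x"
    using linear_injective_isomorphism[OF f] by auto
  have [measurable]: "g \<in> borel_measurable borel" "f \<in> borel_measurable borel"
    using g(1) f(1) by (auto intro!: borel_measurable_continuous_onI linear_continuous_on simp: linear_conv_bounded_linear)
  have img: "f ` A = g -` A" for A by (auto simp: g(2)) (metis g(3) imageI)
  have fA: "f ` A \<in> sets borel" if "A \<in> sets borel" for A
    unfolding img by (rule measurable_sets_borel[OF _ that]) simp
  define N where "N = distr lborel borel g"
  have N: "emeasure N A = vol (f ` A)" if "A \<in> sets borel" for A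
    unfolding N_def img using that by (subst emeasure_distr) auto
  have Nfin: "emeasure N A < \<infinity>" if "A \<in> sets borel" "bounded A" for A
  proof -
    have "bounded (f ` A)" using that f(1) by (intro bounded_linear_image) (auto simp: linear_conv_bounded_linear)
    then show ?thesis using emeasure_bounded_finite by (simp only: N[OF that(1)])
  qed
  have sf: "sigma_finite_measure N"
  proof
    show "\<exists>S. countable S \<and> S \<subseteq> sets N \<and> \<Union>S = space N \<and> (\<forall>a\<in>S. emeasure N a \<noteq> \<infinity>)"
    proof (intro exI conjI ballI)
      show "countable (range (\<lambda>n. cball (0::'a) (real n)))" by simp
      show "\<Union>(range (\<lambda>n. cball (0::'a) (real n))) = space N" by (auto simp: N_def real_arch_simple)
      fix a assume "a \<in> range (\<lambda>n. cball (0::'a) (real n))"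
      then show "emeasure N a \<noteq> \<infinity>" using Nfin[of a] by auto
    qed (auto simp: N_def)
  qed
  have inv: "distr N borel ((+) a) = N" for a
  proof -
    have "distr N borel ((+) a) = distr lborel borel (\<lambda>x. a + g x)"
      unfolding N_def by (subst distr_distr) (auto simp: o_def)
    also have "(\<lambda>x. a + g x) = (\<lambda>x. g (f a + x))" using g by (simp add: linear_add)
    also have "distr lborel borel \<dots> = distr (distr lborel borel ((+) (f a))) borel g"
      by (subst distr_distr) (auto simp: o_def)
    also have "\<dots> = N" by (simp add: lborel_distr_plus N_def)
    finally show ?thesis .
  qed
  have eq: "emeasure N A = emeasure N (cbox 0 One) * vol A" if "A \<in> sets borel" for A
    by (rule translation_invariant_measure_eq[OF sf _ inv that]) (simp add: N_def)
  have "emeasure N (cbox 0 One) < \<infinity>" by (rule Nfin) auto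
  then obtain c where c: "0 \<le> c" "emeasure N (cbox 0 One) = ennreal c"
    by (metis ennreal_cases infinity_ennreal_def order_less_irrefl)
  have "f ` A \<in> sets borel \<and> vol (f ` A) = ennreal c * vol A" if "A \<in> sets borel" for A
    using fA[OF that] eq[OF that] unfolding N[OF that] c(2) by simp
  with c(1) show ?thesis by blast
qed

text \<open>
The constant is \<open>1\<close> because the unit ball is mapped onto itself.
\<close>

lemma emeasure_orthogonal_image:
  fixes f :: "'a::euclidean_space \<Rightarrow> 'a"
  assumes f: "orthogonal_transformation f" and A: "A \<in> sets borel"
  shows "f ` A \<in> sets borel" "vol (f ` A) = vol A"
proof -
  have lin: "linear f" "inj f" "\<And>x. norm (f x) = norm x" "surj f"
    using f by (auto simp: orthogonal_transformation_linear orthogonal_transformation_inj orthogonal_transformation_norm orthogonal_transformation_surj)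
  from emeasure_linear_image_inj[OF lin(1,2)] obtain c where "c \<ge> 0 \<and>
    (\<forall>A\<in>sets borel. f ` A \<in> sets borel \<and> vol (f ` A) = ennreal c * vol A)" ..
  then have c: "0 \<le> c" "\<And>A. A \<in> sets borel \<Longrightarrow> f ` A \<in> sets borel"
    "\<And>A. A \<in> sets borel \<Longrightarrow> vol (f ` A) = ennreal c * vol A"
    by auto
  have "f ` cball 0 1 = cball 0 1"
  proof
    show "f ` cball 0 1 \<subseteq> cball 0 1" using lin(3) by auto
    show "cball 0 1 \<subseteq> f ` cball 0 1"
    proof
      fix y :: 'a assume "y \<in> cball 0 1"
      moreover obtain x where "y = f x" using lin(4) by auto
      ultimately show "y \<in> f ` cball 0 1" using lin(3) by auto
    qed
  qed
  with c(3)[of "cball 0 1"] have "vol (cball (0::'a) 1) = ennreal c * vol (cball (0::'a) 1)" by simp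
  moreover define v where "v = unit_ball_vol (real DIM('a))"
  have v: "0 < v" unfolding v_def by simp
  moreover have "vol (cball (0::'a) 1) = ennreal v"
    using emeasure_cball[of 1 "0::'a"] by (simp add: v_def)
  ultimately have "ennreal v = ennreal (c * v)" using c(1) by (simp only: ennreal_mult' mult.commute)
  then have "v = c * v" using c(1) v by (subst (asm) ennreal_inj) auto
  then have "c = 1" using v by simp
  then show "f ` A \<in> sets borel" "vol (f ` A) = vol A" using c A by auto
qed

lemma measure_linear_image_compact:
  fixes f :: "'a::euclidean_space \<Rightarrow> 'a"
  assumes f: "linear f"
  shows "\<exists>c\<ge>0. \<forall>A. compact A \<longrightarrow> lmeas (f ` A) = c * lmeas A"
proof (cases "inj f")
  case True
  from emeasure_linear_image_inj[OF f True] obtain c where "c \<ge> 0 \<and>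
    (\<forall>A\<in>sets borel. f ` A \<in> sets borel \<and> vol (f ` A) = ennreal c * vol A)" ..
  then have c: "0 \<le> c" "\<And>A. A \<in> sets borel \<Longrightarrow> f ` A \<in> sets borel"
    "\<And>A. A \<in> sets borel \<Longrightarrow> vol (f ` A) = ennreal c * vol A"
    by auto
  have "lmeas (f ` A) = c * lmeas A" if "compact A" for A
  proof -
    have A: "A \<in> sets borel" using that by (rule borel_compact)
    then have "measure lborel (f ` A) = c * measure lborel A"
      using c by (simp add: measure_def enn2real_mult)
    then show ?thesis using A c(2) by simp
  qed
  with c(1) show ?thesis by blast
next
  case False
  then have "lmeas (f ` A) = 0 * lmeas A" for A
    using negligible_linear_singular_image[OF f False] by (simp add: negligible_imp_measure0)
  then show ?thesis by (intro exI[of _ 0]) simp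
qed

section \<open>Volumes of balls and cones by slicing\<close>

abbreviation slice_space :: "'a::euclidean_space \<Rightarrow> ('a \<Rightarrow> real) measure" where
  "slice_space b \<equiv> PiM (Basis - {b}) (\<lambda>_. lborel)"

abbreviation slice_point :: "'a::euclidean_space \<Rightarrow> real \<Rightarrow> ('a \<Rightarrow> real) \<Rightarrow> 'a" where
  "slice_point b t y \<equiv> (\<Sum>i\<in>Basis - {b}. y i *\<^sub>R i) + t *\<^sub>R b"

text \<open>
The measure of the slice of \<open>A\<close> by the hyperplane \<open>x \<bullet> b = t\<close>, in the coordinates other than \<open>b\<close>.
\<close>

definition slice_measure :: "'a::euclidean_space \<Rightarrow> real \<Rightarrow> 'a set \<Rightarrow> ennreal" where
  "slice_measure b t A = emeasure (slice_space b)
     {y \<in> space (slice_space b). slice_point b t y \<in> A}"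

lemma slice_set_measurable:
  fixes A :: "'a::euclidean_space set"
  assumes [measurable]: "A \<in> sets borel"
  shows "{y \<in> space (slice_space b). slice_point b t y \<in> A}
    \<in> sets (slice_space b)"
  by measurable

lemma emeasure_lborel_slices:
  fixes A :: "'a::euclidean_space set"
  assumes b: "b \<in> Basis" and A[measurable]: "A \<in> sets borel"
  shows "vol A = (\<integral>\<^sup>+t. slice_measure b t A \<partial>lborel)"
proof -
  interpret product_sigma_finite "\<lambda>_::'a. lborel :: real measure" by standard
  let ?v = "\<lambda>f. \<Sum>i\<in>Basis. f i *\<^sub>R i :: 'a"
  have ins: "insert b (Basis - {b}) = Basis" using b by auto
  have "vol A = emeasure (distr (PiM Basis (\<lambda>_. lborel)) borel ?v) A"
    by (subst lborel_eq) simp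
  also have "\<dots> = (\<integral>\<^sup>+f. indicator A (?v f) \<partial>PiM Basis (\<lambda>_. lborel))"
    by (subst nn_integral_indicator[symmetric]) (simp_all add: nn_integral_distr del: nn_integral_indicator)
  also have "\<dots> = (\<integral>\<^sup>+t. \<integral>\<^sup>+f. indicator A (?v (f(b := t))) \<partial>slice_space b \<partial>lborel)"
    using product_nn_integral_insert_rev[of "Basis - {b}" b "\<lambda>f. indicator A (?v f)"] unfolding ins by simp
  also have "\<dots> = (\<integral>\<^sup>+t. slice_measure b t A \<partial>lborel)"
  proof (rule nn_integral_cong)
    fix t :: real
    let ?S = "{y \<in> space (slice_space b). slice_point b t y \<in> A}"
    have v: "?v (f(b := t)) = slice_point b t f" for f
      using b by (subst sum.remove[of _ b]) (auto simp: add.commute intro!: sum.cong)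
    have "(\<integral>\<^sup>+f. indicator A (?v (f(b := t))) \<partial>slice_space b)
      = (\<integral>\<^sup>+f. indicator ?S f \<partial>slice_space b)"
      unfolding v by (intro nn_integral_cong) (auto simp: indicator_def)
    also have "\<dots> = slice_measure b t A"
      unfolding slice_measure_def by (rule nn_integral_indicator) (rule slice_set_measurable[OF A])
    finally show "(\<integral>\<^sup>+f. indicator A (?v (f(b := t))) \<partial>slice_space b) = slice_measure b t A" .
  qed
  finally show ?thesis .
qed

lemma inner_slice_point:
  fixes b :: "'a::euclidean_space"
  assumes "b \<in> Basis"
  shows "slice_point b t y \<bullet> b = t"
    and "j \<in> Basis - {b} \<Longrightarrow> slice_point b t y \<bullet> j = y j"
proof -
  show "slice_point b t y \<bullet> b = t"
    using assms by (simp add: inner_add_left inner_sum_left inner_Basis)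
  assume j: "j \<in> Basis - {b}"
  have "slice_point b t y \<bullet> j = (\<Sum>i\<in>Basis - {b}. y i * (i \<bullet> j))"
    using assms j by (simp add: inner_add_left inner_sum_left inner_Basis[of b j] eq_commute[of b j])
  also have "\<dots> = (\<Sum>i\<in>Basis - {b}. if i = j then y i else 0)"
    using j by (intro sum.cong) (auto simp: inner_Basis)
  finally have "slice_point b t y \<bullet> j = (\<Sum>i\<in>Basis - {b}. if i = j then y i else 0)" .
  then show "slice_point b t y \<bullet> j = y j" using j by simp
qed

lemma norm_slice_point:
  fixes b :: "'a::euclidean_space"
  assumes b: "b \<in> Basis"
  shows "norm (slice_point b t y) = sqrt ((\<Sum>i\<in>Basis - {b}. (y i)\<^sup>2) + t\<^sup>2)"
proof -
  let ?x = "slice_point b t y"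
  have "norm ?x = sqrt (\<Sum>i\<in>Basis. (?x \<bullet> i)\<^sup>2)"
    using euclidean_dist_l2[of ?x 0] by (simp add: L2_set_def)
  also have "(\<Sum>i\<in>Basis. (?x \<bullet> i)\<^sup>2) = (?x \<bullet> b)\<^sup>2 + (\<Sum>i\<in>Basis - {b}. (?x \<bullet> i)\<^sup>2)"
    using b by (subst sum.remove[of _ b]) auto
  also have "\<dots> = t\<^sup>2 + (\<Sum>i\<in>Basis - {b}. (y i)\<^sup>2)"
    using inner_slice_point[OF b] by simp
  finally show ?thesis by (simp add: add.commute)
qed

lemma slice_isodiametric:
  fixes A :: "'a::euclidean_space set"
  assumes b: "b \<in> Basis" and A: "A \<in> sets borel" and d: "0 \<le> d"
    and diam: "\<And>x y. x \<in> A \<Longrightarrow> y \<in> A \<Longrightarrow> x \<bullet> b = t \<Longrightarrow> y \<bullet> b = t \<Longrightarrow> dist x y \<le> d"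
  shows "slice_measure b t A \<le> ennreal (unit_ball_vol (real (DIM('a) - 1)) * (d / 2) ^ (DIM('a) - 1))"
proof -
  have card: "card (Basis - {b}) = DIM('a) - 1" using b by simp
  show ?thesis
    unfolding slice_measure_def card[symmetric]
  proof (rule isodiametric_PiM)
    fix x y
    let ?v = "\<lambda>y. slice_point b t y"
    assume "x \<in> {y \<in> space (slice_space b). ?v y \<in> A}" "y \<in> {y \<in> space (slice_space b). ?v y \<in> A}"
    then have "dist (?v x) (?v y) \<le> d" using diam inner_slice_point[OF b] by blast
    moreover have "?v x - ?v y = (\<Sum>i\<in>Basis - {b}. (x i - y i) *\<^sub>R i) + 0 *\<^sub>R b"
      by (simp add: scaleR_diff_left sum_subtractf)
    ultimately show "sqrt (\<Sum>i\<in>Basis - {b}. (x i - y i)\<^sup>2) \<le> d"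
      using norm_slice_point[OF b, of "\<lambda>i. x i - y i" 0] by (simp add: dist_norm)
  qed (use d slice_set_measurable[OF A] in auto)
qed

lemma slice_measure_cball_0:
  fixes b :: "'a::euclidean_space"
  assumes b: "b \<in> Basis" and t: "\<bar>t\<bar> < r"
  shows "slice_measure b t (cball 0 r) = ennreal (unit_ball_vol (real (DIM('a) - 1)) * sqrt (r\<^sup>2 - t\<^sup>2) ^ (DIM('a) - 1))"
proof -
  have card: "card (Basis - {b}) = DIM('a) - 1" using b by simp
  have tr: "t\<^sup>2 < r\<^sup>2" using t by (simp add: abs_square_less_1 power2_less_imp_less abs_le_square_iff flip: abs_le_square_iff not_le)
  have r0: "0 \<le> r" using t by linarith
  have "{y \<in> space (slice_space b). slice_point b t y \<in> cball 0 r}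
    = {y. sqrt (\<Sum>i\<in>Basis - {b}. (y i)\<^sup>2) \<le> sqrt (r\<^sup>2 - t\<^sup>2)} \<inter> space (slice_space b)"
  proof -
    have "slice_point b t y \<in> cball 0 r \<longleftrightarrow> sqrt (\<Sum>i\<in>Basis - {b}. (y i)\<^sup>2) \<le> sqrt (r\<^sup>2 - t\<^sup>2)" for y
    proof -
      have "slice_point b t y \<in> cball 0 r \<longleftrightarrow> sqrt ((\<Sum>i\<in>Basis - {b}. (y i)\<^sup>2) + t\<^sup>2) \<le> r"
        by (simp only: mem_cball_0 norm_slice_point[OF b])
      also have "\<dots> \<longleftrightarrow> (\<Sum>i\<in>Basis - {b}. (y i)\<^sup>2) + t\<^sup>2 \<le> r\<^sup>2"
        using r0 by (intro real_sqrt_le_iff') (auto intro!: add_nonneg_nonneg sum_nonneg)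
      also have "\<dots> \<longleftrightarrow> (\<Sum>i\<in>Basis - {b}. (y i)\<^sup>2) \<le> r\<^sup>2 - t\<^sup>2" by linarith
      finally show ?thesis by simp
    qed
    then show ?thesis by blast
  qed
  then show ?thesis unfolding slice_measure_def card[symmetric]
    using emeasure_cball_aux[of "Basis - {b}" "sqrt (r\<^sup>2 - t\<^sup>2)"] tr by simp
qed

text \<open>
The integrand is the cost of a slice of a ball around a point with \<open>b\<close>-coordinate \<open>s\<close>.  It counts
the slice at \<open>|t - s| = r\<close> as nonempty, as a covering argument must; in dimension \<open>1\<close> its value there
is \<open>1\<close>, but two values of \<open>t\<close> do not affect the integral.
\<close>

lemma ball_slices_integral:
  fixes b :: "'a::euclidean_space"
  assumes b: "b \<in> Basis"
  shows "(\<integral>\<^sup>+t. (if \<bar>t - s\<bar> \<le> r then ennreal (unit_ball_vol (real (DIM('a) - 1)) * sqrt (r\<^sup>2 - (t - s)\<^sup>2) ^ (DIM('a) - 1)) else 0) \<partial>lborel)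
    \<le> vol (cball (0::'a) r)"
proof -
  let ?c = "\<lambda>t. if \<bar>t\<bar> \<le> r then ennreal (unit_ball_vol (real (DIM('a) - 1)) * sqrt (r\<^sup>2 - t\<^sup>2) ^ (DIM('a) - 1)) else 0"
  have [measurable]: "?c \<in> borel_measurable borel" by measurable
  have "(\<integral>\<^sup>+t. ?c (t - s) \<partial>lborel) = (\<integral>\<^sup>+t. ?c t \<partial>lborel)"
  proof -
    have eq: "- s + 1 * t = t - s" for t by simp
    show ?thesis using nn_integral_real_affine[of ?c 1 "- s"] unfolding eq by simp
  qed
  also have "\<dots> \<le> (\<integral>\<^sup>+t. slice_measure b t (cball 0 r) \<partial>lborel)"
  proof (rule nn_integral_mono_AE)
    have "AE t in lborel. t \<notin> {-r, r}" by (intro AE_not_in countable_imp_null_set_lborel) auto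
    then show "AE t in lborel. ?c t \<le> slice_measure b t (cball 0 r)"
    proof eventually_elim
      case (elim t)
      then have "\<bar>t\<bar> \<noteq> r" by auto
      then show ?case using slice_measure_cball_0[OF b, of t r] by auto
    qed
  qed
  also have "\<dots> = vol (cball (0::'a) r)"
    by (rule emeasure_lborel_slices[OF b, symmetric]) simp
  finally show ?thesis .
qed

definition cone_over :: "'a::real_vector set \<Rightarrow> 'a set" where
  "cone_over U = (\<lambda>(s, x). s *\<^sub>R x) ` ({0..1} \<times> U)"

lemma compact_cone_over:
  fixes U :: "'a::real_normed_vector set"
  assumes "compact U"
  shows "compact (cone_over U)"
  unfolding cone_over_def
  by (intro compact_continuous_image compact_Times assms) (auto intro!: continuous_intros simp: split_beta)

text \<open>
The slice of the cone at height \<open>t\<close> is \<open>U\<close> scaled by \<open>t / h\<close>, so the isodiametric inequality bounds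
its measure by \<open>(t / h)\<^sup>n\<^sup>-\<^sup>1\<close> times the cost of \<open>U\<close>.  Integrating over \<open>{0..h}\<close> gives the factor
\<open>h / n\<close>.
\<close>

lemma emeasure_cone_over_axis:
  fixes U :: "'a::euclidean_space set"
  assumes b: "b \<in> Basis" and U: "compact U" "U \<subseteq> {x. x \<bullet> b = h}" and h: "0 < h" and d: "0 \<le> d"
    and diam: "\<And>x y. x \<in> U \<Longrightarrow> y \<in> U \<Longrightarrow> dist x y \<le> d"
  shows "vol (cone_over U) \<le>
    ennreal (h / DIM('a)) * ennreal (unit_ball_vol (real (DIM('a) - 1)) * (d / 2) ^ (DIM('a) - 1))"
proof -
  define m where "m = DIM('a) - 1"
  have DIM: "DIM('a) = Suc m" unfolding m_def by (simp add: Suc_leI)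
  define \<omega> where "\<omega> = unit_ball_vol (real m) * (d / 2) ^ m"
  define c where "c = \<omega> / (real (Suc m) * h ^ m)"
  have \<omega>0: "0 \<le> \<omega>" using d by (simp add: \<omega>_def)
  have meas: "cone_over U \<in> sets borel" by (intro borel_compact compact_cone_over U)
  have slice: "slice_measure b t (cone_over U) \<le> ennreal (\<omega> * (t / h) ^ m) * indicator {0..h} t" for t
  proof (cases "t \<in> {0..h}")
    case True
    have "slice_measure b t (cone_over U) \<le> ennreal (unit_ball_vol (real (DIM('a) - 1)) * ((t / h * d) / 2) ^ (DIM('a) - 1))"
    proof (rule slice_isodiametric[OF b meas])
      show "0 \<le> t / h * d" using True h d by simp
      fix x y assume xy: "x \<in> cone_over U" "y \<in> cone_over U" "x \<bullet> b = t" "y \<bullet> b = t"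
      obtain s x' where s: "0 \<le> s" "s \<le> 1" "x' \<in> U" "x = s *\<^sub>R x'" using xy by (auto simp: cone_over_def)
      obtain s2 y' where s2: "0 \<le> s2" "s2 \<le> 1" "y' \<in> U" "y = s2 *\<^sub>R y'" using xy by (auto simp: cone_over_def)
      have "s * h = t" "s2 * h = t" using s s2 xy U by auto
      then have eq: "s = t / h" "s2 = t / h" using h by auto
      have "dist x y = t / h * dist x' y'" using s s2 True h unfolding eq
        by (simp add: dist_norm flip: scaleR_diff_right)
      also have "\<dots> \<le> t / h * d" using diam s s2 True h by (intro mult_left_mono) auto
      finally show "dist x y \<le> t / h * d" .
    qed
    also have "unit_ball_vol (real (DIM('a) - 1)) * ((t / h * d) / 2) ^ (DIM('a) - 1) = \<omega> * (t / h) ^ m"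
    proof -
      have "((t / h * d) / 2) ^ m = (t / h) ^ m * (d / 2) ^ m" unfolding power_mult_distrib[symmetric] by simp
      then show ?thesis unfolding \<omega>_def m_def[symmetric] by simp
    qed
    finally show ?thesis using True by simp
  next
    case False
    have "{y \<in> space (slice_space b). slice_point b t y \<in> cone_over U} = {}"
    proof -
      have "x \<notin> cone_over U" if "x \<bullet> b = t" for x
      proof
        assume "x \<in> cone_over U"
        then obtain s x' where s: "0 \<le> s" "s \<le> 1" "x' \<in> U" "x = s *\<^sub>R x'" by (auto simp: cone_over_def)
        then have "t = s * h" using that U by auto
        then show False using False s h by (simp add: mult_left_le_one_le)
      qed
      then show ?thesis using inner_slice_point(1)[OF b] by blast
    qed
    then show ?thesis unfolding slice_measure_def by (simp only: emeasure_empty zero_le)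
  qed
  have "vol (cone_over U) = (\<integral>\<^sup>+t. slice_measure b t (cone_over U) \<partial>lborel)"
    by (rule emeasure_lborel_slices[OF b meas])
  also have "\<dots> \<le> (\<integral>\<^sup>+t. ennreal (\<omega> * (t / h) ^ m) * indicator {0..h} t \<partial>lborel)"
    by (intro nn_integral_mono slice)
  also have "\<dots> = ennreal (c * h ^ Suc m - c * 0 ^ Suc m)"
  proof (rule nn_integral_FTC_Icc)
    fix x assume "x \<in> {0..h}"
    then show "0 \<le> \<omega> * (x / h) ^ m" using \<omega>0 h by simp
    have "((\<lambda>x. c * x ^ Suc m) has_real_derivative c * (real (Suc m) * x ^ m)) (at x)"
      using DERIV_cmult[OF DERIV_pow[of "Suc m" x], of c] by simp
    moreover have "c * (real (Suc m) * x ^ m) = \<omega> * (x / h) ^ m"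
      using h by (simp add: c_def power_divide del: of_nat_Suc)
    ultimately show "((\<lambda>x. c * x ^ Suc m) has_real_derivative \<omega> * (x / h) ^ m) (at x)" by simp
  qed (use h in auto)
  also have "c * h ^ Suc m - c * 0 ^ Suc m = (h / Suc m) * \<omega>" using h by (simp add: c_def del: of_nat_Suc)
  also have "ennreal \<dots> = ennreal (h / Suc m) * ennreal \<omega>" using h \<omega>0 by (intro ennreal_mult) auto
  finally show ?thesis unfolding \<omega>_def DIM by simp
qed

lemma cone_over_linear_image: "linear f \<Longrightarrow> cone_over (f ` U) = f ` cone_over U"
  unfolding cone_over_def by (force simp: image_iff linear_scale)

lemma emeasure_cone_over_hyperplane:
  fixes U :: "(real ^ 'n) set"
  assumes \<nu>: "norm \<nu> = 1" and U: "compact U" "U \<subseteq> {x. \<nu> \<bullet> x = h}" and h: "0 < h" and d: "0 \<le> d"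
    and diam: "\<And>x y. x \<in> U \<Longrightarrow> y \<in> U \<Longrightarrow> dist x y \<le> d"
  shows "vol (cone_over U) \<le>
    ennreal (h / CARD('n)) * ennreal (unit_ball_vol (real (CARD('n) - 1)) * (d / 2) ^ (CARD('n) - 1))"
proof -
  have DIM: "DIM(real^'n) = CARD('n)" by simp
  obtain k :: 'n where True by simp
  have b: "axis k 1 \<in> (Basis :: (real ^ 'n) set)" by (simp add: axis_in_Basis_iff)
  obtain f where f: "orthogonal_transformation f" "f \<nu> = axis k (1::real)"
    by (rule orthogonal_transformation_exists_1[of \<nu> "axis k 1"]) (use \<nu> in auto)
  have lin: "linear f" using f by (simp add: orthogonal_transformation_linear)
  have ip: "f x \<bullet> f y = x \<bullet> y" for x y using f by (simp add: orthogonal_transformation_def)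
  have "vol (cone_over U) = vol (f ` cone_over U)"
    by (intro emeasure_orthogonal_image(2)[symmetric] f borel_compact compact_cone_over U)
  also have "\<dots> = vol (cone_over (f ` U))" by (simp add: cone_over_linear_image lin)
  also have "\<dots> \<le> ennreal (h / DIM(real^'n)) * ennreal (unit_ball_vol (real (DIM(real^'n) - 1)) * (d / 2) ^ (DIM(real^'n) - 1))"
  proof (rule emeasure_cone_over_axis[OF b])
    show "compact (f ` U)" using U lin by (intro compact_continuous_image linear_continuous_on) (auto simp: linear_conv_bounded_linear)
    show "f ` U \<subseteq> {x. x \<bullet> axis k 1 = h}" 
    proof clarsimp
      fix x assume "x \<in> U"
      then have "\<nu> \<bullet> x = h" using U by auto
      then show "f x \<bullet> axis k 1 = h" using ip[of x \<nu>] f(2) by (simp add: inner_commute)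
    qed
    show "x \<in> f ` U \<Longrightarrow> y \<in> f ` U \<Longrightarrow> dist x y \<le> d" for x y
    proof -
      assume "x \<in> f ` U" "y \<in> f ` U"
      then obtain x' y' where xy: "x' \<in> U" "y' \<in> U" "x = f x'" "y = f y'" by blast
      have "dist x y = norm (f (x' - y'))" unfolding xy dist_norm by (simp add: linear_diff[OF lin])
      also have "\<dots> = dist x' y'" by (simp add: dist_norm norm_eq_sqrt_inner ip)
      finally show "dist x y \<le> d" using diam xy by simp
    qed
  qed (use h d in auto)
  finally show ?thesis unfolding DIM .
qed

section \<open>Hausdorff measure bounded below by volumes of cones\<close>

lemma hausdorff_cost_mono:
  assumes "V \<subseteq> U" "bounded U"
  shows "hausdorff_cost m V \<le> hausdorff_cost m U"
proof -
  have "diameter V \<le> diameter U" "0 \<le> diameter V" using assms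
    by (auto intro: diameter_subset diameter_ge_0 bounded_subset)
  then have "unit_ball_vol (real m) * (diameter V / 2) ^ m \<le> unit_ball_vol (real m) * (diameter U / 2) ^ m"
    by (intro mult_left_mono power_mono) auto
  then show ?thesis using assms by (auto simp: hausdorff_cost_def intro: ennreal_leI)
qed

lemma hausdorff_premeasure_mono:
  assumes "S \<subseteq> T"
  shows "hausdorff_premeasure m \<delta> S \<le> hausdorff_premeasure m \<delta> T"
  unfolding hausdorff_premeasure_def
proof (rule Inf_superset_mono, rule subsetI)
  fix z assume "z \<in> {(\<Sum>i. hausdorff_cost m (U i)) |U. T \<subseteq> (\<Union>i. U i) \<and> (\<forall>i. bounded (U i) \<and> diameter (U i) \<le> \<delta>)}"
  then obtain U where U: "z = (\<Sum>i. hausdorff_cost m (U i))" "T \<subseteq> (\<Union>i. U i)" "\<forall>i. bounded (U i) \<and> diameter (U i) \<le> \<delta>"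
    by (elim CollectE exE conjE)
  then show "z \<in> {(\<Sum>i. hausdorff_cost m (U i)) |U. S \<subseteq> (\<Union>i. U i) \<and> (\<forall>i. bounded (U i) \<and> diameter (U i) \<le> \<delta>)}"
    using assms by (intro CollectI exI[of _ U]) (simp add: subset_trans[OF assms])
qed

lemma cone_over_cost:
  fixes V :: "(real ^ 'n) set"
  assumes V: "bounded V" "V \<subseteq> {x. \<nu> \<bullet> x = h}" and \<nu>: "norm \<nu> = 1" and h: "0 < h"
  shows "vol (cone_over (closure V)) \<le> ennreal (h / CARD('n)) * hausdorff_cost (CARD('n) - 1) V"
proof (cases "V = {}")
  case True
  then show ?thesis by (simp add: cone_over_def)
next
  case False
  have "vol (cone_over (closure V)) \<le>
    ennreal (h / CARD('n)) * ennreal (unit_ball_vol (real (CARD('n) - 1)) * (diameter V / 2) ^ (CARD('n) - 1))"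
  proof (rule emeasure_cone_over_hyperplane[OF \<nu> _ _ h])
    show "compact (closure V)" using V by (simp add: compact_closure)
    show "closure V \<subseteq> {x. \<nu> \<bullet> x = h}" using V by (intro closure_minimal closed_hyperplane)
    show "0 \<le> diameter V" using V by (simp add: diameter_ge_0)
    show "dist x y \<le> diameter V" if "x \<in> closure V" "y \<in> closure V" for x y
      using diameter_bounded_bound[of "closure V" x y] that V by (simp add: diameter_closure bounded_closure)
  qed
  then show ?thesis using False by (simp add: hausdorff_cost_def)
qed

text \<open>
A set of diameter at most \<open>\<delta>\<close> meets at most one of the separated sets \<open>K i\<close>.  So the cost of a
member of a cover is charged to the cone over a single \<open>K i\<close> only, and costs add up over \<open>i\<close>.
\<close>

lemma hausdorff_measure_ge_cones:
  fixes K :: "'i \<Rightarrow> (real ^ 'n) set"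
  assumes I: "finite I" and K: "\<And>i. i \<in> I \<Longrightarrow> compact (K i)" "\<And>i. i \<in> I \<Longrightarrow> K i \<subseteq> {x. \<nu> i \<bullet> x = h i}"
    and \<nu>: "\<And>i. i \<in> I \<Longrightarrow> norm (\<nu> i) = 1" and h: "\<And>i. i \<in> I \<Longrightarrow> 0 < h i"
    and sub: "\<And>i. i \<in> I \<Longrightarrow> K i \<subseteq> S" and \<delta>: "0 < \<delta>"
    and sep: "\<And>i j x y. i \<in> I \<Longrightarrow> j \<in> I \<Longrightarrow> i \<noteq> j \<Longrightarrow> x \<in> K i \<Longrightarrow> y \<in> K j \<Longrightarrow> \<delta> < dist x y"
  shows "(\<Sum>i\<in>I. ennreal (CARD('n) / h i) * vol (cone_over (K i))) \<le> hausdorff_measure (CARD('n) - 1) S"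
proof -
  let ?m = "CARD('n) - 1"
  have "(\<Sum>i\<in>I. ennreal (CARD('n) / h i) * vol (cone_over (K i))) \<le> hausdorff_premeasure ?m \<delta> S"
    unfolding hausdorff_premeasure_def
  proof (rule Inf_greatest, clarify)
    fix U :: "nat \<Rightarrow> (real ^ 'n) set"
    assume U: "S \<subseteq> (\<Union>i. U i)" "\<forall>i. bounded (U i) \<and> diameter (U i) \<le> \<delta>"
    have one: "ennreal (CARD('n) / h i) * vol (cone_over (K i)) \<le> (\<Sum>k. hausdorff_cost ?m (U k \<inter> K i))" if i: "i \<in> I" for i
    proof -
      let ?V = "\<lambda>k. closure (U k \<inter> K i)"
      have "cone_over (K i) \<subseteq> (\<Union>k. cone_over (?V k))"
      proof
        fix z assume "z \<in> cone_over (K i)"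
        then obtain s x where sx: "s \<in> {0..1}" "x \<in> K i" "z = s *\<^sub>R x" by (auto simp: cone_over_def)
        then obtain k where "x \<in> U k" using U sub[OF i] by blast
        then have "x \<in> ?V k" using sx closure_subset[of "U k \<inter> K i"] by auto
        then show "z \<in> (\<Union>k. cone_over (?V k))" using sx by (force simp: cone_over_def)
      qed
      moreover have cpt: "compact (?V k)" for k using U K[OF i] by (simp add: compact_closure bounded_Int)
      then have bor: "cone_over (?V k) \<in> sets borel" for k by (intro borel_compact compact_cone_over)
      ultimately have "vol (cone_over (K i)) \<le> vol (\<Union>k. cone_over (?V k))"
        by (intro emeasure_mono) auto
      also have "\<dots> \<le> (\<Sum>k. vol (cone_over (?V k)))"
        by (intro emeasure_subadditive_countably) (use bor in auto)
      also have "\<dots> \<le> (\<Sum>k. ennreal (h i / CARD('n)) * hausdorff_cost ?m (U k \<inter> K i))"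
        by (intro suminf_le cone_over_cost[of _ "\<nu> i"]) (use U K[OF i] \<nu>[OF i] h[OF i] in \<open>auto simp: bounded_Int\<close>)
      finally have le: "vol (cone_over (K i)) \<le> ennreal (h i / CARD('n)) * (\<Sum>k. hausdorff_cost ?m (U k \<inter> K i))"
        by simp
      have "ennreal (CARD('n) / h i) * vol (cone_over (K i)) \<le>
        ennreal (CARD('n) / h i) * (ennreal (h i / CARD('n)) * (\<Sum>k. hausdorff_cost ?m (U k \<inter> K i)))"
        using le by (rule mult_left_mono) simp
      also have "\<dots> = (\<Sum>k. hausdorff_cost ?m (U k \<inter> K i))"
      proof -
        have "ennreal (CARD('n) / h i) * ennreal (h i / CARD('n)) = 1"
          using h[OF i] by (subst ennreal_mult[symmetric]) auto
        then show ?thesis by (simp add: mult.assoc[symmetric])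
      qed
      finally show ?thesis .
    qed
    have "(\<Sum>i\<in>I. ennreal (CARD('n) / h i) * vol (cone_over (K i))) \<le> (\<Sum>i\<in>I. \<Sum>k. hausdorff_cost ?m (U k \<inter> K i))"
      using one by (intro sum_mono)
    also have "\<dots> = (\<Sum>k. \<Sum>i\<in>I. hausdorff_cost ?m (U k \<inter> K i))"
      by (rule suminf_sum[symmetric]) simp
    also have "\<dots> \<le> (\<Sum>k. hausdorff_cost ?m (U k))"
    proof (intro suminf_le)
      fix k
      have bU: "bounded (U k)" "diameter (U k) \<le> \<delta>" using U by auto
      show "(\<Sum>i\<in>I. hausdorff_cost ?m (U k \<inter> K i)) \<le> hausdorff_cost ?m (U k)"
      proof (cases "\<exists>j\<in>I. U k \<inter> K j \<noteq> {}")
        case True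
        then obtain j x where j: "j \<in> I" "x \<in> U k" "x \<in> K j" by auto
        have "U k \<inter> K i = {}" if "i \<in> I" "i \<noteq> j" for i
        proof (rule ccontr)
          assume "U k \<inter> K i \<noteq> {}"
          then obtain y where y: "y \<in> U k" "y \<in> K i" by auto
          have "dist y x \<le> \<delta>" using diameter_bounded_bound[OF bU(1) y(1) j(2)] bU by simp
          then show False using sep[OF that(1) j(1) that(2) y(2) j(3)] by simp
        qed
        then have "hausdorff_cost ?m (U k \<inter> K i) = 0" if "i \<in> I - {j}" for i
          using that by (simp add: hausdorff_cost_def)
        then have "(\<Sum>i\<in>I. hausdorff_cost ?m (U k \<inter> K i)) = hausdorff_cost ?m (U k \<inter> K j)"
          using I j by (subst sum.remove[of _ j]) auto
        then show ?thesis using hausdorff_cost_mono[of "U k \<inter> K j" "U k"] bU by simp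
      next
        case False
        then have "(\<Sum>i\<in>I. hausdorff_cost ?m (U k \<inter> K i)) = 0" by (simp add: hausdorff_cost_def)
        then show ?thesis by simp
      qed
    qed auto
    finally show "(\<Sum>i\<in>I. ennreal (CARD('n) / h i) * vol (cone_over (K i))) \<le> (\<Sum>k. hausdorff_cost ?m (U k))" .
  qed
  also have "\<dots> \<le> hausdorff_measure ?m S"
    unfolding hausdorff_measure_def using \<delta> by (intro SUP_upper) auto
  finally show ?thesis .
qed

section \<open>Hausdorff measure of the boundary of the cube\<close>

text \<open>
By outer regularity \<open>N\<close> lies in an open set \<open>T\<close> of small measure.  The Vitali covering lemma selects
disjoint balls in \<open>T\<close> whose fivefold enlargements still cover \<open>N\<close>.  A pair stands for the centre and
the radius of an enlarged ball.
\<close>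

lemma null_set_ball_cover:
  fixes N :: "'a::euclidean_space set"
  assumes N: "negligible N" and \<delta>: "0 < \<delta>" and \<epsilon>: "0 < \<epsilon>"
  obtains C :: "('a \<times> real) set" where "countable C" "\<forall>p\<in>C. 0 \<le> snd p \<and> snd p \<le> \<delta>"
    "N \<subseteq> (\<Union>p\<in>C. cball (fst p) (snd p))"
    "(\<integral>\<^sup>+p. vol (cball (fst p) (snd p)) \<partial>count_space C) \<le> ennreal \<epsilon>"
proof -
  \<comment> \<open>This makes up for the fivefold enlargement of the balls.\<close>
  define \<epsilon>' where "\<epsilon>' = \<epsilon> / 5 ^ DIM('a)"
  have \<epsilon>': "0 < \<epsilon>'" using \<epsilon> by (simp add: \<epsilon>'_def)
  have Nn: "N \<in> null_sets lebesgue" using N by (simp add: negligible_iff_null_sets)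
  then have Ns: "N \<in> sets lebesgue" by (rule null_setsD2)
  obtain T where T: "open T" "N \<subseteq> T" "emeasure lebesgue (T - N) < ennreal \<epsilon>'"
    by (rule sets_lebesgue_outer_open[OF Ns \<epsilon>'])
  have Tm: "vol T \<le> ennreal \<epsilon>'"
  proof -
    have "emeasure lebesgue (T - N) = emeasure lebesgue T"
      using T Nn by (intro emeasure_Diff_null_set) auto
    then show ?thesis using T by simp
  qed
  define K where "K = {p. fst p \<in> N \<and> 0 < snd p \<and> snd p \<le> \<delta> \<and> cball (fst p) (snd p / 5) \<subseteq> T}"
  have K1: "\<And>p. p \<in> K \<Longrightarrow> 0 < snd p / 5 \<and> snd p / 5 \<le> \<delta>" by (auto simp: K_def)
  obtain C where C: "countable C" "C \<subseteq> K"
    "pairwise (\<lambda>i j. disjnt (cball (fst i) (snd i / 5)) (cball (fst j) (snd j / 5))) C"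
    "\<And>i. i \<in> K \<Longrightarrow> \<exists>j. j \<in> C \<and> \<not> disjnt (cball (fst i) (snd i / 5)) (cball (fst j) (snd j / 5)) \<and>
       cball (fst i) (snd i / 5) \<subseteq> ball (fst j) (5 * (snd j / 5))"
    by (rule Vitali_covering_lemma_cballs_balls[of K "\<lambda>p. snd p / 5" \<delta> fst]) (use K1 in auto)
  show thesis
  proof
    show "countable C" by fact
    show "\<forall>p\<in>C. 0 \<le> snd p \<and> snd p \<le> \<delta>" using C by (auto simp: K_def)
    show "N \<subseteq> (\<Union>p\<in>C. cball (fst p) (snd p))"
    proof
      fix x assume x: "x \<in> N"
      then obtain e where e: "0 < e" "cball x e \<subseteq> T" using T open_contains_cball by blast
      define r where "r = min \<delta> (5 * e)"
      have "cball x (r / 5) \<subseteq> cball x e" by (intro subset_cball) (simp add: r_def)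
      then have "(x, r) \<in> K" using x e \<delta> by (auto simp: K_def r_def)
      from C(4)[OF this] obtain j where j: "j \<in> C" "cball x (r / 5) \<subseteq> ball (fst j) (5 * (snd j / 5))" by auto
      have "x \<in> cball x (r / 5)" using e \<delta> by (simp add: r_def)
      then have "x \<in> cball (fst j) (snd j)" using j by (auto simp: subset_iff less_imp_le)
      then show "x \<in> (\<Union>p\<in>C. cball (fst p) (snd p))" using j by blast
    qed
    have scale: "vol (cball (fst p) (snd p)) = ennreal (5 ^ DIM('a)) * vol (cball (fst p) (snd p / 5))"
      if "p \<in> C" for p :: "'a \<times> real"
    proof -
      have "0 \<le> snd p" using that C by (auto simp: K_def)
      then show ?thesis by (simp add: emeasure_cball power_divide flip: ennreal_mult)
    qed
    have "(\<integral>\<^sup>+p. vol (cball (fst p) (snd p)) \<partial>count_space C)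
      = (\<integral>\<^sup>+p. ennreal (5 ^ DIM('a)) * vol (cball (fst p) (snd p / 5)) \<partial>count_space C)"
      by (intro nn_integral_cong scale) simp
    also have "\<dots> = ennreal (5 ^ DIM('a)) * (\<integral>\<^sup>+p. vol (cball (fst p) (snd p / 5)) \<partial>count_space C)"
      by (rule nn_integral_cmult) simp
    also have "(\<integral>\<^sup>+p. vol (cball (fst p) (snd p / 5)) \<partial>count_space C)
      = vol (\<Union>p\<in>C. cball (fst p) (snd p / 5))"
      by (rule emeasure_UN_countable[symmetric])
        (use C in \<open>auto simp: disjoint_family_on_def pairwise_def disjnt_def\<close>)
    also have "\<dots> \<le> vol T"
      using C T by (intro emeasure_mono) (auto simp: K_def)
    also note Tm
    also have "ennreal (5 ^ DIM('a)) * ennreal \<epsilon>' = ennreal \<epsilon>" using \<epsilon>' by (subst ennreal_mult[symmetric]) (auto simp: \<epsilon>'_def)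
    finally show "(\<integral>\<^sup>+p. vol (cball (fst p) (snd p)) \<partial>count_space C) \<le> ennreal \<epsilon>"
      by (simp add: mult_left_mono)
  qed
qed

text \<open>
The value \<open>None\<close> pads the enumeration when \<open>C\<close> is finite.
\<close>

lemma enumerate_countable:
  fixes f :: "'x \<Rightarrow> ennreal"
  assumes C: "countable C"
  obtains q :: "nat \<Rightarrow> 'x option" where "\<forall>k. q k = None \<or> q k \<in> Some ` C" "\<forall>p\<in>C. \<exists>k. q k = Some p"
    "(\<Sum>k. case_option 0 f (q k)) = (\<integral>\<^sup>+p. f p \<partial>count_space C)"
proof -
  define D where "D = to_nat_on C ` C"
  define q where "q k = (if k \<in> D then Some (from_nat_into C k) else None)" for k
  have bij: "bij_betw (to_nat_on C) C D" using C by (simp add: D_def inj_on_to_nat_on inj_on_imp_bij_betw)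
  have q: "q (to_nat_on C p) = Some p" if "p \<in> C" for p using that C by (simp add: q_def D_def)
  have "(\<Sum>k. case_option 0 f (q k)) = (\<integral>\<^sup>+k. case_option 0 f (q k) \<partial>count_space UNIV)"
    by (rule nn_integral_count_space_nat[symmetric])
  also have "\<dots> = (\<integral>\<^sup>+k. case_option 0 f (q k) \<partial>count_space D)"
    by (rule nn_integral_count_space_eq) (auto simp: q_def)
  also have "\<dots> = (\<integral>\<^sup>+p. case_option 0 f (q (to_nat_on C p)) \<partial>count_space C)"
    by (rule nn_integral_bij_count_space[OF bij, symmetric])
  also have "\<dots> = (\<integral>\<^sup>+p. f p \<partial>count_space C)" by (intro nn_integral_cong) (simp add: q)
  finally show thesis
  proof (rule that[rotated 2])
    show "\<forall>k. q k = None \<or> q k \<in> Some ` C" using C by (auto simp: q_def D_def)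
    show "\<forall>p\<in>C. \<exists>k. q k = Some p" using q by blast
  qed
qed

text \<open>
Disjoint balls inside the open box cover it up to a null set, and their volumes add up to at most
that of the box.  The null set and the faces of the box are covered by balls of total volume at most
\<open>\<epsilon>\<close>.  To get a sequence even when there are only finitely many balls, the radius \<open>0\<close> is admitted
for padding.
\<close>

lemma cbox_ball_cover:
  fixes l u :: "'a::euclidean_space"
  assumes \<delta>: "0 < \<delta>" and \<epsilon>: "0 < \<epsilon>"
  obtains a :: "nat \<Rightarrow> 'a" and r :: "nat \<Rightarrow> real" where "\<forall>k. 0 \<le> r k \<and> r k \<le> \<delta>"
    "cbox l u \<subseteq> (\<Union>k. cball (a k) (r k))"
    "(\<Sum>k. vol (cball (a k) (r k))) \<le> vol (cbox l u) + ennreal \<epsilon>"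
proof -
  define K where "K = {p. 0 < snd p \<and> snd p \<le> \<delta> \<and> cball (fst p) (snd p) \<subseteq> box l u}"
  have K: "\<exists>p. p \<in> K \<and> x \<in> cball (fst p) (snd p) \<and> snd p < d" if xd: "x \<in> box l u" "0 < d" for x d
  proof -
    obtain e where e: "0 < e" "cball x e \<subseteq> box l u" using open_box[of l u] xd(1) unfolding open_contains_cball by blast
    \<comment> \<open>The Vitali theorem needs balls of radius below any given \<open>d\<close> around \<open>x\<close>.\<close>
    define r where "r = min (min \<delta> e) (d / 2)"
    have "cball x r \<subseteq> cball x e" by (intro subset_cball) (simp add: r_def)
    then have "(x, r) \<in> K" using e \<delta> xd by (auto simp: K_def r_def)
    moreover have "0 \<le> r" "r < d" using e \<delta> xd by (auto simp: r_def)
    ultimately show ?thesis by (intro exI[of _ "(x, r)"]) auto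
  qed
  obtain C1 where C1: "countable C1" "C1 \<subseteq> K"
    "pairwise (\<lambda>i j. disjnt (cball (fst i) (snd i)) (cball (fst j) (snd j))) C1"
    "negligible (box l u - (\<Union>i\<in>C1. cball (fst i) (snd i)))"
    by (rule Vitali_covering_theorem_cballs[of K snd "box l u" fst]) (use K in \<open>auto simp: K_def\<close>)
  define N where "N = (box l u - (\<Union>i\<in>C1. cball (fst i) (snd i))) \<union> (cbox l u - box l u)"
  have "negligible N" unfolding N_def by (intro negligible_Un C1 negligible_frontier_interval)
  then obtain C2 where C2: "countable C2" "\<forall>p\<in>C2. 0 \<le> snd p \<and> snd p \<le> \<delta>"
    "N \<subseteq> (\<Union>p\<in>C2. cball (fst p) (snd p))"
    "(\<integral>\<^sup>+p. vol (cball (fst p) (snd p)) \<partial>count_space C2) \<le> ennreal \<epsilon>"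
    by (rule null_set_ball_cover[OF _ \<delta> \<epsilon>])
  define C where "C = C1 \<union> C2"
  let ?e = "\<lambda>p. vol (cball (fst p) (snd p))"
  have cC: "countable C" using C1 C2 by (simp add: C_def)
  have Cr: "0 \<le> snd p \<and> snd p \<le> \<delta>" if "p \<in> C" for p
    using that C1(2) C2(2) by (cases "p \<in> C2") (auto simp: C_def K_def)
  have cov: "cbox l u \<subseteq> (\<Union>p\<in>C. cball (fst p) (snd p))" using C2(3) by (auto simp: C_def N_def)
  have "(\<integral>\<^sup>+p. ?e p \<partial>count_space C1) = vol (\<Union>p\<in>C1. cball (fst p) (snd p))"
    by (rule emeasure_UN_countable[symmetric])
      (use C1 in \<open>auto simp: disjoint_family_on_def pairwise_def disjnt_def\<close>)
  also have "\<dots> \<le> vol (cbox l u)"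
    using C1 box_subset_cbox[of l u] by (intro emeasure_mono) (auto simp: K_def)
  finally have C1e: "(\<integral>\<^sup>+p. ?e p \<partial>count_space C1) \<le> vol (cbox l u)" .
  have "(\<integral>\<^sup>+p. ?e p \<partial>count_space C) = (\<integral>\<^sup>+p. ?e p * indicator C p \<partial>count_space UNIV)"
    by (rule nn_integral_count_space_indicator) simp
  also have "\<dots> \<le> (\<integral>\<^sup>+p. ?e p * indicator C1 p + ?e p * indicator C2 p \<partial>count_space UNIV)"
    by (intro nn_integral_mono) (auto simp: C_def indicator_def)
  also have "\<dots> = (\<integral>\<^sup>+p. ?e p * indicator C1 p \<partial>count_space UNIV) + (\<integral>\<^sup>+p. ?e p * indicator C2 p \<partial>count_space UNIV)"
    by (rule nn_integral_add) auto
  also have "\<dots> = (\<integral>\<^sup>+p. ?e p \<partial>count_space C1) + (\<integral>\<^sup>+p. ?e p \<partial>count_space C2)"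
    by (simp add: nn_integral_count_space_indicator[symmetric])
  also have "\<dots> \<le> vol (cbox l u) + ennreal \<epsilon>" by (intro add_mono C1e C2)
  finally have Ce: "(\<integral>\<^sup>+p. ?e p \<partial>count_space C) \<le> vol (cbox l u) + ennreal \<epsilon>" .
  obtain q where q: "\<forall>k. q k = None \<or> q k \<in> Some ` C" "\<forall>p\<in>C. \<exists>k. q k = Some p"
    "(\<Sum>k. case_option 0 ?e (q k)) = (\<integral>\<^sup>+p. ?e p \<partial>count_space C)"
    by (rule enumerate_countable[OF cC])
  define b where "b k = (case q k of None \<Rightarrow> (0, 0) | Some p \<Rightarrow> p)" for k
  show thesis
  proof (rule that[of "\<lambda>k. snd (b k)" "\<lambda>k. fst (b k)"])
    show "\<forall>k. 0 \<le> snd (b k) \<and> snd (b k) \<le> \<delta>"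
    proof
      fix k show "0 \<le> snd (b k) \<and> snd (b k) \<le> \<delta>"
        using q(1)[rule_format, of k] Cr \<delta> by (cases "q k") (auto simp: b_def)
    qed
    show "cbox l u \<subseteq> (\<Union>k. cball (fst (b k)) (snd (b k)))"
    proof
      fix x assume "x \<in> cbox l u"
      then obtain p where p: "p \<in> C" "x \<in> cball (fst p) (snd p)" using cov by blast
      then obtain k where "q k = Some p" using q(2) by blast
      then show "x \<in> (\<Union>k. cball (fst (b k)) (snd (b k)))" using p by (intro UN_I[of k]) (auto simp: b_def)
    qed
    have "?e (b k) = case_option 0 ?e (q k)" for k by (simp add: b_def split: option.split)
    then show "(\<Sum>k. ?e (b k)) \<le> vol (cbox l u) + ennreal \<epsilon>" using Ce q(3) by simp
  qed
qed

lemma hausdorff_premeasure_finite_Union_le: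
  fixes A :: "'i \<Rightarrow> 'a::metric_space set" and V :: "'i \<Rightarrow> nat \<Rightarrow> 'a set"
  assumes I: "finite I" and \<delta>: "0 \<le> \<delta>"
    and cov: "\<And>i. i \<in> I \<Longrightarrow> A i \<subseteq> (\<Union>k. V i k)"
    and V: "\<And>i k. i \<in> I \<Longrightarrow> bounded (V i k) \<and> diameter (V i k) \<le> \<delta>"
  shows "hausdorff_premeasure m \<delta> (\<Union>i\<in>I. A i) \<le> (\<Sum>i\<in>I. \<Sum>k. hausdorff_cost m (V i k))"
proof -
  let ?C = "I \<times> (UNIV :: nat set)"
  have cC: "countable ?C" using I by (simp add: countable_finite)
  obtain q where q: "\<forall>n. q n = None \<or> q n \<in> Some ` ?C" "\<forall>p\<in>?C. \<exists>n. q n = Some p"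
    "(\<Sum>n. case_option 0 (\<lambda>p. hausdorff_cost m (case_prod V p)) (q n)) = (\<integral>\<^sup>+p. hausdorff_cost m (case_prod V p) \<partial>count_space ?C)"
    by (rule enumerate_countable[OF cC])
  define U where "U n = case_option {} (case_prod V) (q n)" for n
  have "hausdorff_premeasure m \<delta> (\<Union>i\<in>I. A i) \<le> (\<Sum>n. hausdorff_cost m (U n))"
    unfolding hausdorff_premeasure_def
  proof (rule Inf_lower, rule CollectI, intro exI conjI allI)
    show "(\<Union>i\<in>I. A i) \<subseteq> (\<Union>n. U n)"
    proof clarify
      fix x i assume "i \<in> I" "x \<in> A i"
      then obtain k where k: "x \<in> V i k" "(i, k) \<in> ?C" using cov by blast
      then obtain n where "q n = Some (i, k)" using q(2) by blast
      then show "x \<in> (\<Union>n. U n)" using k by (intro UN_I[of n]) (auto simp: U_def)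
    qed
    show "bounded (U n)" "diameter (U n) \<le> \<delta>" for n
      using q(1)[rule_format, of n] V \<delta> by (auto simp: U_def)
  qed simp
  also have "\<dots> = (\<integral>\<^sup>+p. hausdorff_cost m (case_prod V p) \<partial>count_space ?C)"
  proof -
    have "hausdorff_cost m (U n) = case_option 0 (\<lambda>p. hausdorff_cost m (case_prod V p)) (q n)" for n
      by (simp add: U_def hausdorff_cost_def split: option.split)
    then show ?thesis by (simp only: q(3))
  qed
  also have "\<dots> = (\<integral>\<^sup>+p. hausdorff_cost m (case_prod V p) * indicator ?C p \<partial>count_space UNIV)"
    by (rule nn_integral_count_space_indicator) simp
  also have "\<dots> = (\<integral>\<^sup>+p. (\<Sum>i\<in>I. hausdorff_cost m (case_prod V p) * indicator ({i} \<times> UNIV) p) \<partial>count_space UNIV)"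
  proof (intro nn_integral_cong)
    fix p :: "'i \<times> nat"
    have "(\<Sum>i\<in>I. indicator ({i} \<times> UNIV) p) = (\<Sum>i\<in>I. if fst p = i then 1 else (0::ennreal))"
      by (intro sum.cong) (auto simp: indicator_def mem_Times_iff)
    also have "\<dots> = indicator ?C p" using I by (auto simp: indicator_def mem_Times_iff)
    finally show "hausdorff_cost m (case_prod V p) * indicator ?C p = (\<Sum>i\<in>I. hausdorff_cost m (case_prod V p) * indicator ({i} \<times> UNIV) p)"
      by (simp add: sum_distrib_left[symmetric])
  qed
  also have "\<dots> = (\<Sum>i\<in>I. \<integral>\<^sup>+p. hausdorff_cost m (case_prod V p) * indicator ({i} \<times> UNIV) p \<partial>count_space UNIV)"
    by (rule nn_integral_sum) simp
  also have "\<dots> = (\<Sum>i\<in>I. \<Sum>k. hausdorff_cost m (V i k))"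
  proof (rule sum.cong[OF refl])
    fix i assume "i \<in> I"
    have b: "bij_betw (Pair i) (UNIV :: nat set) ({i} \<times> UNIV)" by (auto simp: bij_betw_def inj_on_def)
    have "(\<integral>\<^sup>+p. hausdorff_cost m (case_prod V p) * indicator ({i} \<times> UNIV) p \<partial>count_space UNIV)
      = (\<integral>\<^sup>+p. hausdorff_cost m (case_prod V p) \<partial>count_space ({i} \<times> UNIV))"
      by (rule nn_integral_count_space_indicator[symmetric]) simp
    also have "\<dots> = (\<integral>\<^sup>+k. hausdorff_cost m (case_prod V (i, k)) \<partial>count_space UNIV)"
      by (rule nn_integral_bij_count_space[OF b, symmetric])
    finally show "(\<integral>\<^sup>+p. hausdorff_cost m (case_prod V p) * indicator ({i} \<times> UNIV) p \<partial>count_space UNIV) = (\<Sum>k. hausdorff_cost m (V i k))"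
      by (simp add: nn_integral_count_space_nat)
  qed
  finally show ?thesis .
qed

text \<open>
By Pythagoras the slice lies in a ball of radius \<open>\<rho>\<close> around the projection \<open>c\<close> of the centre.
\<close>

lemma ball_slice_cost:
  fixes a :: "'a::euclidean_space"
  assumes b: "b \<in> Basis" and r: "0 \<le> r"
  shows "hausdorff_cost m {x \<in> cball a r. x \<bullet> b = t} \<le>
    (if \<bar>t - a \<bullet> b\<bar> \<le> r then ennreal (unit_ball_vol (real m) * sqrt (r\<^sup>2 - (t - a \<bullet> b)\<^sup>2) ^ m) else 0)"
proof -
  let ?S = "{x \<in> cball a r. x \<bullet> b = t}"
  define \<rho> where "\<rho> = sqrt (r\<^sup>2 - (t - a \<bullet> b)\<^sup>2)"
  define c where "c = a + (t - a \<bullet> b) *\<^sub>R b"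
  have bb: "b \<bullet> b = 1" using b by simp
  have near: "\<bar>t - a \<bullet> b\<bar> \<le> r \<and> norm (x - c) \<le> \<rho>" if x: "x \<in> ?S" for x
  proof -
    have nx: "norm (x - a) \<le> r" using x by (simp add: dist_norm norm_minus_commute)
    have tb: "(x - a) \<bullet> b = t - a \<bullet> b" using x by (simp add: inner_diff_left)
    have 1: "\<bar>t - a \<bullet> b\<bar> \<le> r" using Basis_le_norm[OF b, of "x - a"] nx tb by simp
    have exp: "(w - s *\<^sub>R b) \<bullet> (w - s *\<^sub>R b) = w \<bullet> w - 2 * s * (w \<bullet> b) + s * s * (b \<bullet> b)" for w s
      by (simp add: inner_diff inner_commute algebra_simps)
    have "x - c = (x - a) - (t - a \<bullet> b) *\<^sub>R b" by (simp add: c_def)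
    then have xc: "(x - c) \<bullet> (x - c) = (x - a) \<bullet> (x - a) - (t - a \<bullet> b) * (t - a \<bullet> b)"
    proof -
      define s where "s = t - a \<bullet> b"
      have "(x - c) \<bullet> (x - c) = (x - a) \<bullet> (x - a) - 2 * s * ((x - a) \<bullet> b) + s * s * (b \<bullet> b)"
        unfolding \<open>x - c = (x - a) - (t - a \<bullet> b) *\<^sub>R b\<close> s_def[symmetric] by (rule exp)
      also have "\<dots> = (x - a) \<bullet> (x - a) - s * s" unfolding bb tb s_def[symmetric] by simp
      finally show ?thesis unfolding s_def .
    qed
    have "(norm (x - c))\<^sup>2 = (norm (x - a))\<^sup>2 - (t - a \<bullet> b)\<^sup>2"
      unfolding power2_norm_eq_inner xc by (simp add: power2_eq_square)
    also have "\<dots> \<le> r\<^sup>2 - (t - a \<bullet> b)\<^sup>2" using nx by (simp add: power_mono)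
    finally have "norm (x - c) \<le> \<rho>" unfolding \<rho>_def by (rule real_le_rsqrt)
    with 1 show ?thesis by simp
  qed
  show ?thesis
  proof (cases "?S = {}")
    case True
    then show ?thesis unfolding hausdorff_cost_def True by simp
  next
    case False
    then obtain x0 where x0: "x0 \<in> ?S" by blast
    have \<rho>0: "0 \<le> \<rho>" using near[OF x0] norm_ge_zero order_trans by blast
    have "diameter ?S \<le> 2 * \<rho>"
    proof (rule diameter_le)
      fix x y assume xy: "x \<in> ?S" "y \<in> ?S"
      have "norm (x - y) \<le> norm (x - c) + norm (y - c)" using norm_triangle_ineq4[of "x - c" "y - c"] by simp
      then show "norm (x - y) \<le> 2 * \<rho>" using near[OF xy(1)] near[OF xy(2)] by simp
    qed (use False in simp)
    moreover have "0 \<le> diameter ?S" by (intro diameter_ge_0 bounded_subset[OF bounded_cball[of a r]]) auto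
    ultimately have "unit_ball_vol (real m) * (diameter ?S / 2) ^ m \<le> unit_ball_vol (real m) * \<rho> ^ m"
      by (intro mult_left_mono power_mono) auto
    then show ?thesis using False near[OF x0] unfolding hausdorff_cost_def \<rho>_def by (auto intro: ennreal_leI)
  qed
qed

text \<open>
Integrated over \<open>t\<close>, the costs of the slices of a ball give its volume.  The interval \<open>{-1..1}\<close> has
length \<open>2\<close>, so if all slices cost more than \<open>c + \<epsilon>\<close> the total volume would exceed \<open>2 c\<close>.
\<close>

lemma exists_cheap_slice:
  fixes a :: "nat \<Rightarrow> 'a::euclidean_space"
  assumes b: "b \<in> Basis" and r: "\<And>k. 0 \<le> r k"
    and vol: "(\<Sum>k. vol (cball (a k) (r k))) \<le> 2 * c" and c: "c < \<infinity>" "0 < \<epsilon>"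
  shows "\<exists>t\<in>{-1..1}. (\<Sum>k. hausdorff_cost (DIM('a) - 1) {x \<in> cball (a k) (r k). x \<bullet> b = t}) \<le> c + ennreal \<epsilon>"
proof (rule ccontr)
  let ?m = "DIM('a) - 1"
  let ?c = "\<lambda>k t. if \<bar>t - a k \<bullet> b\<bar> \<le> r k then ennreal (unit_ball_vol (real ?m) * sqrt ((r k)\<^sup>2 - (t - a k \<bullet> b)\<^sup>2) ^ ?m) else 0"
  have [measurable]: "?c k \<in> borel_measurable borel" for k by measurable
  assume "\<not> ?thesis"
  then have big: "c + ennreal \<epsilon> < (\<Sum>k. hausdorff_cost ?m {x \<in> cball (a k) (r k). x \<bullet> b = t})" if "t \<in> {-1..1}" for t
    using that not_le by blast
  have big2: "c + ennreal \<epsilon> \<le> (\<Sum>k. ?c k t)" if "t \<in> {-1..1}" for t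
  proof -
    have "(\<Sum>k. hausdorff_cost ?m {x \<in> cball (a k) (r k). x \<bullet> b = t}) \<le> (\<Sum>k. ?c k t)"
      using r by (intro suminf_le ball_slice_cost b) auto
    then show ?thesis using big[OF that] by simp
  qed
  have "2 * (c + ennreal \<epsilon>) = (\<integral>\<^sup>+t. (c + ennreal \<epsilon>) * indicator {-1..1} t \<partial>(lborel::real measure))"
    by (simp add: nn_integral_cmult mult.commute)
  also have "\<dots> \<le> (\<integral>\<^sup>+t. (\<Sum>k. ?c k t) \<partial>lborel)"
    using big2 by (intro nn_integral_mono) (auto simp: indicator_def)
  also have "\<dots> = (\<Sum>k. \<integral>\<^sup>+t. ?c k t \<partial>lborel)" by (rule nn_integral_suminf) measurable
  also have "\<dots> \<le> (\<Sum>k. vol (cball (0::'a) (r k)))"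
    by (intro suminf_le ball_slices_integral[OF b]) auto
  also have "\<dots> = (\<Sum>k. vol (cball (a k) (r k)))" using r by (simp add: emeasure_cball)
  also note vol
  finally have le: "2 * (c + ennreal \<epsilon>) \<le> 2 * c" .
  obtain x where x: "c = ennreal x" "0 \<le> x" using c by (cases c) auto
  have "ennreal (2 * (x + \<epsilon>)) \<le> ennreal (2 * x)" using le x c(2) by (simp add: ennreal_mult)
  then have "2 * (x + \<epsilon>) \<le> 2 * x" using x c(2) by (subst (asm) ennreal_le_iff) auto
  then show False using c(2) by simp
qed

lemma diameter_plus_image:
  fixes S :: "'a::real_normed_vector set"
  shows "diameter ((+) v ` S) = diameter S"
proof -
  have "(\<lambda>(x, y). dist x y) ` ((+) v ` S \<times> (+) v ` S) = (\<lambda>(x, y). dist x y) ` (S \<times> S)"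
    by (force simp: image_iff)
  then show ?thesis by (simp add: diameter_def)
qed

lemma hausdorff_cost_translation:
  fixes S :: "'a::real_normed_vector set"
  shows "hausdorff_cost m ((+) v ` S) = hausdorff_cost m S"
  by (simp add: hausdorff_cost_def diameter_plus_image)

text \<open>
The boundary of the cube is the union of \<open>2 n\<close> facets.  Each is a translate of every slice of the
cube parallel to it, in particular of a slice whose cover by slices of balls costs
little more than \<open>2\<^sup>n\<^sup>-\<^sup>1\<close>.
\<close>

lemma hausdorff_cube_boundary_le:
  fixes S :: "(real ^ 'n) set"
  assumes S: "S \<subseteq> {x. (\<forall>i. -1 \<le> x $ i \<and> x $ i \<le> 1) \<and> (\<exists>i. x $ i = -1 \<or> x $ i = 1)}"
  shows "hausdorff_measure (CARD('n) - 1) S \<le> of_nat (CARD('n) * 2 ^ CARD('n))"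
proof -
  let ?m = "CARD('n) - 1"
  have CARD: "CARD('n) = Suc ?m" by simp
  have DIM: "DIM(real ^ 'n) = CARD('n)" by simp
  define I where "I = (UNIV :: 'n set) \<times> {-1, 1::real}"
  have cI: "finite I" "card I = 2 * CARD('n)" by (auto simp: I_def card_cartesian_product)
  define Q where "Q = cbox (\<chi> i. -1) (\<chi> i. 1 :: real ^ 'n)"
  have Q: "x \<in> Q \<longleftrightarrow> (\<forall>i. -1 \<le> x $ i \<and> x $ i \<le> 1)" for x by (simp add: Q_def mem_box_cart)
  have Qvol: "vol Q = ennreal (2 * 2 ^ ?m)"
  proof -
    have ne: "cbox (\<chi> i. -1) (\<chi> i. 1 :: real ^ 'n) \<noteq> {}"
    proof -
      have "0 \<in> Q" by (simp add: Q)
      then show ?thesis unfolding Q_def by blast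
    qed
    have "vol Q = ennreal (measure lborel Q)"
      unfolding Q_def by (rule emeasure_eq_ennreal_measure) (simp add: emeasure_lborel_cbox_eq)
    also have "measure lborel Q = 2 ^ CARD('n)" unfolding Q_def content_cbox_cart[OF ne] by simp
    also have "(2::real) ^ CARD('n) = 2 * 2 ^ ?m" by (subst CARD) (simp only: power_Suc)
    finally show ?thesis .
  qed
  define A where "A i = {x \<in> Q. x $ fst i = snd i}" for i :: "'n \<times> real"
  have SA: "S \<subseteq> (\<Union>i\<in>I. A i)"
  proof
    fix x assume "x \<in> S"
    then have x: "\<forall>i. -1 \<le> x $ i \<and> x $ i \<le> 1" "\<exists>i. x $ i = -1 \<or> x $ i = 1" using S by blast+
    then obtain i where "x $ i = -1 \<or> x $ i = 1" by blast
    then have "(i, x $ i) \<in> I" "x \<in> A (i, x $ i)" using x by (auto simp: A_def I_def Q)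
    then show "x \<in> (\<Union>i\<in>I. A i)" by blast
  qed
  have pre: "hausdorff_premeasure ?m \<delta> S \<le> of_nat (CARD('n) * 2 ^ CARD('n))" if \<delta>: "0 < \<delta>" for \<delta>
  proof -
    have eps: "hausdorff_premeasure ?m \<delta> S \<le> of_nat (2 * CARD('n)) * (ennreal (2 ^ ?m + \<epsilon>) + ennreal \<epsilon>)" if \<epsilon>: "0 < \<epsilon>" for \<epsilon>
    proof -
      have \<delta>2: "0 < \<delta> / 2" using \<delta> by simp
      obtain a r where ar0: "\<forall>k. 0 \<le> r k \<and> r k \<le> \<delta> / 2" and ar': "Q \<subseteq> (\<Union>k. cball (a k) (r k))"
        "(\<Sum>k. vol (cball (a k) (r k))) \<le> vol Q + ennreal \<epsilon>"
        by (rule cbox_ball_cover[OF \<delta>2 \<epsilon>, of "\<chi> i. -1" "\<chi> i. 1 :: real ^ 'n", folded Q_def])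
      have ar: "\<And>k. 0 \<le> r k" "\<And>k. r k \<le> \<delta> / 2" using ar0 by auto
      note ar = ar ar'
      have "vol Q + ennreal \<epsilon> = ennreal (2 * 2 ^ ?m + \<epsilon>)" unfolding Qvol using \<epsilon> by simp
      also have "\<dots> \<le> ennreal (2 * (2 ^ ?m + \<epsilon>))" using \<epsilon> by (intro ennreal_leI) simp
      also have "\<dots> = 2 * ennreal (2 ^ ?m + \<epsilon>)" using \<epsilon> by (subst ennreal_mult) auto
      finally have vol: "(\<Sum>k. vol (cball (a k) (r k))) \<le> 2 * ennreal (2 ^ ?m + \<epsilon>)" using ar(4) by simp
      have "\<exists>t. t \<in> {-1..1} \<and> (\<Sum>k. hausdorff_cost ?m {x \<in> cball (a k) (r k). x $ j = t}) \<le> ennreal (2 ^ ?m + \<epsilon>) + ennreal \<epsilon>" for j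
      proof -
        have ax: "axis j 1 \<in> (Basis :: (real ^ 'n) set)" by (simp add: axis_in_Basis_iff)
        obtain t where "t \<in> {-1..1}" "(\<Sum>k. hausdorff_cost (DIM(real^'n) - 1) {x \<in> cball (a k) (r k). x \<bullet> axis j 1 = t}) \<le> ennreal (2 ^ ?m + \<epsilon>) + ennreal \<epsilon>"
          using exists_cheap_slice[OF ax ar(1) vol _ \<epsilon>] by auto
        then show ?thesis unfolding DIM by (auto simp: inner_axis)
      qed
      then have "\<forall>j. \<exists>t. t \<in> {-1..1} \<and> (\<Sum>k. hausdorff_cost ?m {x \<in> cball (a k) (r k). x $ j = t}) \<le> ennreal (2 ^ ?m + \<epsilon>) + ennreal \<epsilon>" ..
      from choice[OF this] obtain \<tau> where "\<forall>j. \<tau> j \<in> {-1..1} \<and>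
        (\<Sum>k. hausdorff_cost ?m {x \<in> cball (a k) (r k). x $ j = \<tau> j}) \<le> ennreal (2 ^ ?m + \<epsilon>) + ennreal \<epsilon>"
        ..
      then have \<tau>: "\<And>j. \<tau> j \<in> {-1..1}"
        "\<And>j. (\<Sum>k. hausdorff_cost ?m {x \<in> cball (a k) (r k). x $ j = \<tau> j}) \<le> ennreal (2 ^ ?m + \<epsilon>) + ennreal \<epsilon>"
        by blast+
      \<comment> \<open>Slices of the covering balls by \<open>x\<^sub>i = \<tau>\<^sub>i\<close>, translated to the facet \<open>x\<^sub>i = \<plusminus> 1\<close>.\<close>
      define V where "V i k = (+) ((snd i - \<tau> (fst i)) *\<^sub>R axis (fst i) 1) ` {x \<in> cball (a k) (r k). x $ fst i = \<tau> (fst i)}"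
        for i :: "'n \<times> real" and k
      have "hausdorff_premeasure ?m \<delta> (\<Union>i\<in>I. A i) \<le> (\<Sum>i\<in>I. \<Sum>k. hausdorff_cost ?m (V i k))"
      proof (rule hausdorff_premeasure_finite_Union_le[OF cI(1)])
        show "0 \<le> \<delta>" using \<delta> by simp
        fix i k assume "i \<in> I"
        have sub: "{x \<in> cball (a k) (r k). x $ fst i = \<tau> (fst i)} \<subseteq> cball (a k) (r k)" by auto
        have "diameter (V i k) = diameter {x \<in> cball (a k) (r k). x $ fst i = \<tau> (fst i)}" by (simp add: V_def diameter_plus_image)
        also have "\<dots> \<le> diameter (cball (a k) (r k))" by (intro diameter_subset sub) simp
        also have "\<dots> \<le> \<delta>" using ar(1)[of k] ar(2)[of k] by simp
        finally have d: "diameter (V i k) \<le> \<delta>" .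
        have "bounded (V i k)"
          unfolding V_def by (intro bounded_translation bounded_subset[OF bounded_cball sub])
        with d show "bounded (V i k) \<and> diameter (V i k) \<le> \<delta>" by blast
      next
        fix i assume i: "i \<in> I"
        show "A i \<subseteq> (\<Union>k. V i k)"
        proof
          fix x assume x: "x \<in> A i"
          define y where "y = x - (snd i - \<tau> (fst i)) *\<^sub>R axis (fst i) 1"
          have yi: "y $ fst i = \<tau> (fst i)" using x by (simp add: y_def A_def)
          have yj: "y $ j = x $ j" if "j \<noteq> fst i" for j using that by (simp add: y_def axis_def)
          have "y \<in> Q" unfolding Q
          proof
            fix j show "-1 \<le> y $ j \<and> y $ j \<le> 1" using yi yj \<tau>(1)[of "fst i"] x by (cases "j = fst i") (auto simp: A_def Q)
          qed
          then obtain k where "y \<in> cball (a k) (r k)" using ar(3) by blast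
          then have "x \<in> V i k" unfolding V_def using yi by (intro image_eqI[of _ _ y]) (auto simp: y_def)
          then show "x \<in> (\<Union>k. V i k)" by blast
        qed
      qed
      also have "\<dots> \<le> (\<Sum>i\<in>I. ennreal (2 ^ ?m + \<epsilon>) + ennreal \<epsilon>)"
        using \<tau>(2) by (intro sum_mono) (simp add: V_def hausdorff_cost_translation)
      also have "\<dots> = of_nat (2 * CARD('n)) * (ennreal (2 ^ ?m + \<epsilon>) + ennreal \<epsilon>)" using cI by simp
      finally have "hausdorff_premeasure ?m \<delta> (\<Union>i\<in>I. A i) \<le> of_nat (2 * CARD('n)) * (ennreal (2 ^ ?m + \<epsilon>) + ennreal \<epsilon>)" .
      moreover have "hausdorff_premeasure ?m \<delta> S \<le> hausdorff_premeasure ?m \<delta> (\<Union>i\<in>I. A i)"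
        by (rule hausdorff_premeasure_mono[OF SA])
      ultimately show ?thesis by simp
    qed
    have eps': "hausdorff_premeasure ?m \<delta> S \<le> ennreal (2 * real CARD('n) * (2 ^ ?m + 2 * \<epsilon>))" if \<epsilon>: "0 < \<epsilon>" for \<epsilon>
    proof -
      have "ennreal (2 ^ ?m + \<epsilon>) + ennreal \<epsilon> = ennreal (2 ^ ?m + 2 * \<epsilon>)" using \<epsilon> by (subst ennreal_plus[symmetric]) auto
      moreover have "of_nat (2 * CARD('n)) = ennreal (2 * CARD('n))" by (simp add: ennreal_of_nat_eq_real_of_nat)
      moreover have "ennreal (2 * CARD('n)) * ennreal (2 ^ ?m + 2 * \<epsilon>) = ennreal (2 * real CARD('n) * (2 ^ ?m + 2 * \<epsilon>))"
        using \<epsilon> by (subst ennreal_mult[symmetric]) auto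
      ultimately show ?thesis using eps[OF \<epsilon>] by simp
    qed
    have "((\<lambda>\<epsilon>. ennreal (2 * real CARD('n) * (2 ^ ?m + 2 * \<epsilon>))) \<longlongrightarrow> ennreal (2 * real CARD('n) * (2 ^ ?m + 2 * (0::real)))) (at_right 0)"
      by (intro tendsto_intros)
    then have le: "hausdorff_premeasure ?m \<delta> S \<le> ennreal (2 * real CARD('n) * (2 ^ ?m + 2 * (0::real)))"
    proof (rule tendsto_lowerbound)
      show "\<forall>\<^sub>F \<epsilon> in at_right 0. hausdorff_premeasure ?m \<delta> S \<le> ennreal (2 * real CARD('n) * (2 ^ ?m + 2 * \<epsilon>))"
        using eventually_at_right_less[of "0::real"] by (rule eventually_mono) (rule eps')
    qed simp
    have eq: "2 * real CARD('n) * (2 ^ ?m + 2 * (0::real)) = real (CARD('n) * 2 ^ CARD('n))"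
    proof -
      have "(2::real) ^ CARD('n) = 2 * 2 ^ ?m" by (subst CARD) (simp only: power_Suc)
      then show ?thesis by simp
    qed
    show ?thesis using le unfolding eq by (simp only: ennreal_of_nat_eq_real_of_nat)
  qed
  show ?thesis unfolding hausdorff_measure_def by (rule SUP_least) (use pre in auto)
qed

section \<open>Triangulating a polytope by flags of faces\<close>

text \<open>
Follow the ray from \<open>a\<close> through \<open>x\<close>.  Among the half-spaces that define \<open>G\<close>, those with
\<open>u h \<bullet> D > 0\<close> are left at the parameter \<open>q h\<close>, and the ray leaves \<open>G\<close> at the smallest of
these.  The facet reached does not contain \<open>a\<close>, because its functional increases along the ray.
\<close>

lemma exit_facet:
  fixes G :: "'a::euclidean_space set"
  assumes G: "polytope G" and a: "a \<in> G" and x: "x \<in> G" "x \<noteq> a"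
  obtains F b t where "F facet_of G" "a \<notin> F" "b \<in> F" "0 < t" "t \<le> 1" "x = (1 - t) *\<^sub>R a + t *\<^sub>R b"
proof -
  have "polyhedron G" using G by (rule polytope_imp_polyhedron)
  then obtain H where H: "finite H" "G = affine hull G \<inter> \<Inter>H"
    and Hh: "\<forall>h\<in>H. \<exists>u b. u \<noteq> 0 \<and> h = {x. u \<bullet> x \<le> b}"
    and Hmin: "\<forall>H'. H' \<subset> H \<longrightarrow> G \<subset> affine hull G \<inter> \<Inter>H'"
    by (auto simp: polyhedron_Int_affine_minimal)
  from Hh obtain u c where uc: "\<And>h. h \<in> H \<Longrightarrow> u h \<noteq> 0 \<and> h = {x. u h \<bullet> x \<le> c h}" by metis
  have facet: "C facet_of G \<longleftrightarrow> (\<exists>h. h \<in> H \<and> C = G \<inter> {x. u h \<bullet> x = c h})" for C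
    by (rule facet_of_polyhedron_explicit[OF H uc]) (use Hmin in auto)
  define D where "D = x - a"
  have D0: "D \<noteq> 0" using x by (simp add: D_def)
  have ray_aff: "a + s *\<^sub>R D \<in> affine hull G" for s
  proof -
    have "(1 - s) *\<^sub>R a + s *\<^sub>R x \<in> affine hull G"
      using a x affine_affine_hull[of G] hull_subset[of G affine] by (auto simp: affine_alt)
    then show ?thesis by (simp add: D_def algebra_simps)
  qed
  have mem: "y \<in> G \<longleftrightarrow> y \<in> affine hull G \<and> (\<forall>h\<in>H. u h \<bullet> y \<le> c h)" for y
    using H(2) uc by blast
  define P where "P = {h \<in> H. 0 < u h \<bullet> D}"
  \<comment> \<open>The parameter at which the ray leaves the half-space \<open>h\<close>.\<close>
  define q where "q h = (c h - u h \<bullet> a) / (u h \<bullet> D)" for h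
  have fP: "finite P" using H by (simp add: P_def)
  \<comment> \<open>Otherwise the whole ray would lie in \<open>G\<close>, which is bounded.\<close>
  have neP: "P \<noteq> {}"
  proof
    assume "P = {}"
    then have np: "u h \<bullet> D \<le> 0" if "h \<in> H" for h using that by (auto simp: P_def not_less)
    have ray: "a + s *\<^sub>R D \<in> G" if "0 \<le> s" for s
    proof -
      have "u h \<bullet> (a + s *\<^sub>R D) \<le> c h" if "h \<in> H" for h
      proof -
        have "u h \<bullet> (a + s *\<^sub>R D) = u h \<bullet> a + s * (u h \<bullet> D)" by (simp add: inner_add_right)
        also have "\<dots> \<le> u h \<bullet> a" using np[OF that] \<open>0 \<le> s\<close> by (simp add: mult_nonneg_nonpos)
        also have "\<dots> \<le> c h" using a mem that by auto
        finally show ?thesis .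
      qed
      then show ?thesis using mem ray_aff by auto
    qed
    obtain B where B: "\<And>y. y \<in> G \<Longrightarrow> norm y \<le> B"
      using polytope_imp_bounded[OF G] by (auto simp: bounded_iff)
    define s where "s = (B + norm a + 1) / norm D"
    have B0: "0 \<le> B" using B[OF a] norm_ge_zero order_trans by blast
    have s0: "0 \<le> s" using B0 by (simp add: s_def)
    have "norm (s *\<^sub>R D) = B + norm a + 1" using D0 B0 by (simp add: s_def)
    moreover have "norm (s *\<^sub>R D) \<le> norm (a + s *\<^sub>R D) + norm a"
      using norm_triangle_ineq4[of "a + s *\<^sub>R D" a] by simp
    ultimately show False using B[OF ray[OF s0]] by simp
  qed
  define T where "T = Min (q ` P)"
  have "T \<in> q ` P" unfolding T_def using fP neP by simp
  then obtain h where h: "h \<in> P" "T = q h" by auto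
  have Tmin: "T \<le> q k" if "k \<in> P" for k using that fP by (simp add: T_def)
  have T1: "1 \<le> T"
  proof -
    have "u h \<bullet> x \<le> c h" using h x mem by (auto simp: P_def)
    then have "u h \<bullet> D \<le> c h - u h \<bullet> a" by (simp add: D_def inner_diff_right)
    then show ?thesis using h by (simp add: q_def P_def)
  qed
  define b where "b = a + T *\<^sub>R D"
  have bG: "b \<in> G"
  proof -
    have "u k \<bullet> b \<le> c k" if k: "k \<in> H" for k
    proof (cases "k \<in> P")
      case True
      then have "T * (u k \<bullet> D) \<le> c k - u k \<bullet> a" using Tmin[OF True] by (simp add: q_def P_def pos_le_divide_eq)
      then show ?thesis by (simp add: b_def inner_add_right)
    next
      case False
      then have "u k \<bullet> D \<le> 0" using k by (auto simp: P_def not_less)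
      then have "T * (u k \<bullet> D) \<le> 0" using T1 by (simp add: mult_nonneg_nonpos)
      moreover have "u k \<bullet> a \<le> c k" using a mem k by auto
      ultimately show ?thesis by (simp add: b_def inner_add_right)
    qed
    then show ?thesis using mem ray_aff by (auto simp: b_def)
  qed
  have hb: "u h \<bullet> b = c h"
    using h by (simp add: b_def inner_add_right q_def P_def)
  show thesis
  proof
    show "(G \<inter> {x. u h \<bullet> x = c h}) facet_of G" using facet h by (auto simp: P_def)
    show "b \<in> G \<inter> {x. u h \<bullet> x = c h}" using bG hb by auto
    have "0 < T * (u h \<bullet> D)" using h T1 by (simp add: P_def)
    then have "u h \<bullet> a \<noteq> c h" using hb by (simp add: b_def inner_add_right)
    then show "a \<notin> G \<inter> {x. u h \<bullet> x = c h}" by auto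
    show "0 < 1 / T" "1 / T \<le> 1" using T1 by auto
    show "x = (1 - 1 / T) *\<^sub>R a + (1 / T) *\<^sub>R b" using T1 by (simp add: b_def D_def algebra_simps)
  qed
qed

lemma convex_hull_insert_convexE:
  assumes "convex A" "A \<noteq> {}" "x \<in> convex hull (insert a A)"
  obtains t b where "0 \<le> t" "t \<le> 1" "b \<in> A" "x = (1 - t) *\<^sub>R a + t *\<^sub>R b"
proof -
  obtain u v b where uvb: "0 \<le> u" "0 \<le> v" "u + v = 1" "b \<in> convex hull A" "x = u *\<^sub>R a + v *\<^sub>R b"
    using assms(2,3) by (auto simp: convex_hull_insert)
  have "b \<in> A" using uvb(4) assms(1) by (simp add: convex_hull_eq[THEN iffD2] hull_same)
  moreover have "u = 1 - v" using uvb by simp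
  ultimately show thesis using that[of v b] uvb by simp
qed

text \<open>
A point other than \<open>a\<close> in both cones determines a ray from \<open>a\<close>.  If the ray met \<open>A\<close> and \<open>B\<close> in
different points, the nearer one would lie strictly between \<open>a\<close> and the farther one, and the
definition of a face would put \<open>a\<close> into the face of the nearer point.
\<close>

lemma cone_over_facets_Int:
  fixes G :: "'a::euclidean_space set"
  assumes F: "F face_of G" "F' face_of G" and a: "a \<in> G" "a \<notin> F" "a \<notin> F'"
    and A: "convex A" "A \<noteq> {}" "A \<subseteq> F" and B: "convex B" "B \<noteq> {}" "B \<subseteq> F'"
  shows "convex hull (insert a A) \<inter> convex hull (insert a B) \<subseteq> convex hull (insert a (A \<inter> B))"
proof
  fix x assume x: "x \<in> convex hull (insert a A) \<inter> convex hull (insert a B)"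
  show "x \<in> convex hull (insert a (A \<inter> B))"
  proof (cases "x = a")
    case True then show ?thesis by (simp add: hull_inc)
  next
    case False
    obtain t b where t: "0 \<le> t" "t \<le> 1" "b \<in> A" "x = (1 - t) *\<^sub>R a + t *\<^sub>R b"
      using convex_hull_insert_convexE[OF A(1,2)] x by blast
    obtain s c where s: "0 \<le> s" "s \<le> 1" "c \<in> B" "x = (1 - s) *\<^sub>R a + s *\<^sub>R c"
      using convex_hull_insert_convexE[OF B(1,2)] x by blast
    have t0: "0 < t" and s0: "0 < s" using t s False by (auto simp: less_le)
    have bG: "b \<in> G" "c \<in> G" using t s A B F by (auto dest: face_of_imp_subset)
    have eq: "t *\<^sub>R (b - a) = s *\<^sub>R (c - a)" using t(4) s(4) by (simp add: algebra_simps)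
    have key: False
      if "t < s" "0 < t" and eq: "t *\<^sub>R (b - a) = s *\<^sub>R (c - a)" and c: "c \<in> F'" "a \<notin> F'" "F' face_of G" "b \<in> G"
      for t s b c F'
    proof -
      have "c - a = (t / s) *\<^sub>R (b - a)"
      proof -
        have "(t / s) *\<^sub>R (b - a) = (1 / s) *\<^sub>R (t *\<^sub>R (b - a))" by simp
        also have "\<dots> = c - a" using that by (simp add: eq)
        finally show ?thesis by simp
      qed
      then have "c = a + (t / s) *\<^sub>R (b - a)" by (metis add.commute diff_add_cancel)
      then have "c = (1 - t / s) *\<^sub>R a + (t / s) *\<^sub>R b" by (simp add: algebra_simps)
      moreover have "a \<noteq> b" using \<open>c - a = (t / s) *\<^sub>R (b - a)\<close> c by auto
      ultimately have "c \<in> open_segment a b" using that(1,2) by (auto simp: in_segment intro!: exI[of _ "t / s"])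
      then show False using c a(1) face_ofD[OF c(3)] by blast
    qed
    have "t = s"
    proof (rule ccontr)
      assume "t \<noteq> s"
      then consider "t < s" | "s < t" by linarith
      then show False
      proof cases
        case 1
        show ?thesis by (rule key[OF 1 t0 eq _ a(3) F(2) bG(1)]) (use s B in auto)
      next
        case 2
        show ?thesis by (rule key[OF 2 s0 eq[symmetric] _ a(2) F(1) bG(2)]) (use t A in auto)
      qed
    qed
    with eq t0 have "b = c" by simp
    then have "b \<in> A \<inter> B" using t s by simp
    then have "b \<in> convex hull (insert a (A \<inter> B))" "a \<in> convex hull (insert a (A \<inter> B))" by (auto intro: hull_inc)
    then show ?thesis using t convex_convex_hull[of "insert a (A \<inter> B)"] by (auto simp: convex_alt)
  qed
qed

text \<open>
Flags of faces of a polytope of dimension \<open>d\<close>, where \<open>p\<close> picks a point of each face.  A facet that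
contains the chosen point is skipped, since the cone over it would be degenerate.
\<close>

fun flags :: "('a::euclidean_space set \<Rightarrow> 'a) \<Rightarrow> nat \<Rightarrow> 'a set \<Rightarrow> 'a set list set" where
  "flags p 0 G = {[G]}"
| "flags p (Suc d) G = (\<Union>F\<in>{F. F facet_of G \<and> p G \<notin> F}. (#) G ` flags p d F)"

definition flag_simplex :: "('a::euclidean_space set \<Rightarrow> 'a) \<Rightarrow> 'a set list \<Rightarrow> 'a set" where
  "flag_simplex p \<phi> = convex hull (p ` set \<phi>)"

lemma flag_simplex_Cons: "flag_simplex p (G # \<phi>) = convex hull (insert (p G) (flag_simplex p \<phi>))"
  unfolding flag_simplex_def by (simp add: hull_insert[symmetric])

lemma convex_flag_simplex: "convex (flag_simplex p \<phi>)"
  by (simp add: flag_simplex_def)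

lemma compact_flag_simplex: "compact (flag_simplex p \<phi>)"
  by (simp add: flag_simplex_def finite_imp_compact_convex_hull)

lemma facet_of_polytope:
  assumes "polytope G" "aff_dim G = int (Suc d)" "F facet_of G"
  shows "polytope F" "aff_dim F = int d"
  using assms by (auto simp: facet_of_def intro: face_of_polytope_polytope)

lemma finite_flags: "polytope G \<Longrightarrow> aff_dim G = int d \<Longrightarrow> finite (flags p d G)"
proof (induction d arbitrary: G)
  case (Suc d)
  have "finite {F. F facet_of G \<and> p G \<notin> F}"
    by (rule finite_subset[OF _ finite_polytope_facets[OF Suc.prems(1)]]) auto
  moreover have "finite (flags p d F)" if "F facet_of G" for F
    using Suc.IH facet_of_polytope[OF Suc.prems that] by blast
  ultimately show ?case by auto
qed simp

lemma flags_nonempty_list: "\<phi> \<in> flags p d G \<Longrightarrow> \<exists>\<psi>. \<phi> = G # \<psi>"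
  by (cases d) auto

lemma flag_properties:
  assumes "polytope G" "aff_dim G = int d" "\<phi> \<in> flags p d G"
  shows "length \<phi> = Suc d"
    and "\<And>i. i \<le> d \<Longrightarrow> \<phi> ! i face_of G \<and> polytope (\<phi> ! i) \<and> aff_dim (\<phi> ! i) = int d - int i"
    and "\<And>i j. i \<le> j \<Longrightarrow> j \<le> d \<Longrightarrow> \<phi> ! j \<subseteq> \<phi> ! i"
  using assms
proof (atomize(full), induction d arbitrary: G \<phi>)
  case 0
  then show ?case by (auto simp: face_of_refl polytope_imp_convex)
next
  case (Suc d)
  then obtain F \<psi> where F: "F facet_of G" "p G \<notin> F" "\<phi> = G # \<psi>" "\<psi> \<in> flags p d F" by auto
  note IH = Suc.IH[rule_format, OF facet_of_polytope[OF Suc.prems(1,2) F(1)] F(4), simplified]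
  have FG: "F face_of G" using F(1) by (rule facet_of_imp_face_of)
  have hd: "\<psi> ! 0 = F" using flags_nonempty_list[OF F(4)] by auto
  have G: "G face_of G" using Suc.prems by (simp add: face_of_refl polytope_imp_convex)
  have "\<phi> ! i face_of G \<and> polytope (\<phi> ! i) \<and> aff_dim (\<phi> ! i) = int (Suc d) - int i" if "i \<le> Suc d" for i
  proof (cases i)
    case 0 then show ?thesis using Suc.prems G F by simp
  next
    case (Suc k)
    then show ?thesis using IH that F FG by (auto intro: face_of_trans)
  qed
  moreover have "\<phi> ! j \<subseteq> \<phi> ! i" if ij: "i \<le> j" "j \<le> Suc d" for i j
  proof (cases i)
    case 0
    show ?thesis
    proof (cases j)
      case (Suc k)
      then have k: "k \<le> d" using that by simp
      have "\<forall>i j. i \<le> j \<longrightarrow> j \<le> d \<longrightarrow> \<psi> ! j \<subseteq> \<psi> ! i" using IH by blast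
      then have "\<psi> ! k \<subseteq> \<psi> ! 0" using k by blast
      then have "\<psi> ! k \<subseteq> F" by (simp add: hd)
      then show ?thesis using 0 Suc F FG face_of_imp_subset by auto
    qed (use 0 in simp)
  next
    case (Suc k)
    then obtain l where "j = Suc l" using ij by (cases j) auto
    then show ?thesis using IH ij Suc F by auto
  qed
  ultimately show ?case using IH F by auto
qed

lemma flag_simplex_subset:
  assumes p: "\<And>G. polytope G \<Longrightarrow> G \<noteq> {} \<Longrightarrow> p G \<in> G"
    and "polytope G" "aff_dim G = int d" "\<phi> \<in> flags p d G"
  shows "flag_simplex p \<phi> \<subseteq> G"
  unfolding flag_simplex_def
proof (rule hull_minimal)
  show "convex G" using assms by (simp add: polytope_imp_convex)
  show "p ` set \<phi> \<subseteq> G"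
  proof clarsimp
    fix H assume "H \<in> set \<phi>"
    then obtain i where i: "i < length \<phi>" "H = \<phi> ! i" by (auto simp: in_set_conv_nth)
    have "i \<le> d" using flag_properties(1)[OF assms(2-4)] i by simp
    then have "H face_of G" "polytope H" "aff_dim H = int d - int i"
      using flag_properties(2)[OF assms(2-4)] i by auto
    then have "H \<noteq> {}" using \<open>i \<le> d\<close> by auto
    then show "p H \<in> G" using p \<open>polytope H\<close> \<open>H face_of G\<close> face_of_imp_subset by blast
  qed
qed

lemma flag_simplex_nonempty: "\<phi> \<in> flags p d G \<Longrightarrow> flag_simplex p \<phi> \<noteq> {}"
  by (cases d) (auto simp: flag_simplex_def)

text \<open>
Induction on the dimension: by \<open>exit_facet\<close>, \<open>G\<close> is the union of the cones from \<open>p G\<close> over the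
facets that do not contain \<open>p G\<close>.
\<close>

lemma flag_simplices_cover:
  assumes p: "\<And>G. polytope G \<Longrightarrow> G \<noteq> {} \<Longrightarrow> p G \<in> G"
  shows "polytope G \<Longrightarrow> aff_dim G = int d \<Longrightarrow> x \<in> G \<Longrightarrow> \<exists>\<phi>\<in>flags p d G. x \<in> flag_simplex p \<phi>"
proof (induction d arbitrary: G x)
  case 0
  then have "\<exists>a. G = {a}" by (simp add: aff_dim_eq_0)
  moreover have "p G \<in> G" using 0 p by blast
  ultimately show ?case using 0 by (auto simp: flag_simplex_def)
next
  case (Suc d)
  have pG: "p G \<in> G" using Suc.prems p by blast
  \<comment> \<open>The apex \<open>p G\<close> lies in every simplex, but some flag has to exist: any other point of \<open>G\<close> gives one.\<close>
  obtain y where y: "y \<in> G" "y \<noteq> p G" "x \<noteq> p G \<Longrightarrow> y = x"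
  proof (cases "x = p G")
    case True
    have "G \<noteq> {p G}" using Suc.prems by (metis aff_dim_sing of_nat_0 nat.distinct(1) of_nat_eq_iff)
    then obtain y where "y \<in> G" "y \<noteq> p G" using pG by blast
    then show ?thesis using that[of y] True by blast
  next
    case False
    then show ?thesis using that[of x] Suc.prems by blast
  qed
  obtain F b t where F: "F facet_of G" "p G \<notin> F" "b \<in> F" "0 < t" "t \<le> 1" "y = (1 - t) *\<^sub>R p G + t *\<^sub>R b"
    using exit_facet[OF Suc.prems(1) pG y(1,2)] by metis
  obtain \<psi> where \<psi>: "\<psi> \<in> flags p d F" "b \<in> flag_simplex p \<psi>"
    using Suc.IH[OF facet_of_polytope[OF Suc.prems(1,2) F(1)] F(3)] by auto
  have sub: "p G \<in> flag_simplex p (G # \<psi>)" "b \<in> flag_simplex p (G # \<psi>)"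
    using \<psi> by (auto simp: flag_simplex_Cons intro: hull_inc)
  have "x \<in> flag_simplex p (G # \<psi>)"
  proof (cases "x = p G")
    case False
    then have "x = (1 - t) *\<^sub>R p G + t *\<^sub>R b" using y F by simp
    then show ?thesis using sub F convex_flag_simplex[of p "G # \<psi>"] by (auto simp: convex_alt)
  qed (use sub in simp)
  moreover have "G # \<psi> \<in> flags p (Suc d) G" using F \<psi> by auto
  ultimately show ?case by blast
qed

text \<open>
The intersection is a proper face of \<open>F\<close>, as \<open>F \<subseteq> F'\<close> would make \<open>F\<close> a face of \<open>F'\<close> of the same
dimension.
\<close>

lemma aff_dim_Int_facets:
  assumes "polytope G" "F facet_of G" "F' facet_of G" "F \<noteq> F'"
  shows "aff_dim (F \<inter> F') < aff_dim G - 1"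
proof -
  have F: "F face_of G" "F' face_of G" "aff_dim F = aff_dim G - 1" "aff_dim F' = aff_dim G - 1" "convex F" "convex F'"
    using assms by (auto simp: facet_of_def face_of_imp_convex)
  have ne: "F \<inter> F' \<noteq> F"
  proof
    assume "F \<inter> F' = F"
    then have "F face_of F'" using F face_of_face by blast
    then show False using face_of_aff_dim_lt[OF F(6) _ assms(4)] F by auto
  qed
  have "F \<inter> F' face_of F" using F face_of_Int face_of_face by (metis inf_le1)
  then show ?thesis using face_of_aff_dim_lt[OF F(5) _ ne] F by auto
qed

text \<open>
By \<open>cone_over_facets_Int\<close> the intersection of two simplices lies in the cone from \<open>p G\<close> over the
intersection of their bases.  If the bases lie in the same facet, the induction hypothesis bounds the
dimension of that intersection, otherwise it lies in the intersection of two distinct facets.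
\<close>

lemma flag_simplices_overlap:
  assumes p: "\<And>G. polytope G \<Longrightarrow> G \<noteq> {} \<Longrightarrow> p G \<in> G"
  shows "polytope G \<Longrightarrow> aff_dim G = int d \<Longrightarrow> \<phi> \<in> flags p d G \<Longrightarrow> \<phi>' \<in> flags p d G \<Longrightarrow> \<phi> \<noteq> \<phi>' \<Longrightarrow>
    aff_dim (flag_simplex p \<phi> \<inter> flag_simplex p \<phi>') < int d"
proof (induction d arbitrary: G \<phi> \<phi>')
  case 0 then show ?case by auto
next
  case (Suc d)
  obtain F \<psi> where F: "F facet_of G" "p G \<notin> F" "\<phi> = G # \<psi>" "\<psi> \<in> flags p d F" using Suc.prems by auto
  obtain F' \<psi>' where F': "F' facet_of G" "p G \<notin> F'" "\<phi>' = G # \<psi>'" "\<psi>' \<in> flags p d F'" using Suc.prems by auto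
  let ?A = "flag_simplex p \<psi>" let ?B = "flag_simplex p \<psi>'"
  have pG: "p G \<in> G" using p Suc.prems by force
  have sub: "?A \<subseteq> F" "?B \<subseteq> F'"
    using flag_simplex_subset[OF p facet_of_polytope[OF Suc.prems(1,2) F(1)] F(4)]
      flag_simplex_subset[OF p facet_of_polytope[OF Suc.prems(1,2) F'(1)] F'(4)] by auto
  have "flag_simplex p \<phi> \<inter> flag_simplex p \<phi>' \<subseteq> convex hull (insert (p G) (?A \<inter> ?B))"
    unfolding F F' flag_simplex_Cons
    by (rule cone_over_facets_Int)
      (use F F' sub pG in \<open>auto simp: convex_flag_simplex flag_simplex_nonempty facet_of_imp_face_of\<close>)
  then have "aff_dim (flag_simplex p \<phi> \<inter> flag_simplex p \<phi>') \<le> aff_dim (insert (p G) (?A \<inter> ?B))"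
    by (metis aff_dim_convex_hull aff_dim_subset)
  also have "\<dots> \<le> aff_dim (?A \<inter> ?B) + 1" by (simp add: aff_dim_insert)
  also have "aff_dim (?A \<inter> ?B) < int d"
  proof (cases "F = F'")
    case True
    have "\<psi> \<noteq> \<psi>'" using F(3) F'(3) Suc.prems(5) by simp
    with Suc.IH[OF facet_of_polytope[OF Suc.prems(1,2) F(1)] F(4)] F'(4) True show ?thesis by simp
  next
    case False
    have "aff_dim (?A \<inter> ?B) \<le> aff_dim (F \<inter> F')" using sub by (intro aff_dim_subset) auto
    also have "\<dots> < int d" using aff_dim_Int_facets[OF Suc.prems(1) F(1) F'(1) False] Suc.prems by simp
    finally show ?thesis .
  qed
  finally show ?case by simp
qed

section \<open>A simplex compared with a chamber of the cube\<close>

definition signed_perm :: "('n \<Rightarrow> 'n) \<Rightarrow> 'n set \<Rightarrow> real ^ 'n \<Rightarrow> real ^ 'n" where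
  "signed_perm \<sigma> s v = (\<chi> i. (if i \<in> s then -1 else 1) * v $ \<sigma> i)"

lemma orthogonal_signed_perm:
  fixes \<sigma> :: "'n::finite \<Rightarrow> 'n"
  assumes "\<sigma> permutes UNIV"
  shows "orthogonal_transformation (signed_perm \<sigma> s)"
  unfolding orthogonal_transformation
proof (intro conjI allI)
  show "linear (signed_perm \<sigma> s)"
    by (rule linearI) (simp_all add: signed_perm_def vec_eq_iff algebra_simps)
  fix v :: "real ^ 'n"
  have "(\<Sum>i\<in>UNIV. (signed_perm \<sigma> s v $ i)\<^sup>2) = (\<Sum>i\<in>UNIV. (v $ \<sigma> i)\<^sup>2)"
    by (intro sum.cong) (auto simp: signed_perm_def)
  also have "\<dots> = (\<Sum>i\<in>UNIV. (v $ i)\<^sup>2)"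
    using sum.permute[OF assms, of "\<lambda>i. (v $ i)\<^sup>2"] by (simp add: o_def)
  finally show "norm (signed_perm \<sigma> s v) = norm v" by (simp add: norm_vec_def L2_set_def)
qed

lemma card_signed_perms: "card ({\<sigma>. \<sigma> permutes (UNIV :: 'n::finite set)} \<times> (UNIV :: 'n set set)) = fact CARD('n) * 2 ^ CARD('n)"
proof -
  have "card (UNIV :: 'n set set) = 2 ^ CARD('n)"
    using card_Pow[of "UNIV :: 'n set"] by simp
  then show ?thesis by (simp add: card_cartesian_product card_permutations)
qed

text \<open>
The hyperplanes \<open>x\<^sub>i = 0\<close> and \<open>x\<^sub>i = \<plusminus> x\<^sub>j\<close> cut a ball into \<open>2\<^sup>n n!\<close> congruent pieces; this is one of
them.  The injection \<open>e\<close> fixes the order of the coordinates, as the index type carries no order.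
\<close>

definition chamber :: "('n \<Rightarrow> nat) \<Rightarrow> real \<Rightarrow> (real ^ 'n) set" where
  "chamber e r = {v. (\<forall>i. 0 \<le> v $ i) \<and> (\<forall>i j. e i \<le> e j \<longrightarrow> v $ j \<le> v $ i) \<and> norm v \<le> r}"

text \<open>
The value \<open>e (\<sigma> j)\<close> can be read off from the order: it is one more than the number of \<open>i\<close> with
\<open>e (\<sigma> i) < e (\<sigma> j)\<close>.
\<close>

lemma order_rank_unique:
  fixes e :: "'n::finite \<Rightarrow> nat" and \<sigma> \<tau> :: "'n \<Rightarrow> 'n"
  assumes e: "bij_betw e UNIV {1..CARD('n)}" and \<sigma>: "bij \<sigma>" and \<tau>: "bij \<tau>"
    and le: "\<And>i j. e (\<sigma> i) < e (\<sigma> j) \<longleftrightarrow> e (\<tau> i) < e (\<tau> j)"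
  shows "\<sigma> = \<tau>"
proof
  fix j
  have rank: "card {i. e (\<rho> i) < e (\<rho> j)} = e (\<rho> j) - 1" if "bij \<rho>" for \<rho> :: "'n \<Rightarrow> 'n"
  proof -
    have b: "bij_betw (e \<circ> \<rho>) UNIV {1..CARD('n)}" using that e by (rule bij_betw_trans)
    have "(e \<circ> \<rho>) ` {i. e (\<rho> i) < e (\<rho> j)} = {1..<e (\<rho> j)}"
    proof
      show "(e \<circ> \<rho>) ` {i. e (\<rho> i) < e (\<rho> j)} \<subseteq> {1..<e (\<rho> j)}"
        using bij_betwE[OF b] by fastforce
      show "{1..<e (\<rho> j)} \<subseteq> (e \<circ> \<rho>) ` {i. e (\<rho> i) < e (\<rho> j)}"
      proof
        fix m assume m: "m \<in> {1..<e (\<rho> j)}"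
        have "e (\<rho> j) \<le> CARD('n)" using bij_betwE[OF b, rule_format, of j] by simp
        then have "m \<in> {1..CARD('n)}" using m by simp
        then obtain i where "m = (e \<circ> \<rho>) i" using bij_betw_imp_surj_on[OF b] by blast
        then show "m \<in> (e \<circ> \<rho>) ` {i. e (\<rho> i) < e (\<rho> j)}" using m by auto
      qed
    qed
    moreover have "inj_on (e \<circ> \<rho>) {i. e (\<rho> i) < e (\<rho> j)}"
      using bij_betw_imp_inj_on[OF b] by (rule inj_on_subset) simp
    ultimately show ?thesis by (metis card_image card_atLeastLessThan)
  qed
  have "e (\<sigma> j) - 1 = e (\<tau> j) - 1" using rank[OF \<sigma>] rank[OF \<tau>] le by simp
  moreover have "1 \<le> e i" for i using bij_betwE[OF e, rule_format, of i] by simp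
  ultimately have "e (\<sigma> j) = e (\<tau> j)" by (metis le_add_diff_inverse)
  then show "\<sigma> j = \<tau> j" using bij_betw_imp_inj_on[OF e] by (simp add: inj_eq)
qed

lemma compact_chamber: "compact (chamber e r :: (real ^ 'n) set)"
proof -
  have "closed (chamber e r :: (real ^ 'n) set)"
    unfolding chamber_def
    by (intro closed_Collect_conj closed_Collect_all closed_Collect_imp open_Collect_const closed_Collect_le continuous_intros)
  moreover have "bounded (chamber e r :: (real ^ 'n) set)"
    by (rule bounded_subset[OF bounded_cball[of 0 r]]) (auto simp: chamber_def)
  ultimately show ?thesis by (simp add: compact_eq_bounded_closed)
qed

text \<open>
The images of the chamber under the \<open>2\<^sup>n n!\<close> signed permutations lie in the ball.  With strict
inequalities, which remove only finitely many hyperplanes, the images are disjoint: the signs of the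
coordinates recover \<open>s\<close> and the order of their absolute values recovers \<open>\<sigma>\<close>.
\<close>

lemma chamber_measure:
  fixes e :: "'n::finite \<Rightarrow> nat"
  assumes e: "bij_betw e UNIV {1..CARD('n)}"
  shows "fact CARD('n) * 2 ^ CARD('n) * lmeas (chamber e r) \<le> lmeas (cball (0 :: real ^ 'n) r)"
proof -
  define O' where "O' = {v :: real ^ 'n. \<forall>i. 0 < v $ i} \<inter> (\<Inter>p. {v. e (fst p) < e (snd p) \<longrightarrow> v $ snd p < v $ fst p})"
  define V where "V = O' \<inter> cball 0 r"
  have "open O'" unfolding O'_def
  proof (intro open_Int open_INT ballI)
    have "{v :: real ^ 'n. \<forall>i. 0 < v $ i} = (\<Inter>i. {v. 0 < v $ i})" by auto
    also have "open \<dots>" by (intro open_INT ballI open_Collect_less continuous_intros) simp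
    finally show "open {v :: real ^ 'n. \<forall>i. 0 < v $ i}" .
    fix p :: "'n \<times> 'n"
    show "open {v :: real ^ 'n. e (fst p) < e (snd p) \<longrightarrow> v $ snd p < v $ fst p}"
    proof (cases "e (fst p) < e (snd p)")
      case True then show ?thesis by (simp add: open_Collect_less continuous_intros)
    qed simp
  qed simp
  then have Vb: "V \<in> sets borel" by (auto simp: V_def)
  have Vm: "V \<in> lmeasurable" using Vb by (intro bounded_set_imp_lmeasurable) (auto simp: V_def)
  have inj_e: "inj e" using e by (simp add: bij_betw_def)
  define Z where "Z = (\<Union>i. {v :: real ^ 'n. v $ i = 0}) \<union> (\<Union>p\<in>{p. fst p \<noteq> snd p}. {v. (axis (fst p) 1 - axis (snd p) 1) \<bullet> v = 0})"
  have "negligible Z" unfolding Z_def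
  proof (intro negligible_Un negligible_Union)
    show "negligible t" if "t \<in> range (\<lambda>i. {v :: real ^ 'n. v $ i = 0})" for t
      using that negligible_standard_hyperplane_cart by auto
    show "negligible t" if t: "t \<in> (\<lambda>p. {v :: real ^ 'n. (axis (fst p) 1 - axis (snd p) 1) \<bullet> v = 0}) ` {p. fst p \<noteq> snd p}" for t
    proof -
      obtain p where p: "fst p \<noteq> snd p" "t = {v :: real ^ 'n. (axis (fst p) 1 - axis (snd p) 1) \<bullet> v = 0}" using t by blast
      then have "axis (fst p) 1 - axis (snd p) (1::real) \<noteq> 0" by (simp add: axis_eq_axis)
      then show ?thesis unfolding p(2) by (intro negligible_hyperplane) simp
    qed
  qed simp_all
  moreover have VZ: "chamber e r \<subseteq> V \<union> Z"
  proof
    fix v assume v: "v \<in> chamber e r"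
    show "v \<in> V \<union> Z"
    proof (cases "v \<in> Z")
      case False
      have "v $ i \<noteq> 0" for i using False by (auto simp: Z_def)
      moreover have "v $ i \<noteq> v $ j" if "i \<noteq> j" for i j
      proof
        assume "v $ i = v $ j"
        then have "(axis (fst (i, j)) 1 - axis (snd (i, j)) 1) \<bullet> v = 0"
          by (simp add: inner_diff_left inner_axis')
        then have z: "v \<in> {v. (axis (fst (i, j)) 1 - axis (snd (i, j)) 1) \<bullet> v = 0}" by (rule CollectI)
        have "(i, j) \<in> {p. fst p \<noteq> snd p}" using that by simp
        from UN_I[OF this, of v "\<lambda>p. {v. (axis (fst p) 1 - axis (snd p) 1) \<bullet> v = 0}", OF z]
        have "v \<in> Z" unfolding Z_def by (rule UnI2)
        then show False using False by simp
      qed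
      ultimately have "0 < v $ i" "e i < e j \<Longrightarrow> v $ j < v $ i" for i j
      proof -
        assume nz: "\<And>i. v $ i \<noteq> 0" and nd: "\<And>i j. i \<noteq> j \<Longrightarrow> v $ i \<noteq> v $ j"
        have ch: "0 \<le> v $ i" "e i \<le> e j \<Longrightarrow> v $ j \<le> v $ i" for i j using v by (auto simp: chamber_def)
        show "0 < v $ i" using nz[of i] ch(1)[of i] by simp
        assume "e i < e j"
        then have "i \<noteq> j" by auto
        then show "v $ j < v $ i" using nd[of i j] ch(2)[of i j] \<open>e i < e j\<close> by simp
      qed
      then have "v \<in> V" using v by (simp add: V_def O'_def chamber_def)
      then show ?thesis by simp
    qed simp
  qed
  ultimately have "lmeas (chamber e r) \<le> lmeas V"
  proof -
    assume Z: "negligible Z"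
    have "V \<union> Z \<in> lmeasurable" by (intro fmeasurable.Un Vm negligible_imp_measurable Z)
    then have "lmeas (chamber e r) \<le> lmeas (V \<union> Z)"
      by (intro measure_mono_fmeasurable[OF VZ]) (simp_all add: lmeasurable_compact compact_chamber fmeasurableD)
    also have "\<dots> \<le> lmeas V + lmeas Z"
      by (intro measure_Un_le fmeasurableD[OF Vm] negligible_imp_sets Z)
    also have "\<dots> = lmeas V" using Z by (simp add: negligible_imp_measure0)
    finally show ?thesis .
  qed
  let ?I = "{\<sigma>. \<sigma> permutes (UNIV :: 'n set)} \<times> (UNIV :: 'n set set)"
  let ?g = "\<lambda>p. signed_perm (fst p) (snd p) ` V"
  have fI: "finite ?I" by (simp add: finite_permutations)
  have orth: "orthogonal_transformation (signed_perm (fst p) (snd p))" if "p \<in> ?I" for p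
    using that by (auto intro: orthogonal_signed_perm)
  have gm: "?g p \<in> sets borel" "vol (?g p) = vol V" if "p \<in> ?I" for p
    using emeasure_orthogonal_image[OF orth[OF that] Vb] by auto
  have disj: "disjoint_family_on ?g ?I"
    unfolding disjoint_family_on_def
  proof (intro ballI impI)
    fix p q assume pq: "p \<in> ?I" "q \<in> ?I" "p \<noteq> q"
    show "?g p \<inter> ?g q = {}"
    proof (rule ccontr)
      assume "?g p \<inter> ?g q \<noteq> {}"
      then obtain v w where vw: "v \<in> V" "w \<in> V" "signed_perm (fst p) (snd p) v = signed_perm (fst q) (snd q) w" by blast
      have pos: "0 < v $ i" "0 < w $ i" for i using vw by (auto simp: V_def O'_def)
      have comp: "(if i \<in> snd p then -1 else 1) * v $ fst p i = (if i \<in> snd q then -1 else 1) * w $ fst q i" for i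
        using vw(3) by (simp add: signed_perm_def vec_eq_iff)
      have same: "i \<in> snd p \<longleftrightarrow> i \<in> snd q" "v $ fst p i = w $ fst q i" for i
        using comp[of i] pos(1)[of "fst p i"] pos(2)[of "fst q i"] by (auto split: if_splits)
      have lt: "e k < e l \<longleftrightarrow> u $ l < u $ k" if u: "u \<in> V" for u k l
      proof -
        have st: "e k < e l \<Longrightarrow> u $ l < u $ k" for k l using u by (auto simp: V_def O'_def)
        show ?thesis
        proof
          assume "u $ l < u $ k"
          then have "e k \<noteq> e l" using inj_e by (metis injD less_irrefl)
          then show "e k < e l" using st[of l k] \<open>u $ l < u $ k\<close> by fastforce
        qed (rule st)
      qed
      have "fst p = fst q"
      proof (rule order_rank_unique[OF e])
        show "bij (fst p)" "bij (fst q)" using pq by (auto simp: permutes_bij)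
        show "e (fst p i) < e (fst p j) \<longleftrightarrow> e (fst q i) < e (fst q j)" for i j
          using lt[OF vw(1)] lt[OF vw(2)] same(2) by simp
      qed
      moreover have "snd p = snd q" using same(1) by blast
      ultimately show False using pq(3) by (simp add: prod_eq_iff)
    qed
  qed
  have "of_nat (card ?I) * vol V = (\<Sum>p\<in>?I. vol (?g p))" using gm by simp
  also have "\<dots> = vol (\<Union>p\<in>?I. ?g p)"
    using gm disj fI by (intro sum_emeasure) auto
  also have "\<dots> \<le> vol (cball (0 :: real ^ 'n) r)"
  proof (intro emeasure_mono UN_least subsetI)
    fix p y assume p: "p \<in> ?I" "y \<in> ?g p"
    then obtain v where v: "v \<in> V" "y = signed_perm (fst p) (snd p) v" by blast
    then show "y \<in> cball 0 r" using orthogonal_transformation_norm[OF orth[OF p(1)]] by (simp add: V_def)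
  qed simp
  finally have "of_nat (card ?I) * vol V \<le> vol (cball (0 :: real ^ 'n) r)" .
  moreover have "vol V = ennreal (lmeas V)"
  proof -
    have "bounded V" by (auto simp: V_def)
    then have "vol V \<noteq> \<infinity>" using emeasure_bounded_finite by (metis order_less_irrefl)
    then have "vol V = ennreal (measure lborel V)" by (simp add: emeasure_eq_ennreal_measure)
    also have "measure lborel V = lmeas V" using Vb by (simp add: measure_completion)
    finally show ?thesis .
  qed
  moreover have "vol (cball (0 :: real ^ 'n) r) = ennreal (lmeas (cball (0 :: real ^ 'n) r))"
    using emeasure_eq_ennreal_measure[of lborel "cball (0 :: real ^ 'n) r"] emeasure_bounded_finite[of "cball (0 :: real ^ 'n) r"] by (simp add: top.not_eq_extremum)
  ultimately have "ennreal (real (card ?I) * lmeas V) \<le> ennreal (lmeas (cball (0 :: real ^ 'n) r))"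
    by (simp add: ennreal_mult ennreal_of_nat_eq_real_of_nat)
  then have "real (card ?I) * lmeas V \<le> lmeas (cball (0 :: real ^ 'n) r)"
    by (simp add: ennreal_le_iff)
  then have "fact CARD('n) * 2 ^ CARD('n) * lmeas V \<le> lmeas (cball (0 :: real ^ 'n) r)"
    unfolding card_signed_perms by simp
  moreover have "fact CARD('n) * 2 ^ CARD('n) * lmeas (chamber e r) \<le> fact CARD('n) * 2 ^ CARD('n) * lmeas V"
    using \<open>lmeas (chamber e r) \<le> lmeas V\<close> by (intro mult_left_mono) auto
  ultimately show ?thesis by linarith
qed

text \<open>
When the indices are numbered by \<open>e\<close>, this sends the \<open>k\<close>th axis vector to the vertex
\<open>q\<^sub>k = e\<^sub>1 + \<dots> + e\<^sub>k\<close> of the chamber.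
\<close>

definition tail_sums :: "('n \<Rightarrow> nat) \<Rightarrow> real ^ 'n \<Rightarrow> real ^ 'n" where
  "tail_sums e u = (\<chi> k. \<Sum>i\<in>{i. e k \<le> e i}. u $ i)"

lemma linear_tail_sums: "linear (tail_sums e :: real ^ 'n \<Rightarrow> _)"
  by (rule linearI) (simp_all add: tail_sums_def vec_eq_iff sum.distrib sum_distrib_left)

text \<open>
The preimage of a decreasing vector consists of its successive differences, with \<open>0\<close> appended after
the last coordinate.
\<close>

lemma tail_sums_surj:
  fixes e :: "'n::finite \<Rightarrow> nat"
  assumes e: "bij_betw e UNIV {1..CARD('n)}"
    and v: "\<And>i. 0 \<le> v $ i" "\<And>i. v $ i \<le> 1" "\<And>i j. e i \<le> e j \<Longrightarrow> v $ j \<le> v $ i"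
  shows "v \<in> tail_sums e ` (convex hull (insert 0 Basis))"
proof -
  \<comment> \<open>The coordinates of \<open>v\<close> as a sequence, continued by \<open>0\<close>.\<close>
  define w where "w m = (if m \<le> CARD('n) then v $ (inv_into UNIV e m) else 0)" for m
  define u where "u = (\<chi> i. w (e i) - w (Suc (e i)))"
  have eb: "e i \<in> {1..CARD('n)}" for i using bij_betwE[OF e] by blast
  have inv1: "inv_into UNIV e (e i) = i" for i using e by (simp add: bij_betw_def inv_f_f)
  have inv2: "e (inv_into UNIV e m) = m" if "m \<in> {1..CARD('n)}" for m
    using bij_betw_inv_into_right[OF e that] .
  have we: "w (e i) = v $ i" for i using eb[of i] by (simp add: w_def inv1)
  have wmono: "w (Suc m) \<le> w m" if "m \<in> {1..CARD('n)}" for m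
  proof (cases "Suc m \<le> CARD('n)")
    case True
    then show ?thesis using that inv2[of m] inv2[of "Suc m"] v(3)[of "inv_into UNIV e m" "inv_into UNIV e (Suc m)"] by (simp add: w_def)
  next
    case False
    then show ?thesis using that v(1) by (simp add: w_def)
  qed
  have u0: "0 \<le> u $ i" for i using wmono[OF eb[of i]] by (simp add: u_def)
  have tele: "(\<Sum>i\<in>{i. m \<le> e i}. u $ i) = w m" if m: "m \<in> {1..CARD('n)}" for m
  proof -
    have "bij_betw e {i. m \<le> e i} {m..CARD('n)}"
      unfolding bij_betw_def
    proof
      show "inj_on e {i. m \<le> e i}" using e by (auto simp: bij_betw_def inj_on_def)
      show "e ` {i. m \<le> e i} = {m..CARD('n)}"
      proof
        show "{m..CARD('n)} \<subseteq> e ` {i. m \<le> e i}"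
        proof
          fix l assume "l \<in> {m..CARD('n)}"
          then show "l \<in> e ` {i. m \<le> e i}" using inv2[of l] m by (intro image_eqI[of _ _ "inv_into UNIV e l"]) auto
        qed
      qed (use eb in auto)
    qed
    from sum.reindex_bij_betw[OF this, of "\<lambda>m. w m - w (Suc m)"]
    have "(\<Sum>i\<in>{i. m \<le> e i}. u $ i) = (\<Sum>l\<in>{m..CARD('n)}. w l - w (Suc l))" by (simp add: u_def)
    also have "\<dots> = - (\<Sum>l\<in>{m..CARD('n)}. w (Suc l) - w l)" by (simp add: sum_negf[symmetric])
    also have "(\<Sum>l\<in>{m..CARD('n)}. w (Suc l) - w l) = w (Suc CARD('n)) - w m"
      using m by (intro sum_Suc_diff) auto
    finally show ?thesis by (simp add: w_def)
  qed
  have "tail_sums e u = v"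
    using tele[OF eb] we by (simp add: tail_sums_def vec_eq_iff)
  moreover have "u \<in> convex hull (insert 0 Basis)"
  proof -
    have "sum (\<lambda>i. u $ i) UNIV = w 1"
    proof -
      have "{i. 1 \<le> e i} = UNIV" using eb by auto
      moreover have "(1::nat) \<in> {1..CARD('n)}" by (simp add: Suc_leI)
      ultimately show ?thesis using tele[of 1] by simp
    qed
    also have "\<dots> \<le> 1" using v(2) by (simp add: w_def)
    finally have "sum (\<lambda>i. u $ i) UNIV \<le> 1" .
    moreover have "sum ((\<bullet>) u) Basis = sum (\<lambda>i. u $ i) UNIV"
      by (simp add: Basis_vec_def cart_eq_inner_axis axis_eq_axis sum.UNION_disjoint)
    ultimately show ?thesis unfolding std_simplex using u0
      by (auto simp: Basis_vec_def inner_axis)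
  qed
  ultimately show ?thesis by blast
qed

lemma sorting_permutation:
  fixes e :: "'n::finite \<Rightarrow> nat" and u :: "real ^ 'n"
  assumes e: "bij_betw e UNIV {1..CARD('n)}"
  obtains \<tau> :: "'n \<Rightarrow> 'n" where "bij \<tau>" "\<And>k l. e k \<le> e l \<Longrightarrow> u $ \<tau> l \<le> u $ \<tau> k"
proof -
  obtain ys where ys: "set ys = (UNIV :: 'n set)" "distinct ys" using finite_distinct_list[of "UNIV :: 'n set"] by auto
  define ws where "ws = sort_key (\<lambda>i. - u $ i) ys"
  have ws: "set ws = UNIV" "distinct ws" "sorted (map (\<lambda>i. - u $ i) ws)" using ys by (simp_all add: ws_def)
  have len: "length ws = CARD('n)" using ws distinct_card by fastforce
  have b1: "bij_betw (\<lambda>m. m - 1) {1..CARD('n)} {..<CARD('n)}"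
    by (rule bij_betw_byWitness[where f' = Suc]) auto
  have b2: "bij_betw ((!) ws) {..<CARD('n)} UNIV" using bij_betw_nth[OF ws(2), of "{..<CARD('n)}" UNIV] ws len by simp
  have b: "bij ((!) ws \<circ> ((\<lambda>m. m - 1) \<circ> e))" by (rule bij_betw_trans[OF bij_betw_trans[OF e b1] b2])
  show thesis
  proof (rule that[OF b])
    fix k l assume kl: "e k \<le> e l"
    have "e l \<in> {1..CARD('n)}" using bij_betwE[OF e] by blast
    then have "map (\<lambda>i. - u $ i) ws ! (e k - 1) \<le> map (\<lambda>i. - u $ i) ws ! (e l - 1)"
      using kl ws(3) len by (intro sorted_nth_mono) auto
    then show "u $ ((!) ws \<circ> ((\<lambda>m. m - 1) \<circ> e)) l \<le> u $ ((!) ws \<circ> ((\<lambda>m. m - 1) \<circ> e)) k"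
    proof -
      have "e k - 1 < length ws" "e l - 1 < length ws" using kl \<open>e l \<in> {1..CARD('n)}\<close> len by auto
      with \<open>map (\<lambda>i. - u $ i) ws ! (e k - 1) \<le> map (\<lambda>i. - u $ i) ws ! (e l - 1)\<close> show ?thesis by simp
    qed
  qed
qed

lemma compact_std_simplex: "compact (convex hull (insert 0 Basis) :: 'a::euclidean_space set)"
  by (simp add: finite_imp_compact_convex_hull)

lemma measure_std_simplex: "lmeas (convex hull (insert 0 Basis) :: 'a::euclidean_space set) = 1 / fact DIM('a)"
  using content_std_simplex[where 'a='a] compact_std_simplex[where 'a='a] by (simp only: borel_compact measure_completion sets_lborel)

text \<open>
The map scales volumes by a constant \<open>c\<close>.  Its image of the standard simplex contains the decreasing
vectors of the unit cube, so \<open>n!\<close> congruent copies of that image, each of volume \<open>c / n!\<close>, cover the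
cube by sorting coordinates.  Hence \<open>c \<ge> 1\<close>.
\<close>

lemma tail_sums_expands:
  fixes e :: "'n::finite \<Rightarrow> nat"
  assumes e: "bij_betw e UNIV {1..CARD('n)}" and A: "compact A"
  shows "lmeas A \<le> lmeas (tail_sums e ` A :: (real ^ 'n) set)"
proof -
  from measure_linear_image_compact[OF linear_tail_sums[of e]] obtain c where
    "c \<ge> 0 \<and> (\<forall>A. compact A \<longrightarrow> lmeas (tail_sums e ` A) = c * lmeas (A :: (real ^ 'n) set))" ..
  then have c: "0 \<le> c" "\<And>A. compact A \<Longrightarrow> lmeas (tail_sums e ` A) = c * lmeas (A :: (real ^ 'n) set)"
    by auto
  let ?S = "convex hull (insert 0 Basis) :: (real ^ 'n) set"
  let ?\<Delta> = "tail_sums e ` ?S"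
  let ?Q = "cbox 0 1 :: (real ^ 'n) set"
  have c\<Delta>: "compact ?\<Delta>"
    by (rule compact_continuous_image[OF _ compact_std_simplex])
      (intro linear_continuous_on linear_conv_bounded_linear[THEN iffD1] linear_tail_sums)
  have m\<Delta>: "lmeas ?\<Delta> = c / fact CARD('n)"
    by (simp add: c compact_std_simplex measure_std_simplex)
  have orth: "orthogonal_transformation (signed_perm \<sigma> {} :: real ^ 'n \<Rightarrow> _)" if "\<sigma> permutes UNIV" for \<sigma>
    using that by (rule orthogonal_signed_perm)
  have cov: "?Q \<subseteq> (\<Union>\<sigma>\<in>{\<sigma>. \<sigma> permutes UNIV}. signed_perm \<sigma> {} ` ?\<Delta>)"
  proof
    fix u :: "real ^ 'n" assume u: "u \<in> ?Q"
    obtain \<tau> where \<tau>: "bij \<tau>" "\<And>k l. e k \<le> e l \<Longrightarrow> u $ \<tau> l \<le> u $ \<tau> k"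
      using sorting_permutation[OF e, of u] by metis
    define v where "v = (\<chi> k. u $ \<tau> k)"
    have "v \<in> ?\<Delta>" by (rule tail_sums_surj[OF e]) (use u \<tau> in \<open>auto simp: v_def mem_box_cart\<close>)
    moreover have "signed_perm (inv \<tau>) {} v = u"
      using \<tau>(1) by (simp add: signed_perm_def v_def vec_eq_iff bij_is_surj surj_f_inv_f)
    moreover have "inv \<tau> permutes UNIV" by (intro permutes_inv bij_imp_permutes \<tau>(1)) simp
    ultimately show "u \<in> (\<Union>\<sigma>\<in>{\<sigma>. \<sigma> permutes UNIV}. signed_perm \<sigma> {} ` ?\<Delta>)" by blast
  qed
  have fin: "finite {\<sigma>. \<sigma> permutes (UNIV :: 'n set)}" by (simp add: finite_permutations)
  have img: "compact (signed_perm \<sigma> {} ` ?\<Delta>)" "lmeas (signed_perm \<sigma> {} ` ?\<Delta>) = lmeas ?\<Delta>" if "\<sigma> permutes UNIV" for \<sigma>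
  proof -
    have "linear (signed_perm \<sigma> {} :: real ^ 'n \<Rightarrow> _)" using orth[OF that] by (rule orthogonal_transformation_linear)
    then show cpt: "compact (signed_perm \<sigma> {} ` ?\<Delta>)" using c\<Delta>
      by (intro compact_continuous_image[OF _ c\<Delta>] linear_continuous_on) (rule linear_conv_bounded_linear[THEN iffD1])
    have "vol (signed_perm \<sigma> {} ` ?\<Delta>) = vol ?\<Delta>"
      by (rule emeasure_orthogonal_image[OF orth[OF that]]) (rule borel_compact[OF c\<Delta>])
    then have "measure lborel (signed_perm \<sigma> {} ` ?\<Delta>) = measure lborel ?\<Delta>" by (simp add: measure_def)
    then show "lmeas (signed_perm \<sigma> {} ` ?\<Delta>) = lmeas ?\<Delta>"
      using cpt c\<Delta> by (simp add: borel_compact)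
  qed
  have ne: "?Q \<noteq> {}"
  proof -
    have "0 \<in> ?Q" by (simp add: mem_box_cart)
    then show ?thesis by blast
  qed
  have "1 = lmeas ?Q" using content_cbox_cart[OF ne] by simp
  also have "\<dots> \<le> lmeas (\<Union>\<sigma>\<in>{\<sigma>. \<sigma> permutes UNIV}. signed_perm \<sigma> {} ` ?\<Delta>)"
    using cov img by (intro measure_mono_fmeasurable) (auto intro!: lmeasurable_compact compact_UN fin)
  also have "\<dots> \<le> (\<Sum>\<sigma>\<in>{\<sigma>. \<sigma> permutes UNIV}. lmeas (signed_perm \<sigma> {} ` ?\<Delta>))"
    using img by (intro measure_UNION_le fin) (auto intro: lmeasurable_compact fmeasurableD)
  also have "\<dots> = (\<Sum>\<sigma>\<in>{\<sigma>. \<sigma> permutes (UNIV :: 'n set)}. c / fact CARD('n))"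
    using img m\<Delta> by (intro sum.cong) auto
  also have "\<dots> = c" by (simp add: card_permutations)
  finally have "1 \<le> c" .
  then have "1 * lmeas A \<le> c * lmeas A" by (intro mult_right_mono) auto
  then show ?thesis using c(2)[OF A] by simp
qed

text \<open>
The Gram matrix of the vectors \<open>q\<^sub>k\<close> is \<open>min i j\<close>.
\<close>

lemma norm_tail_sums_sq:
  fixes e :: "'n::finite \<Rightarrow> nat"
  assumes e: "bij_betw e UNIV {1..CARD('n)}"
  shows "(norm (tail_sums e v))\<^sup>2 = (\<Sum>i\<in>UNIV. \<Sum>j\<in>UNIV. v $ i * v $ j * real (min (e i) (e j)))"
proof -
  have eb: "e i \<in> {1..CARD('n)}" for i using bij_betwE[OF e] by blast
  have card: "card {k. e k \<le> m} = m" if "m \<le> CARD('n)" for m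
  proof -
    have "e ` {k. e k \<le> m} = {1..m}"
    proof
      show "e ` {k. e k \<le> m} \<subseteq> {1..m}" using eb by auto
      show "{1..m} \<subseteq> e ` {k. e k \<le> m}"
      proof
        fix l assume l: "l \<in> {1..m}"
        then have "l \<in> {1..CARD('n)}" using that by simp
        then obtain k where "l = e k" using bij_betw_imp_surj_on[OF e] by blast
        then show "l \<in> e ` {k. e k \<le> m}" using l by auto
      qed
    qed
    moreover have "inj_on e {k. e k \<le> m}" using e by (auto simp: bij_betw_def inj_on_def)
    ultimately show ?thesis by (metis card_image card_atLeastAtMost diff_Suc_1)
  qed
  have comp: "tail_sums e v $ k = (\<Sum>i\<in>UNIV. if e k \<le> e i then v $ i else 0)" for k
    by (simp add: tail_sums_def sum.If_cases)
  have "(norm (tail_sums e v))\<^sup>2 = (\<Sum>k\<in>UNIV. (tail_sums e v $ k) * (tail_sums e v $ k))"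
    by (simp add: power2_norm_eq_inner inner_vec_def)
  also have "\<dots> = (\<Sum>k\<in>UNIV. \<Sum>i\<in>UNIV. \<Sum>j\<in>UNIV. (if e k \<le> e i then v $ i else 0) * (if e k \<le> e j then v $ j else 0))"
    unfolding comp sum_product ..
  also have "\<dots> = (\<Sum>i\<in>UNIV. \<Sum>k\<in>UNIV. \<Sum>j\<in>UNIV. (if e k \<le> e i then v $ i else 0) * (if e k \<le> e j then v $ j else 0))"
    by (rule sum.swap)
  also have "\<dots> = (\<Sum>i\<in>UNIV. \<Sum>j\<in>UNIV. \<Sum>k\<in>UNIV. (if e k \<le> e i then v $ i else 0) * (if e k \<le> e j then v $ j else 0))"
    by (intro sum.cong refl sum.swap)
  also have "\<dots> = (\<Sum>i\<in>UNIV. \<Sum>j\<in>UNIV. v $ i * v $ j * real (min (e i) (e j)))"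
  proof (intro sum.cong refl)
    fix i j
    have "(\<Sum>k\<in>UNIV. (if e k \<le> e i then v $ i else 0) * (if e k \<le> e j then v $ j else 0)) = (\<Sum>k\<in>UNIV. if e k \<le> min (e i) (e j) then v $ i * v $ j else 0)"
      by (intro sum.cong) auto
    also have "\<dots> = v $ i * v $ j * real (card {k. e k \<le> min (e i) (e j)})"
      by (simp add: sum.If_cases)
    also have "card {k. e k \<le> min (e i) (e j)} = min (e i) (e j)"
      using eb[of i] by (intro card) auto
    finally show "(\<Sum>k\<in>UNIV. (if e k \<le> e i then v $ i else 0) * (if e k \<le> e j then v $ j else 0)) = v $ i * v $ j * real (min (e i) (e j))" .
  qed
  finally show ?thesis .
qed

text \<open>
Let \<open>L\<close> map the standard simplex onto \<open>T\<close>, so that \<open>L\<close> scales volumes by \<open>n! vol T\<close>.  Scaling the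
coordinate of \<open>p\<^sub>1\<close> by \<open>q = |p\<^sub>1|\<close> is the same as replacing \<open>p\<^sub>1\<close> by \<open>p\<^sub>1 / q\<close>, and the Gram matrix
of the new vectors still dominates \<open>min i j\<close> entrywise.  Therefore \<open>u \<mapsto> tail_sums e (D u)\<close> maps the
set \<open>W\<close> of coordinate vectors of \<open>T \<inter> cball 0 r\<close> into a chamber, and it expands volumes by at least
the factor \<open>q\<close>.
\<close>

theorem simplex_ball_comparison:
  fixes p :: "nat \<Rightarrow> real ^ 'n"
  assumes gram: "\<And>i j. 1 \<le> i \<Longrightarrow> i \<le> j \<Longrightarrow> j \<le> CARD('n) \<Longrightarrow> real i \<le> p i \<bullet> p j"
    and first: "\<And>j. 1 \<le> j \<Longrightarrow> j \<le> CARD('n) \<Longrightarrow> p 1 \<bullet> p 1 \<le> p 1 \<bullet> p j"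
    and T: "T = convex hull (insert 0 (p ` {1..CARD('n)}))"
  shows "norm (p 1) * 2 ^ CARD('n) * lmeas (cball 0 r \<inter> T) \<le> lmeas T * lmeas (cball (0 :: real ^ 'n) r)"
proof -
  let ?n = "CARD('n)"
  let ?S = "convex hull (insert 0 Basis) :: (real ^ 'n) set"
  obtain h where "bij_betw h {1..?n} (UNIV :: 'n set)" using ex_bij_betw_nat_finite_1[of "UNIV :: 'n set"] by auto
  then obtain e where e: "bij_betw e (UNIV :: 'n set) {1..?n}" using bij_betw_inv_into by blast
  have eb: "1 \<le> e i" "e i \<le> ?n" for i using bij_betwE[OF e, rule_format, of i] by auto
  define q where "q = norm (p 1)"
  have n1: "1 \<le> ?n" by (simp add: Suc_leI)
  have q1: "1 \<le> q"
  proof -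
    have "1 \<le> p 1 \<bullet> p 1" using gram[of 1 1] n1 by simp
    then show ?thesis unfolding q_def by (simp add: norm_eq_sqrt_inner)
  qed
  have qq: "p 1 \<bullet> p 1 = q * q" by (simp add: q_def dot_square_norm power2_eq_square)
  define L where "L u = (\<Sum>i\<in>UNIV. u $ i *\<^sub>R p (e i))" for u :: "real ^ 'n"
  have linL: "linear L" unfolding L_def
    by (rule linearI) (simp_all add: scaleR_add_left sum.distrib scaleR_sum_right)
  have contL: "continuous_on A L" for A using linL by (simp add: linear_continuous_on linear_conv_bounded_linear)
  have Lax: "L (axis i 1) = p (e i)" for i
  proof -
    have "L (axis i 1) = (\<Sum>j\<in>UNIV. if j = i then p (e j) else 0)" unfolding L_def by (intro sum.cong) (auto simp: axis_def)
    then show ?thesis by simp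
  qed
  have TL: "T = L ` ?S"
  proof -
    have "L ` ?S = convex hull (L ` insert 0 Basis)" by (rule convex_hull_linear_image[OF linL])
    also have "L ` insert 0 Basis = insert 0 (p ` {1..?n})"
    proof -
      have "L ` Basis = range (\<lambda>i. p (e i))" by (auto simp: Basis_vec_def Lax image_iff)
      also have "\<dots> = p ` {1..?n}" using bij_betw_imp_surj_on[OF e] by (metis image_image)
      finally show ?thesis by (simp add: linear_0[OF linL])
    qed
    finally show ?thesis by (simp add: T)
  qed
  from measure_linear_image_compact[OF linL] obtain c where
    "c \<ge> 0 \<and> (\<forall>A. compact A \<longrightarrow> lmeas (L ` A) = c * lmeas (A :: (real ^ 'n) set))" ..
  then have c: "0 \<le> c" "\<And>A. compact A \<Longrightarrow> lmeas (L ` A) = c * lmeas (A :: (real ^ 'n) set)"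
    by auto
  have mT: "fact ?n * lmeas T = c"
    by (simp add: TL c compact_std_simplex measure_std_simplex)
  define W where "W = {u \<in> ?S. norm (L u) \<le> r}"
  have cW: "compact W"
  proof -
    have "closed {u. norm (L u) \<le> r}" by (intro closed_Collect_le continuous_on_norm contL continuous_on_const)
    moreover have "W = ?S \<inter> {u. norm (L u) \<le> r}" by (auto simp: W_def)
    ultimately show ?thesis using compact_Int_closed[OF compact_std_simplex] by simp
  qed
  have BT: "cball 0 r \<inter> T = L ` W" by (auto simp: TL W_def)
  define d where "d k = (if e k = 1 then q else 1)" for k
  define D where "D u = (\<chi> k. d k * u $ k)" for u :: "real ^ 'n"
  have prod_d: "prod d UNIV = q"
  proof -
    obtain k where k: "e k = 1" using bij_betw_imp_surj_on[OF e] n1 by (metis atLeastAtMost_iff imageE order_refl)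
    have "e j = 1 \<longleftrightarrow> j = k" for j using k bij_betw_imp_inj_on[OF e] by (auto simp: inj_on_def)
    then show ?thesis by (simp add: d_def)
  qed
  have mD: "lmeas (D ` W) = q * lmeas W"
    using measure_stretch[OF lmeasurable_compact[OF cW], of d] q1 by (simp add: D_def[abs_def] prod_d)
  define Y where "Y = {v :: real ^ 'n. (\<forall>i. 0 \<le> v $ i) \<and> norm (tail_sums e v) \<le> r}"
  have cY: "compact Y"
  proof -
    have "continuous_on UNIV (tail_sums e :: real ^ 'n \<Rightarrow> _)"
      by (simp add: linear_continuous_on linear_tail_sums linear_conv_bounded_linear[symmetric])
    then have "closed Y" unfolding Y_def
      by (intro closed_Collect_conj closed_Collect_all closed_Collect_le continuous_intros)
    moreover have "Y \<subseteq> cbox 0 (\<chi> i. r)"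
    proof
      fix v assume v: "v \<in> Y"
      have "v $ i \<le> r" for i
      proof -
        have "v $ i \<le> tail_sums e v $ i"
          using v by (simp add: tail_sums_def Y_def member_le_sum)
        also have "\<dots> \<le> norm (tail_sums e v)" using component_le_norm_cart by (rule order_trans[OF abs_ge_self])
        also have "\<dots> \<le> r" using v by (simp add: Y_def)
        finally show ?thesis .
      qed
      then show "v \<in> cbox 0 (\<chi> i. r)" using v by (simp add: mem_box_cart Y_def)
    qed
    ultimately show ?thesis using bounded_cbox bounded_subset compact_eq_bounded_closed by blast
  qed
  \<comment> \<open>Only nonnegative \<open>u\<close> allow an entrywise comparison of the two quadratic forms.\<close>
  have key: "norm (tail_sums e (D u)) \<le> norm (L u)" if u: "\<And>i. 0 \<le> u $ i" for u
  proof -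
    have sym: "d i * d j * real (min (e i) (e j)) \<le> p (e i) \<bullet> p (e j)" if ij: "e i \<le> e j" for i j
    proof (cases "e i = 1")
      case True
      show ?thesis
      proof (cases "e j = 1")
        case True
        with \<open>e i = 1\<close> qq show ?thesis by (simp add: d_def)
      next
        case False
        \<comment> \<open>The inner product of \<open>p\<^sub>1 / q\<close> with \<open>p\<^sub>j\<close> is at least \<open>q \<ge> 1\<close>; this is where \<open>|p\<^sub>1| \<ge> 1\<close> enters.\<close>
        have "q * 1 \<le> q * q" using q1 by (intro mult_left_mono) auto
        also have "\<dots> \<le> p 1 \<bullet> p (e j)" using first[OF eb(1) eb(2), of j] unfolding qq .
        finally show ?thesis using True False ij by (simp add: d_def min_def)
      qed
    next
      case False
      then have "e j \<noteq> 1" using ij eb[of i] by simp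
      with False show ?thesis using gram[OF eb(1) ij eb(2)] ij by (simp add: d_def min_def)
    qed
    have all: "d i * d j * real (min (e i) (e j)) \<le> p (e i) \<bullet> p (e j)" for i j
    proof (cases "e i \<le> e j")
      case True then show ?thesis by (rule sym)
    next
      case False
      then have "d j * d i * real (min (e j) (e i)) \<le> p (e j) \<bullet> p (e i)" by (intro sym) simp
      then show ?thesis by (simp add: inner_commute min.commute mult.commute)
    qed
    have "(norm (tail_sums e (D u)))\<^sup>2 = (\<Sum>i\<in>UNIV. \<Sum>j\<in>UNIV. u $ i * u $ j * (d i * d j * real (min (e i) (e j))))"
      unfolding norm_tail_sums_sq[OF e] by (intro sum.cong refl) (simp add: D_def)
    also have "\<dots> \<le> (\<Sum>i\<in>UNIV. \<Sum>j\<in>UNIV. u $ i * u $ j * (p (e i) \<bullet> p (e j)))"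
      by (intro sum_mono mult_left_mono all) (simp add: u)
    also have "\<dots> = (norm (L u))\<^sup>2"
      unfolding power2_norm_eq_inner L_def inner_sum_left inner_sum_right
      by (intro sum.cong refl) (simp add: inner_commute mult_ac)
    finally show ?thesis by (rule power2_le_imp_le) simp
  qed
  have DW: "D ` W \<subseteq> Y"
  proof clarify
    fix u assume u: "u \<in> W"
    have u0: "0 \<le> u $ i" for i
    proof -
      have "0 \<le> u \<bullet> axis i 1" using u unfolding W_def std_simplex by (auto simp: axis_in_Basis_iff)
      then show ?thesis by (simp add: inner_axis)
    qed
    have "0 \<le> D u $ i" for i using u0 q1 by (simp add: D_def d_def)
    moreover have "norm (tail_sums e (D u)) \<le> r" using key[OF u0] u by (auto simp: W_def)
    ultimately show "D u \<in> Y" by (simp add: Y_def)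
  qed
  have tY: "tail_sums e ` Y \<subseteq> chamber e r"
  proof clarify
    fix v assume v: "v \<in> Y"
    have "tail_sums e v $ j \<le> tail_sums e v $ i" if "e i \<le> e j" for i j
      using v that unfolding tail_sums_def by (simp, intro sum_mono2) (auto simp: Y_def)
    moreover have "0 \<le> tail_sums e v $ i" for i using v by (simp add: tail_sums_def Y_def sum_nonneg)
    ultimately show "tail_sums e v \<in> chamber e r" using v by (simp add: chamber_def Y_def)
  qed
  have cont: "continuous_on Y (tail_sums e :: real ^ 'n \<Rightarrow> _)"
    by (simp add: linear_continuous_on linear_tail_sums linear_conv_bounded_linear[symmetric])
  have "q * lmeas W \<le> lmeas Y"
    unfolding mD[symmetric]
  proof (rule measure_mono_fmeasurable[OF DW])
    show "D ` W \<in> sets lebesgue"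
      using measurable_stretch[OF lmeasurable_compact[OF cW], of d] by (simp add: D_def[abs_def] fmeasurableD)
  qed (rule lmeasurable_compact[OF cY])
  also have "\<dots> \<le> lmeas (tail_sums e ` Y)" by (rule tail_sums_expands[OF e cY])
  also have "\<dots> \<le> lmeas (chamber e r)"
    by (intro measure_mono_fmeasurable tY fmeasurableD lmeasurable_compact compact_chamber compact_continuous_image cont cY)
  finally have qW: "q * lmeas W \<le> lmeas (chamber e r)" .
  have "q * 2 ^ ?n * lmeas (cball 0 r \<inter> T) = fact ?n * lmeas T * 2 ^ ?n * (q * lmeas W)"
    unfolding BT using c(2)[OF cW] mT by simp
  also have "\<dots> \<le> fact ?n * lmeas T * 2 ^ ?n * lmeas (chamber e r)"
    using qW by (intro mult_left_mono) auto
  also have "\<dots> = lmeas T * (fact ?n * 2 ^ ?n * lmeas (chamber e r))" by simp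
  also have "\<dots> \<le> lmeas T * lmeas (cball (0 :: real ^ 'n) r)"
    by (intro mult_left_mono chamber_measure e) simp
  finally show ?thesis by (simp add: q_def)
qed

section \<open>The boundary of a polytope with distant faces\<close>

lemma negligible_aff_dim:
  fixes S :: "'a::euclidean_space set"
  assumes "aff_dim S < int DIM('a)"
  shows "negligible S"
proof (cases "S = {}")
  case False
  then obtain a where a: "a \<in> S" by blast
  let ?T = "(+) (- a) ` S"
  have "0 \<in> ?T" using a by force
  then have "aff_dim ?T = int (dim ?T)" by (intro aff_dim_zero hull_inc)
  moreover have "aff_dim ?T = aff_dim S" by (rule aff_dim_translation_eq)
  ultimately have "dim ?T < DIM('a)" using assms by simp
  then have "negligible ?T" by (rule negligible_lowdim)
  then show ?thesis by (rule negligible_translation_rev)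
qed simp

text \<open>
A facet is exposed by some \<open>a \<bullet> x \<le> b\<close>; here \<open>b > 0\<close> because a small positive multiple of \<open>a\<close> lies
in \<open>P\<close>.
\<close>

lemma facet_supporting_hyperplane:
  fixes P :: "'a::euclidean_space set"
  assumes P: "polytope P" "0 \<in> interior P" and F: "F facet_of P"
  shows "\<exists>\<nu> h. norm \<nu> = 1 \<and> 0 < h \<and> F \<subseteq> {x. \<nu> \<bullet> x = h}"
proof -
  have "F exposed_face_of P"
    using exposed_face_of_polyhedron[of P F] P F by (simp add: polytope_imp_polyhedron facet_of_imp_face_of)
  then obtain a b where ab: "P \<subseteq> {x. a \<bullet> x \<le> b}" "F = P \<inter> {x. a \<bullet> x = b}" by (auto simp: exposed_face_of_def)
  have F': "F \<noteq> {}" "F \<noteq> P" using F facet_of_irrefl by (auto simp: facet_of_def)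
  have a0: "a \<noteq> 0"
  proof
    assume "a = 0"
    then have "F = P \<or> F = {}" using ab by auto
    then show False using F' by blast
  qed
  obtain e where e: "0 < e" "ball 0 e \<subseteq> P" using P(2) by (auto simp: mem_interior)
  define t where "t = e / (2 * norm a)"
  have t: "0 < t" "norm (t *\<^sub>R a) < e" using e a0 by (auto simp: t_def)
  then have "t *\<^sub>R a \<in> P" using e(2) by (auto simp: subset_iff)
  then have "a \<bullet> (t *\<^sub>R a) \<le> b" using ab by blast
  moreover have "0 < a \<bullet> (t *\<^sub>R a)" using t a0 by simp
  ultimately have b: "0 < b" by linarith
  show ?thesis
  proof (intro exI conjI)
    show "norm (a /\<^sub>R norm a) = 1" "0 < b / norm a" using a0 b by auto
    show "F \<subseteq> {x. (a /\<^sub>R norm a) \<bullet> x = b / norm a}" using ab by (auto simp: field_simps)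
  qed
qed

lemma negligible_cone_over_Int_facets:
  fixes P :: "'a::euclidean_space set"
  assumes P: "polytope P" "aff_dim P = int DIM('a)" and F: "F facet_of P" "G facet_of P" "F \<noteq> G"
  shows "negligible (cone_over (F \<inter> G))"
proof -
  have "cone_over (F \<inter> G) \<subseteq> convex hull (insert 0 (F \<inter> G))"
  proof
    fix z assume "z \<in> cone_over (F \<inter> G)"
    then obtain s x where s: "0 \<le> s" "s \<le> 1" "x \<in> F \<inter> G" "z = s *\<^sub>R x" by (auto simp: cone_over_def)
    have "(1 - s) *\<^sub>R 0 + s *\<^sub>R x \<in> convex hull (insert 0 (F \<inter> G))"
      using s by (intro convexD_alt convex_convex_hull hull_inc) auto
    then show "z \<in> convex hull (insert 0 (F \<inter> G))" using s by simp
  qed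
  then have "aff_dim (cone_over (F \<inter> G)) \<le> aff_dim (insert 0 (F \<inter> G))"
    by (metis aff_dim_convex_hull aff_dim_subset)
  also have "\<dots> \<le> aff_dim (F \<inter> G) + 1" by (simp add: aff_dim_insert)
  also have "\<dots> < int DIM('a)" using aff_dim_Int_facets[OF P(1) F] P(2) by simp
  finally show ?thesis by (rule negligible_aff_dim)
qed

text \<open>
The facets themselves touch each other.  The points of a facet at distance at least \<open>1 / (m + 1)\<close>
from all other facets form compact sets that are separated from each other, and as \<open>m\<close> grows they
exhaust the facet up to its intersections with other facets, over which the cones are null sets.
\<close>

lemma hausdorff_frontier_ge_facet_cones:
  fixes P :: "(real ^ 'n) set"
  assumes P: "polytope P" "aff_dim P = int CARD('n)"
    and \<nu>: "\<And>F. F facet_of P \<Longrightarrow> norm (\<nu> F) = 1" and h: "\<And>F. F facet_of P \<Longrightarrow> 0 < h F"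
    and sub: "\<And>F. F facet_of P \<Longrightarrow> F \<subseteq> {x. \<nu> F \<bullet> x = h F}"
  shows "(\<Sum>F | F facet_of P. ennreal (CARD('n) / h F) * vol (cone_over F)) \<le> hausdorff_measure (CARD('n) - 1) (frontier P)"
proof -
  let ?I = "{F. F facet_of P}"
  have fin: "finite ?I" using P(1) by (rule finite_polytope_facets)
  have cF: "compact F" if "F facet_of P" for F
    using that P(1) by (meson face_of_polytope_polytope facet_of_imp_face_of polytope_imp_compact)
  define K where "K m F = {x \<in> F. \<forall>G\<in>?I - {F}. \<forall>y\<in>G. 1 / real (Suc m) \<le> dist x y}" for m F
  have cK: "compact (K m F)" if F: "F facet_of P" for m F
  proof -
    have "K m F = F \<inter> (\<Inter>G\<in>?I - {F}. \<Inter>y\<in>G. {x. 1 / real (Suc m) \<le> dist x y})" by (auto simp: K_def)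
    moreover have "closed (\<Inter>G\<in>?I - {F}. \<Inter>y\<in>G. {x :: real ^ 'n. 1 / real (Suc m) \<le> dist x y})"
      by (intro closed_INT ballI closed_Collect_le continuous_intros)
    ultimately show ?thesis using compact_Int_closed[OF cF[OF F]] by simp
  qed
  have le: "(\<Sum>F\<in>?I. ennreal (CARD('n) / h F) * vol (cone_over (K m F))) \<le> hausdorff_measure (CARD('n) - 1) (frontier P)" for m
  proof (rule hausdorff_measure_ge_cones[OF fin, where \<nu> = \<nu> and \<delta> = "1 / (2 * real (Suc m))"])
    fix F assume F: "F \<in> ?I"
    show "compact (K m F)" using cK F by simp
    show "norm (\<nu> F) = 1" "0 < h F" using \<nu> h F by auto
    show "K m F \<subseteq> {x. \<nu> F \<bullet> x = h F}" using sub[of F] F by (auto simp: K_def)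
    have "F face_of P" "F \<noteq> P" using F facet_of_irrefl facet_of_imp_face_of by auto
    then have "F \<subseteq> rel_frontier P" by (rule face_of_subset_rel_frontier)
    also have "rel_frontier P = frontier P" using P(2) by (intro rel_frontier_frontier) (simp add: aff_dim_eq_full[symmetric])
    finally show "K m F \<subseteq> frontier P" by (auto simp: K_def)
  next
    fix F G x y assume FG: "F \<in> ?I" "G \<in> ?I" "F \<noteq> G" "x \<in> K m F" "y \<in> K m G"
    then have "1 / real (Suc m) \<le> dist x y" by (auto simp: K_def)
    moreover have "1 / (2 * real (Suc m)) < 1 / real (Suc m)" by (intro divide_strict_left_mono) auto
    ultimately show "1 / (2 * real (Suc m)) < dist x y" by linarith
  qed simp
  have lim: "(\<lambda>m. vol (cone_over (K m F))) \<longlonglongrightarrow> vol (\<Union>m. cone_over (K m F))" if F: "F facet_of P" for F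
  proof (rule Lim_emeasure_incseq)
    show "range (\<lambda>m. cone_over (K m F)) \<subseteq> sets lborel" using cK[OF F] compact_cone_over borel_compact by auto
    have "K m F \<subseteq> K (Suc m) F" for m
    proof
      fix x assume x: "x \<in> K m F"
      have "1 / real (Suc (Suc m)) \<le> 1 / real (Suc m)" by (intro divide_left_mono) auto
      then show "x \<in> K (Suc m) F" using x unfolding K_def by (auto intro: order_trans)
    qed
    then show "incseq (\<lambda>m. cone_over (K m F))" unfolding cone_over_def by (intro incseq_SucI image_mono Sigma_mono) auto
  qed
  have lower: "vol (cone_over F) \<le> vol (\<Union>m. cone_over (K m F))" if F: "F facet_of P" for F
  proof -
    let ?N = "\<Union>G\<in>?I - {F}. cone_over (F \<inter> G)"
    have Nn: "negligible ?N"
      using fin P F by (intro negligible_Union) (auto intro!: negligible_cone_over_Int_facets)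
    have Nb: "?N \<in> sets borel"
      using fin F cF by (intro sets.finite_UN borel_compact compact_cone_over compact_Int) auto
    have Ub: "(\<Union>m. cone_over (K m F)) \<in> sets borel" using cK[OF F] compact_cone_over borel_compact by blast
    have "cone_over F \<subseteq> (\<Union>m. cone_over (K m F)) \<union> ?N"
    proof
      fix z assume "z \<in> cone_over F"
      then obtain s x where sx: "s \<in> {0..1}" "x \<in> F" "z = s *\<^sub>R x" by (auto simp: cone_over_def)
      show "z \<in> (\<Union>m. cone_over (K m F)) \<union> ?N"
      proof (cases "\<exists>G\<in>?I - {F}. x \<in> G")
        case True
        then obtain G where "G \<in> ?I - {F}" "x \<in> F \<inter> G" using sx by blast
        moreover then have "z \<in> cone_over (F \<inter> G)" using sx unfolding cone_over_def by (intro image_eqI[of _ _ "(s, x)"]) auto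
        ultimately show ?thesis by blast
      next
        case False
        let ?U = "\<Union>(?I - {F})"
        have "closed ?U" using fin cF compact_imp_closed by (intro closed_Union) auto
        moreover have "x \<notin> ?U" using False by blast
        ultimately obtain d where d: "0 < d" "\<And>y. y \<in> ?U \<Longrightarrow> d \<le> dist x y"
          using separate_point_closed[of ?U x] by auto
        obtain m where m: "1 / real (Suc m) < d" using d(1) by (metis nat_approx_posE)
        have "x \<in> K m F" unfolding K_def using sx(2) d(2) m by (auto intro: order_trans[OF less_imp_le])
        then have "z \<in> cone_over (K m F)" using sx unfolding cone_over_def by (intro image_eqI[of _ _ "(s, x)"]) auto
        then show ?thesis by blast
      qed
    qed
    then have "vol (cone_over F) \<le> vol ((\<Union>m. cone_over (K m F)) \<union> ?N)"
      using Ub Nb by (intro emeasure_mono) auto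
    also have "\<dots> \<le> vol (\<Union>m. cone_over (K m F)) + vol ?N"
      using Ub Nb by (intro emeasure_subadditive) auto
    also have "vol ?N = 0"
    proof -
      have "?N \<in> null_sets lebesgue" using Nn by (simp add: negligible_iff_null_sets)
      then have "?N \<in> null_sets lborel" using Nb by (simp add: null_sets_completion_iff)
      then show ?thesis by (rule null_setsD1)
    qed
    finally show ?thesis by simp
  qed
  have "(\<Sum>F\<in>?I. ennreal (CARD('n) / h F) * vol (cone_over F)) \<le> (\<Sum>F\<in>?I. ennreal (CARD('n) / h F) * vol (\<Union>m. cone_over (K m F)))"
    using lower by (intro sum_mono mult_left_mono) auto
  also have "\<dots> \<le> hausdorff_measure (CARD('n) - 1) (frontier P)"
  proof (rule LIMSEQ_le_const2)
    show "(\<lambda>m. \<Sum>F\<in>?I. ennreal (CARD('n) / h F) * vol (cone_over (K m F))) \<longlonglongrightarrow> (\<Sum>F\<in>?I. ennreal (CARD('n) / h F) * vol (\<Union>m. cone_over (K m F)))"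
      using lim by (intro tendsto_sum ennreal_tendsto_cmult) auto
    show "\<exists>N. \<forall>m\<ge>N. (\<Sum>F\<in>?I. ennreal (CARD('n) / h F) * vol (cone_over (K m F))) \<le> hausdorff_measure (CARD('n) - 1) (frontier P)"
      using le by blast
  qed
  finally show ?thesis .
qed

text \<open>
All simplices of the flags are compared with a small ball around the origin inside \<open>P\<close>.  Those flags
that pass through a facet \<open>F\<close> at height \<open>h F\<close> have non-overlapping simplices in the cone over \<open>F\<close>.
The height cancels against \<open>norm (p F)\<close> in \<open>simplex_ball_comparison\<close>.
\<close>

lemma sqrt_codim_polytope_boundary_ge:
  fixes P :: "(real ^ 'n) set"
  assumes "sqrt_codim_polytope P"
  shows "of_nat (CARD('n) * 2 ^ CARD('n)) \<le> hausdorff_measure (CARD('n) - 1) (frontier P)"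
proof -
  let ?n = "CARD('n)"
  have n1: "1 \<le> ?n" by (simp add: Suc_leI)
  have P: "polytope P" "aff_dim P = int ?n" "0 \<in> interior P"
    and dist: "\<And>k F. k \<in> {1..?n} \<Longrightarrow> F face_of P \<Longrightarrow> F \<noteq> {} \<Longrightarrow> F \<noteq> P \<Longrightarrow> aff_dim F = int ?n - int k \<Longrightarrow> sqrt (real k) \<le> infdist 0 (affine hull F)"
    using assms unfolding sqrt_codim_polytope_def by auto
  define p where "p G = closest_point G (0 :: real ^ 'n)" for G
  have pin: "p G \<in> G" if "polytope G" "G \<noteq> {}" for G
    unfolding p_def using that by (intro closest_point_in_set polytope_imp_closed)
  \<comment> \<open>The origin itself is the vertex belonging to the top face.\<close>
  have pP: "p P = 0"
    unfolding p_def using P(3) interior_subset by (intro closest_point_self) blast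
  let ?\<Phi> = "flags p ?n P"
  have fin\<Phi>: "finite ?\<Phi>" by (rule finite_flags[OF P(1,2)])
  note flag = flag_properties[OF P(1,2)]
  have ex\<nu>: "\<forall>F. \<exists>\<nu> h. F facet_of P \<longrightarrow> norm \<nu> = 1 \<and> 0 < h \<and> F \<subseteq> {x. \<nu> \<bullet> x = h}"
    using facet_supporting_hyperplane[OF P(1,3)] by blast
  from choice[OF ex\<nu>] obtain \<nu> where "\<forall>F. \<exists>h. F facet_of P \<longrightarrow> norm (\<nu> F) = 1 \<and> 0 < h \<and> F \<subseteq> {x. \<nu> F \<bullet> x = h}" ..
  from choice[OF this] obtain h where "\<forall>F. F facet_of P \<longrightarrow> norm (\<nu> F) = 1 \<and> 0 < h F \<and> F \<subseteq> {x. \<nu> F \<bullet> x = h F}" ..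
  then have \<nu>: "\<And>F. F facet_of P \<Longrightarrow> norm (\<nu> F) = 1" and h: "\<And>F. F facet_of P \<Longrightarrow> 0 < h F"
    and hyp: "\<And>F. F facet_of P \<Longrightarrow> F \<subseteq> {x. \<nu> F \<bullet> x = h F}" by blast+
  let ?I = "{F. F facet_of P}"
  have finI: "finite ?I" using P(1) by (rule finite_polytope_facets)
  let ?T = "flag_simplex p"
  have Tm: "?T \<phi> \<in> lmeasurable" for \<phi> by (intro lmeasurable_compact compact_flag_simplex)
  have first: "\<phi> ! 1 facet_of P \<and> ?T \<phi> \<subseteq> cone_over (\<phi> ! 1) \<and> p (\<phi> ! 1) \<in> \<phi> ! 1" if \<phi>: "\<phi> \<in> ?\<Phi>" for \<phi>
  proof -
    obtain d where d: "?n = Suc d" using n1 by (cases ?n) auto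
    obtain F \<psi> where F: "F facet_of P" "\<phi> = P # \<psi>" "\<psi> \<in> flags p d F" using \<phi> unfolding d by auto
    have Fp: "polytope F" "aff_dim F = int d" using facet_of_polytope[OF P(1) _ F(1), of d] P(2) d by auto
    have hd: "\<psi> ! 0 = F" using flags_nonempty_list[OF F(3)] by auto
    have sub: "?T \<psi> \<subseteq> F" by (rule flag_simplex_subset[OF pin Fp F(3)])
    have "?T \<phi> \<subseteq> cone_over F"
    proof
      fix x assume "x \<in> ?T \<phi>"
      then have "x \<in> convex hull (insert 0 (?T \<psi>))" unfolding F(2) flag_simplex_Cons pP .
      from convex_hull_insert_convexE[OF convex_flag_simplex flag_simplex_nonempty[OF F(3)] this]
      obtain t b where "0 \<le> t" "t \<le> 1" "b \<in> ?T \<psi>" "x = (1 - t) *\<^sub>R 0 + t *\<^sub>R b" .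
      then show "x \<in> cone_over F" unfolding cone_over_def using sub by (intro image_eqI[of _ _ "(t, b)"]) auto
    qed
    moreover have "F \<noteq> {}" using F(1) by (auto simp: facet_of_def)
    ultimately show ?thesis using F hd pin[OF Fp(1)] by simp
  qed
  have gram: "real i \<le> p (\<phi> ! i) \<bullet> p (\<phi> ! j) \<and> p (\<phi> ! i) \<bullet> p (\<phi> ! i) \<le> p (\<phi> ! i) \<bullet> p (\<phi> ! j)"
    if \<phi>: "\<phi> \<in> ?\<Phi>" and ij: "1 \<le> i" "i \<le> j" "j \<le> ?n" for \<phi> i j
  proof -
    have Gi: "\<phi> ! i face_of P" "polytope (\<phi> ! i)" "aff_dim (\<phi> ! i) = int ?n - int i"
      and Gj: "polytope (\<phi> ! j)" "aff_dim (\<phi> ! j) = int ?n - int j"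
      using flag(2)[OF \<phi>, of i] flag(2)[OF \<phi>, of j] ij by auto
    have ne: "\<phi> ! i \<noteq> {}" "\<phi> ! j \<noteq> {}" "\<phi> ! i \<noteq> P" using Gi Gj ij P(2) by auto
    have mem: "p (\<phi> ! i) \<in> \<phi> ! i" "p (\<phi> ! j) \<in> \<phi> ! i"
      using pin Gi Gj ne flag(3)[OF \<phi> ij(2,3)] by auto
    \<comment> \<open>The point \<open>p\<^sub>j\<close> lies in \<open>F\<^sub>i\<close>, whose point nearest to the origin is \<open>p\<^sub>i\<close>.\<close>
    have "\<forall>z\<in>\<phi> ! i. dist 0 (p (\<phi> ! i)) \<le> dist 0 z"
      unfolding p_def using closest_point_exists(2)[OF polytope_imp_closed[OF Gi(2)] ne(1)] .
    then have "(0 - p (\<phi> ! i)) \<bullet> (p (\<phi> ! j) - p (\<phi> ! i)) \<le> 0"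
      using Gi mem by (intro any_closest_point_dot[of "\<phi> ! i"]) (auto simp: polytope_imp_convex polytope_imp_closed)
    then have le: "p (\<phi> ! i) \<bullet> p (\<phi> ! i) \<le> p (\<phi> ! i) \<bullet> p (\<phi> ! j)" by (simp add: inner_diff_right)
    have "sqrt (real i) \<le> infdist 0 (affine hull (\<phi> ! i))" using ij by (intro dist Gi ne) auto
    also have "\<dots> \<le> dist 0 (p (\<phi> ! i))" by (intro infdist_le hull_inc mem)
    finally have "sqrt (real i) \<le> norm (p (\<phi> ! i))" by simp
    then have "(sqrt (real i))\<^sup>2 \<le> (norm (p (\<phi> ! i)))\<^sup>2" by (intro power_mono) auto
    then have "real i \<le> p (\<phi> ! i) \<bullet> p (\<phi> ! i)" by (simp add: power2_norm_eq_inner)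
    with le show ?thesis by linarith
  qed
  obtain r where r: "0 < r" "cball 0 r \<subseteq> P" using P(3) by (auto simp: mem_interior_cball)
  let ?B = "lmeas (cball (0 :: real ^ 'n) r)"
  have B0: "0 < ?B"
    using content_cball_pos[OF r(1), of "0 :: real ^ 'n"] by simp
  have cmp: "real ?n * 2 ^ ?n * lmeas (cball 0 r \<inter> ?T \<phi>) \<le> ?B * (real ?n / h (\<phi> ! 1) * lmeas (?T \<phi>))"
    if \<phi>: "\<phi> \<in> ?\<Phi>" for \<phi>
  proof -
    let ?p = "\<lambda>k. p (\<phi> ! k)"
    have "p ` set \<phi> = insert 0 (?p ` {1..?n})"
    proof -
      have "\<phi> ! 0 = P" using flags_nonempty_list[OF \<phi>] by auto
      have "set \<phi> = (!) \<phi> ` {0..?n}" unfolding set_conv_nth using flag(1)[OF \<phi>] by (auto simp: image_iff less_Suc_eq_le)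
      also have "{0..?n} = insert 0 {1..?n}" by auto
      finally show ?thesis using \<open>\<phi> ! 0 = P\<close> pP by (simp add: image_image)
    qed
    then have T: "?T \<phi> = convex hull (insert 0 (?p ` {1..?n}))" by (simp add: flag_simplex_def)
    have main: "norm (?p 1) * 2 ^ ?n * lmeas (cball 0 r \<inter> ?T \<phi>) \<le> lmeas (?T \<phi>) * ?B"
      by (rule simplex_ball_comparison[OF _ _ T]) (use gram[OF \<phi>] in auto)
    have facet: "\<phi> ! 1 facet_of P" "?p 1 \<in> \<phi> ! 1" using first[OF \<phi>] by auto
    have h0: "0 < h (\<phi> ! 1)" by (rule h[OF facet(1)])
    \<comment> \<open>The nearest point of the facet is at least as far away as its hyperplane.\<close>
    have "h (\<phi> ! 1) = \<nu> (\<phi> ! 1) \<bullet> ?p 1" using hyp[OF facet(1)] facet(2) by auto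
    also have "\<dots> \<le> norm (\<nu> (\<phi> ! 1)) * norm (?p 1)" by (rule norm_cauchy_schwarz)
    finally have "h (\<phi> ! 1) \<le> norm (?p 1)" using \<nu>[OF facet(1)] by simp
    then have "h (\<phi> ! 1) * (2 ^ ?n * lmeas (cball 0 r \<inter> ?T \<phi>)) \<le> norm (?p 1) * (2 ^ ?n * lmeas (cball 0 r \<inter> ?T \<phi>))"
      by (intro mult_right_mono) auto
    also have "\<dots> \<le> lmeas (?T \<phi>) * ?B" using main by (simp add: mult.assoc)
    finally have "2 ^ ?n * lmeas (cball 0 r \<inter> ?T \<phi>) \<le> lmeas (?T \<phi>) * ?B / h (\<phi> ! 1)"
      using h0 by (simp add: pos_le_divide_eq mult.commute)
    then have "real ?n * (2 ^ ?n * lmeas (cball 0 r \<inter> ?T \<phi>)) \<le> real ?n * (lmeas (?T \<phi>) * ?B / h (\<phi> ! 1))"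
      by (rule mult_left_mono) simp
    then show ?thesis by (simp add: mult_ac)
  qed
  have cover: "?B \<le> (\<Sum>\<phi>\<in>?\<Phi>. lmeas (cball 0 r \<inter> ?T \<phi>))"
  proof -
    have "cball 0 r \<subseteq> (\<Union>\<phi>\<in>?\<Phi>. cball 0 r \<inter> ?T \<phi>)"
      using r(2) flag_simplices_cover[OF pin P(1,2)] by blast
    then have "?B \<le> lmeas (\<Union>\<phi>\<in>?\<Phi>. cball 0 r \<inter> ?T \<phi>)"
      by (intro measure_mono_fmeasurable fmeasurable.finite_UN fin\<Phi> sets.finite_UN sets.Int fmeasurable_Int_fmeasurable fmeasurableD[OF Tm] lmeasurable_cball) auto
    also have "\<dots> \<le> (\<Sum>\<phi>\<in>?\<Phi>. lmeas (cball 0 r \<inter> ?T \<phi>))"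
      by (intro measure_UNION_le fin\<Phi> sets.Int fmeasurableD[OF Tm]) auto
    finally show ?thesis .
  qed
  have facet_sum: "(\<Sum>\<phi>\<in>{\<phi> \<in> ?\<Phi>. \<phi> ! 1 = F}. lmeas (?T \<phi>)) \<le> lmeas (cone_over F)" if F: "F facet_of P" for F
  proof -
    have cF: "compact F" using F P(1) by (meson face_of_polytope_polytope facet_of_imp_face_of polytope_imp_compact)
    have "(\<Sum>\<phi>\<in>{\<phi> \<in> ?\<Phi>. \<phi> ! 1 = F}. lmeas (?T \<phi>)) = lmeas (\<Union>(?T ` {\<phi> \<in> ?\<Phi>. \<phi> ! 1 = F}))"
    proof (rule measure_negligible_finite_Union_image[symmetric])
      show "pairwise (\<lambda>x y. negligible (?T x \<inter> ?T y)) {\<phi> \<in> ?\<Phi>. \<phi> ! 1 = F}"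
        unfolding pairwise_def using flag_simplices_overlap[OF pin P(1,2)] by (auto intro!: negligible_aff_dim)
    qed (use fin\<Phi> Tm in auto)
    also have "\<dots> \<le> lmeas (cone_over F)"
    proof (rule measure_mono_fmeasurable)
      show "\<Union>(?T ` {\<phi> \<in> ?\<Phi>. \<phi> ! 1 = F}) \<subseteq> cone_over F" using first by blast
      show "\<Union>(?T ` {\<phi> \<in> ?\<Phi>. \<phi> ! 1 = F}) \<in> sets lebesgue" using fin\<Phi> Tm by (intro sets.finite_UN) auto
      show "cone_over F \<in> lmeasurable" by (intro lmeasurable_compact compact_cone_over cF)
    qed
    finally show ?thesis .
  qed
  have "real ?n * 2 ^ ?n * ?B \<le> (\<Sum>\<phi>\<in>?\<Phi>. real ?n * 2 ^ ?n * lmeas (cball 0 r \<inter> ?T \<phi>))"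
    using mult_left_mono[OF cover, of "real ?n * 2 ^ ?n"] by (simp add: sum_distrib_left)
  also have "\<dots> \<le> (\<Sum>\<phi>\<in>?\<Phi>. ?B * (real ?n / h (\<phi> ! 1) * lmeas (?T \<phi>)))"
    by (intro sum_mono cmp)
  also have "\<dots> = ?B * (\<Sum>\<phi>\<in>?\<Phi>. real ?n / h (\<phi> ! 1) * lmeas (?T \<phi>))"
    by (simp add: sum_distrib_left)
  finally have "real ?n * 2 ^ ?n \<le> (\<Sum>\<phi>\<in>?\<Phi>. real ?n / h (\<phi> ! 1) * lmeas (?T \<phi>))"
    using B0 by (simp add: mult.commute)
  also have "\<dots> = (\<Sum>F\<in>?I. \<Sum>\<phi>\<in>{\<phi> \<in> ?\<Phi>. \<phi> ! 1 = F}. real ?n / h (\<phi> ! 1) * lmeas (?T \<phi>))"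
    using first by (intro sum.group[symmetric] fin\<Phi> finI) auto
  also have "\<dots> = (\<Sum>F\<in>?I. real ?n / h F * (\<Sum>\<phi>\<in>{\<phi> \<in> ?\<Phi>. \<phi> ! 1 = F}. lmeas (?T \<phi>)))"
    by (intro sum.cong refl) (simp add: sum_distrib_left)
  also have "\<dots> \<le> (\<Sum>F\<in>?I. real ?n / h F * lmeas (cone_over F))"
    using h by (intro sum_mono mult_left_mono facet_sum) (auto intro: less_imp_le)
  finally have "ennreal (real ?n * 2 ^ ?n) \<le> ennreal (\<Sum>F\<in>?I. real ?n / h F * lmeas (cone_over F))"
    by (rule ennreal_leI)
  also have "\<dots> = (\<Sum>F\<in>?I. ennreal (real ?n / h F * lmeas (cone_over F)))"
    using h by (intro sum_ennreal[symmetric]) (auto intro!: mult_nonneg_nonneg divide_nonneg_nonneg simp: less_imp_le)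
  also have "\<dots> = (\<Sum>F\<in>?I. ennreal (real ?n / h F) * vol (cone_over F))"
  proof (intro sum.cong refl)
    fix F assume F: "F \<in> ?I"
    then have "compact F" using P(1) by (simp, meson face_of_polytope_polytope facet_of_imp_face_of polytope_imp_compact)
    then have c: "compact (cone_over F)" by (rule compact_cone_over)
    then have "vol (cone_over F) = ennreal (measure lborel (cone_over F))"
      using emeasure_compact_finite[OF c] by (intro emeasure_eq_ennreal_measure) auto
    moreover have "measure lborel (cone_over F) = lmeas (cone_over F)" using c by (simp add: borel_compact)
    moreover have "0 < h F" using F h by simp
    ultimately show "ennreal (real ?n / h F * lmeas (cone_over F)) = ennreal (real ?n / h F) * vol (cone_over F)"
      by (simp add: ennreal_mult[symmetric])
  qed
  also have "\<dots> \<le> hausdorff_measure (?n - 1) (frontier P)"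
    by (rule hausdorff_frontier_ge_facet_cones[OF P(1,2) \<nu> h hyp])
  finally show ?thesis by (simp add: ennreal_of_nat_eq_real_of_nat)
qed

section \<open>The cube\<close>

text \<open>
Let \<open>c\<close> be a relative interior point of \<open>F\<close> and \<open>J\<close> the set of its coordinates equal to \<open>\<plusminus> 1\<close>.  If
a point of \<open>F\<close> differed from \<open>c\<close> in a coordinate in \<open>J\<close>, the segment from it to \<open>c\<close> could be
prolonged beyond \<open>c\<close> inside \<open>F\<close>, which would leave the cube.  In the other coordinates one can move from \<open>c\<close> both ways inside the cube, hence, by the
definition of a face, inside \<open>F\<close>; so the dimension of \<open>F\<close> is at least \<open>n - card J\<close>.
\<close>

lemma cube_face_fixed_coordinates:
  fixes Q :: "(real ^ 'n) set"
  assumes Q: "Q = {x. \<forall>i. -1 \<le> x $ i \<and> x $ i \<le> 1}" and F: "F face_of Q" "F \<noteq> {}"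
  shows "\<exists>c J. (\<forall>j\<in>J. \<bar>c $ j\<bar> = 1) \<and> F \<subseteq> {x. \<forall>j\<in>J. x $ j = c $ j} \<and>
    int CARD('n) - int (card J) \<le> aff_dim F"
proof -
  have "convex F" using F(1) by (rule face_of_imp_convex)
  then obtain c where c: "c \<in> rel_interior F" using F(2) by (metis ex_in_conv rel_interior_eq_empty)
  have cF: "c \<in> F" using c rel_interior_subset by blast
  have FQ: "F \<subseteq> Q" using F(1) by (rule face_of_imp_subset)
  have cQ: "-1 \<le> c $ i" "c $ i \<le> 1" for i using cF FQ Q by auto
  define J where "J = {j. \<bar>c $ j\<bar> = 1}"
  show ?thesis
  proof (rule exI[of _ c], rule exI[of _ J], intro conjI ballI)
    show "\<bar>c $ j\<bar> = 1" if "j \<in> J" for j using that by (simp add: J_def)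
    show "F \<subseteq> {x. \<forall>j\<in>J. x $ j = c $ j}"
    proof clarify
      fix x j assume x: "x \<in> F" and j: "j \<in> J"
      show "x $ j = c $ j"
      proof (rule ccontr)
        assume ne: "x $ j \<noteq> c $ j"
        then have "x \<noteq> c" by auto
        obtain e where e: "1 < e" "(1 - e) *\<^sub>R x + e *\<^sub>R c \<in> F"
          using convex_rel_interior_if2[OF \<open>convex F\<close> c] hull_inc[OF x] by blast
        let ?y = "(1 - e) *\<^sub>R x + e *\<^sub>R c"
        have y: "-1 \<le> ?y $ j" "?y $ j \<le> 1" using e(2) FQ Q by auto
        have xj: "-1 \<le> x $ j" "x $ j \<le> 1" using x FQ Q by auto
        have yj: "?y $ j = c $ j + (e - 1) * (c $ j - x $ j)" by (simp add: algebra_simps)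
        consider "c $ j = 1" | "c $ j = -1" using j by (auto simp: J_def abs_if split: if_splits)
        then show False
        proof cases
          case 1
          then have "0 < (e - 1) * (c $ j - x $ j)" using ne xj e(1) by (intro mult_pos_pos) auto
          then show False using y(2) yj 1 by linarith
        next
          case 2
          then have "(e - 1) * (c $ j - x $ j) < 0" using ne xj e(1) by (intro mult_pos_neg) auto
          then show False using y(1) yj 2 by linarith
        qed
      qed
    qed
    have step: "\<exists>t>0. c + t *\<^sub>R axis i 1 \<in> F" if i: "i \<notin> J" for i
    proof -
      define t where "t = 1 - \<bar>c $ i\<bar>"
      have t: "0 < t" using i cQ[of i] by (auto simp: t_def J_def abs_if split: if_splits)
      have in_Q: "c + s *\<^sub>R axis i 1 \<in> Q" if s: "\<bar>s\<bar> \<le> t" for s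
        unfolding Q
      proof (rule CollectI, rule allI)
        fix k
        show "-1 \<le> (c + s *\<^sub>R axis i 1) $ k \<and> (c + s *\<^sub>R axis i 1) $ k \<le> 1"
          using cQ[of k] s by (cases "k = i") (auto simp: t_def axis_def abs_if split: if_splits)
      qed
      have pQ: "c + t *\<^sub>R axis i 1 \<in> Q" "c - t *\<^sub>R axis i 1 \<in> Q" using in_Q[of t] in_Q[of "- t"] t by auto
      have "c \<in> open_segment (c + t *\<^sub>R axis i 1) (c - t *\<^sub>R axis i 1)"
      proof -
        have "t *\<^sub>R axis i (1::real) \<noteq> 0" using t by (simp add: axis_eq_0_iff)
        then have "c + t *\<^sub>R axis i 1 \<noteq> c - t *\<^sub>R axis i 1"
        proof -
          have "(c + t *\<^sub>R axis i 1) - (c - t *\<^sub>R axis i 1) = 2 *\<^sub>R (t *\<^sub>R axis i 1)"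
          proof -
            have "(c + w) - (c - w) = 2 *\<^sub>R w" for w by (simp only: scaleR_2) simp
            then show ?thesis .
          qed
          then show ?thesis using \<open>t *\<^sub>R axis i (1::real) \<noteq> 0\<close> by (metis right_minus_eq scaleR_eq_0_iff zero_neq_numeral)
        qed
        moreover have "c = midpoint (c + t *\<^sub>R axis i 1) (c - t *\<^sub>R axis i 1)"
        proof -
          have "midpoint (c + w) (c - w) = c" for w by (simp add: midpoint_eq_iff)
          then show ?thesis by simp
        qed
        ultimately show ?thesis by (metis midpoint_in_open_segment)
      qed
      then have "c + t *\<^sub>R axis i 1 \<in> F" using face_ofD[OF F(1) _ pQ cF] by blast
      with t show ?thesis by blast
    qed
    let ?G = "(+) (- c) ` F"
    have "axis i 1 \<in> span ?G" if i: "i \<notin> J" for i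
    proof -
      obtain t where t: "0 < t" "c + t *\<^sub>R axis i 1 \<in> F" using step[OF i] by blast
      then have "t *\<^sub>R axis i 1 \<in> ?G" by (intro image_eqI[of _ _ "c + t *\<^sub>R axis i 1"]) auto
      then have "(1 / t) *\<^sub>R (t *\<^sub>R axis i 1) \<in> span ?G" by (intro span_scale span_base)
      then show ?thesis using t by simp
    qed
    then have "(\<lambda>i. axis i (1::real)) ` (- J) \<subseteq> span ?G" by blast
    moreover have "independent ((\<lambda>i. axis i (1::real)) ` (- J))"
      by (rule independent_mono[OF independent_Basis]) (auto simp: axis_in_Basis_iff)
    ultimately have "card ((\<lambda>i. axis i (1::real)) ` (- J) :: (real ^ 'n) set) \<le> dim ?G"
      using independent_card_le_dim dim_span by metis
    moreover have "card ((\<lambda>i. axis i (1::real)) ` (- J) :: (real ^ 'n) set) = CARD('n) - card J"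
      by (subst card_image) (auto simp: inj_on_def axis_eq_axis Compl_eq_Diff_UNIV card_Diff_subset)
    moreover have "aff_dim F = int (dim ?G)"
    proof -
      have "0 \<in> ?G" using cF by (intro image_eqI[of _ _ c]) auto
      then have "aff_dim ?G = int (dim ?G)" by (intro aff_dim_zero hull_inc)
      then show ?thesis by (simp only: aff_dim_translation_eq)
    qed
    ultimately show "int CARD('n) - int (card J) \<le> aff_dim F" by linarith
  qed
qed

text \<open>
A face of codimension \<open>k\<close> has at least \<open>k\<close> coordinates fixed at \<open>\<plusminus> 1\<close>, and so has its affine hull;
hence all points of the hull have norm at least \<open>sqrt k\<close>.
\<close>

lemma sqrt_codim_polytope_cube:
  assumes Q: "Q = {x :: real ^ 'n. \<forall>i. -1 \<le> x $ i \<and> x $ i \<le> 1}"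
  shows "sqrt_codim_polytope Q"
  unfolding sqrt_codim_polytope_def
proof (intro conjI ballI allI impI)
  have Qc: "Q = cbox (\<chi> i. -1) (\<chi> i. 1)" by (auto simp: Q mem_box_cart)
  show "polytope Q" unfolding Qc by (rule polytope_interval)
  show int: "0 \<in> interior Q" unfolding Qc interior_cbox by (simp add: mem_box_cart)
  then have "interior Q \<noteq> {}" by blast
  then show "aff_dim Q = int CARD('n)" by (simp add: aff_dim_nonempty_interior)
  fix k F assume k: "k \<in> {1..CARD('n)}" and F: "F face_of Q \<and> F \<noteq> {} \<and> F \<noteq> Q \<and> aff_dim F = int CARD('n) - int k"
  from F have "F face_of Q" "F \<noteq> {}" by blast+
  from cube_face_fixed_coordinates[OF Q this] obtain c J where
    "(\<forall>j\<in>J. \<bar>c $ j\<bar> = 1) \<and> F \<subseteq> {x. \<forall>j\<in>J. x $ j = c $ j} \<and> int CARD('n) - int (card J) \<le> aff_dim F"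
    by (elim exE)
  then have J: "\<And>j. j \<in> J \<Longrightarrow> \<bar>c $ j\<bar> = 1" "F \<subseteq> {x. \<forall>j\<in>J. x $ j = c $ j}"
    "int CARD('n) - int (card J) \<le> aff_dim F" by blast+
  have kJ: "k \<le> card J" using J(3) F by simp
  have "affine {x :: real ^ 'n. \<forall>j\<in>J. x $ j = c $ j}"
    by (auto simp: affine_def distrib_right[symmetric])
  then have hull: "affine hull F \<subseteq> {x. \<forall>j\<in>J. x $ j = c $ j}" using J(2) by (rule hull_minimal[rotated])
  have "affine hull F \<noteq> {}" using F by simp
  show "sqrt (real k) \<le> infdist 0 (affine hull F)"
    unfolding infdist_notempty[OF \<open>affine hull F \<noteq> {}\<close>]
  proof (rule cINF_greatest[OF \<open>affine hull F \<noteq> {}\<close>])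
    fix x assume "x \<in> affine hull F"
    then have xj: "x $ j = c $ j" if "j \<in> J" for j using hull that by blast
    have "real k \<le> (\<Sum>j\<in>J. (x $ j)\<^sup>2)"
    proof -
      have "(\<Sum>j\<in>J. (x $ j)\<^sup>2) = (\<Sum>j\<in>J. 1)" 
      proof (rule sum.cong[OF refl])
        fix j assume j: "j \<in> J"
        have "(x $ j)\<^sup>2 = \<bar>c $ j\<bar>\<^sup>2" using xj[OF j] by simp
        then show "(x $ j)\<^sup>2 = 1" using J(1)[OF j] by simp
      qed
      then show ?thesis using kJ by simp
    qed
    also have "\<dots> \<le> (\<Sum>j\<in>UNIV. (x $ j)\<^sup>2)" by (rule sum_mono2) auto
    finally have "sqrt (real k) \<le> sqrt (\<Sum>j\<in>UNIV. (x $ j)\<^sup>2)" by (rule real_sqrt_le_mono)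
    then show "sqrt (real k) \<le> dist 0 x" by (simp add: norm_vec_def L2_set_def)
  qed
qed

theorem theorem1p1:
  "(\<forall>P :: (real ^ 'n) set. sqrt_codim_polytope P \<longrightarrow>
      hausdorff_measure (CARD('n) - 1) (frontier P) \<ge> of_nat (CARD('n) * 2 ^ CARD('n))) \<and>
   (let Q = {x :: real ^ 'n. \<forall>i. -1 \<le> x $ i \<and> x $ i \<le> 1} in
      sqrt_codim_polytope Q \<and>
      hausdorff_measure (CARD('n) - 1) (frontier Q) = of_nat (CARD('n) * 2 ^ CARD('n)))"
proof -
  define Q where "Q = {x :: real ^ 'n. \<forall>i. -1 \<le> x $ i \<and> x $ i \<le> 1}"
  have Q: "sqrt_codim_polytope Q" by (rule sqrt_codim_polytope_cube[OF Q_def])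
  have Qc: "Q = cbox (\<chi> i. -1) (\<chi> i. 1)" by (auto simp: Q_def mem_box_cart)
  have "frontier Q \<subseteq> {x. (\<forall>i. -1 \<le> x $ i \<and> x $ i \<le> 1) \<and> (\<exists>i. x $ i = -1 \<or> x $ i = 1)}"
  proof
    fix x assume "x \<in> frontier Q"
    then have x: "x \<in> cbox (\<chi> i. -1) (\<chi> i. 1)" "x \<notin> box (\<chi> i. -1) (\<chi> i. 1)"
      unfolding Qc frontier_cbox by (auto split: if_splits)
    then obtain i where "\<not> (-1 < x $ i \<and> x $ i < 1)" "\<forall>i. -1 \<le> x $ i \<and> x $ i \<le> 1" by (auto simp: mem_box_cart)
    then show "x \<in> {x. (\<forall>i. -1 \<le> x $ i \<and> x $ i \<le> 1) \<and> (\<exists>i. x $ i = -1 \<or> x $ i = 1)}"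
    proof -
      assume x: "\<not> (-1 < x $ i \<and> x $ i < 1)" "\<forall>i. -1 \<le> x $ i \<and> x $ i \<le> 1"
      then have "-1 \<le> x $ i \<and> x $ i \<le> 1" by blast
      with x(1) have "x $ i = -1 \<or> x $ i = 1" by linarith
      with x(2) show ?thesis by blast
    qed
  qed
  then have "hausdorff_measure (CARD('n) - 1) (frontier Q) \<le> of_nat (CARD('n) * 2 ^ CARD('n))"
    by (rule hausdorff_cube_boundary_le)
  moreover have "of_nat (CARD('n) * 2 ^ CARD('n)) \<le> hausdorff_measure (CARD('n) - 1) (frontier Q)"
    by (rule sqrt_codim_polytope_boundary_ge[OF Q])
  ultimately have eq: "hausdorff_measure (CARD('n) - 1) (frontier Q) = of_nat (CARD('n) * 2 ^ CARD('n))"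
    by (rule order.antisym)
  show ?thesis
    unfolding Let_def Q_def[symmetric]
    by (intro conjI allI impI sqrt_codim_polytope_boundary_ge Q eq)
qed

end
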